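(* Let $K\in\mathcal K_{\mathbb F}(S,T;\mathbb R^{d\times d})$ be a $\star$-Volterra kernel. Assume that $$\operatorname*{ess\,sup}_{t\in(S,T)}|\mathfrak F_0[K](t)|_{\mathrm{op}}<1$$ and that there exists a nonnegative function $a\in L^2(0,T-S;\mathbb R)$ satisfying $$|\mathfrak F_n[K](t_0,t_1,\dots,t_n)|_{\mathrm{op}}\le\prod_{i=1}^na(t_{i-1}-t_i),\quad(t_0,t_1,\dots,t_n)\in\Delta_{n+1}(S,T),$$ for every $n\in\mathbb N$. Then $K$ has a $\star$-resolvent $R\in\mathcal K_{\mathbb F}(S,T;\mathbb R^{d\times d})$ on $(S,T)$.
   Context: Fix $0\le S<T<\infty$ and $d\in\mathbb N$; $\mathbb N_0=\mathbb N\cup\{0\}$. $(\Omega,\mathcal F,\mathbb P)$ is a complete probability space with a one-dimensional Brownian motion $W$; for $s\le t$, $\mathcal F^s_t$ is the $\mathbb P$-augmentation of the $\sigma$-field generated by $W(r)-W(s)$, $s\le r\le t$. $\Delta_n(S,T)=\{(t_1,\dots,t_n): T>t_1>\cdots>t_n>S\}$. $|A|$ is the Frobenius norm and $|A|_{\mathrm{op}}$ the operator norm. $L^2_{\mathbb F}(S,T;\mathbb R^{d\times d})$ is the space of measurable processes $\xi$ on $(S,T)$ with $\xi(t)$ $\mathcal F^S_t$-measurable and $\mathbb E\int_S^T|\xi(t)|^2dt<\infty$. Put $\mathfrak W_0[f_0](t)=f_0(t)$ and $\mathfrak W_n[f_n](t)=\int_S^t\int_S^{t_1}\cdots\int_S^{t_{n-1}}f_n(t,t_1,\dots,t_n)\,dW(t_n)\cdots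 dW(t_1)$ for deterministic $f_n\in L^2(\Delta_{n+1}(S,T))$; each $\xi\in L^2_{\mathbb F}(S,T)$ is uniquely $\xi=\sum_{n\ge0}\mathfrak W_n[\mathfrak F_n[\xi]]$ with $\mathfrak F_n[\xi]\in L^2(\Delta_{n+1}(S,T))$ (Wiener–Itô chaos expansion). $\mathcal V_{n+1}(S,T;\mathbb R^{d\times d})$ is the set of measurable $k:\Delta_{n+1}(S,T)\to\mathbb R^{d\times d}$ with finite norm $\|k\|_{\mathcal V_1(S,T)}=\operatorname{ess\,sup}_t|k(t)|_{\mathrm{op}}$ (if $n=0$), $\|k\|_{\mathcal V_{n+1}(S,T)}=\operatorname{ess\,sup}_{t\in(S,T)}(\int_{\Delta_n(t,T)}|k(s,t)|_{\mathrm{op}}^2ds)^{1/2}$ (if $n\ge1$). The space of $\star$-Volterra kernels $\mathcal K_{\mathbb F}(S,T;\mathbb R^{d\times d})$ is the set of $K\in L^2_{\mathbb F}(S,T;\mathbb R^{d\times d})$ with $\mathfrak F_n[K]\in\mathcal V_{n+1}(S,T;\mathbb R^{d\times d})$ for all $n\in\mathbb N_0$ and $\sum_{n\ge0}\|\mathfrak F_n[K]\|_{\mathcal V_{n+1}(S,T)}<\infty$. For $f$ on $\Delta_{m+1}(S,T)$ and $g$ on $\Delta_{n+1}(S,T)$ ($m,n\in\mathbb N_0$), $(f\triangleright g)(t_0,\dots,t_{m+n})=f(t_0,\dots,t_m)g(t_m,\dots,t_{m+n})$. For $K_1,K_2\in\mathcal K_{\mathbb F}(S,T;\mathbb R^{d\times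 d})$, $K_1\star K_2\in\mathcal K_{\mathbb F}(S,T;\mathbb R^{d\times d})$ is defined by $\mathfrak F_n[K_1\star K_2]=\sum_{k=0}^n\mathfrak F_{n-k}[K_1]\triangleright\mathfrak F_k[K_2]$, $n\in\mathbb N_0$. $R\in\mathcal K_{\mathbb F}(S,T;\mathbb R^{d\times d})$ is a $\star$-resolvent of $K$ if $R=K+K\star R=K+R\star K$. *)

theory Defs
  imports "HOL-Probability.Probability"
begin

section \<open>Brownian motion and its filtration\<close>

definition brownian_motion :: "'w measure \<Rightarrow> (real \<Rightarrow> 'w \<Rightarrow> real) \<Rightarrow> bool" where
  "brownian_motion M W \<longleftrightarrow>
     (\<forall>t\<ge>0. W t \<in> borel_measurable M) \<and>
     (AE \<omega> in M. W 0 \<omega> = 0) \<and>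
     (\<forall>s t. 0 \<le> s \<longrightarrow> s < t \<longrightarrow>
        distributed M lborel (\<lambda>\<omega>. W t \<omega> - W s \<omega>) (normal_density 0 (sqrt (t - s)))) \<and>
     (\<forall>(n::nat) (\<tau>::nat \<Rightarrow> real). 0 \<le> \<tau> 0 \<longrightarrow> (\<forall>i<n. \<tau> i \<le> \<tau> (Suc i)) \<longrightarrow>
        prob_space.indep_vars M (\<lambda>_. borel) (\<lambda>i \<omega>. W (\<tau> (Suc i)) \<omega> - W (\<tau> i) \<omega>) {..<n}) \<and>
     (AE \<omega> in M. continuous_on {0..} (\<lambda>t. W t \<omega>))"

definition aug_filtration :: "'w measure \<Rightarrow> (real \<Rightarrow> 'w \<Rightarrow> real) \<Rightarrow> real \<Rightarrow> real \<Rightarrow> 'w measure" where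
  "aug_filtration M W s t =
     sigma (space M)
       ({(\<lambda>\<omega>. W r \<omega> - W s \<omega>) -` A \<inter> space M | r A. r \<in> {s..t} \<and> A \<in> sets borel} \<union> null_sets M)"


section \<open>Square-integrable adapted processes\<close>

text \<open>Processes are functions of time and scenario; values at times outside \<open>{S<..<T}\<close> are
  irrelevant.  On matrices, the library norm is the Frobenius norm.\<close>

abbreviation time_interval :: "real \<Rightarrow> real \<Rightarrow> real measure" where
  "time_interval S T \<equiv> restrict_space lborel {S<..<T}"

definition process_sqnorm ::
    "'w measure \<Rightarrow> real \<Rightarrow> real \<Rightarrow> (real \<Rightarrow> 'w \<Rightarrow> 'b::real_normed_vector) \<Rightarrow> ennreal" where
  "process_sqnorm M S T \<xi> = (\<integral>\<^sup>+\<omega>. (\<integral>\<^sup>+t. ennreal ((norm (\<xi> t \<omega>))\<^sup>2) \<partial>time_interval S T) \<partial>M)"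

definition L2_adapted ::
    "'w measure \<Rightarrow> (real \<Rightarrow> 'w \<Rightarrow> real) \<Rightarrow> real \<Rightarrow> real \<Rightarrow> (real \<Rightarrow> 'w \<Rightarrow> 'b::euclidean_space) set" where
  "L2_adapted M W S T =
     {\<xi>. (\<lambda>(t, \<omega>). \<xi> t \<omega>) \<in> borel_measurable (time_interval S T \<Otimes>\<^sub>M M) \<and>
          (\<forall>t\<in>{S<..<T}. \<xi> t \<in> borel_measurable (aug_filtration M W S t)) \<and>
          process_sqnorm M S T \<xi> < \<infinity>}"

text \<open>Equality of elements of this \<open>L\<^sup>2\<close> space.\<close>

definition process_eq ::
    "'w measure \<Rightarrow> real \<Rightarrow> real \<Rightarrow> (real \<Rightarrow> 'w \<Rightarrow> 'b) \<Rightarrow> (real \<Rightarrow> 'w \<Rightarrow> 'b) \<Rightarrow> bool" where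
  "process_eq M S T \<xi> \<zeta> \<longleftrightarrow> (AE (t, \<omega>) in time_interval S T \<Otimes>\<^sub>M M. \<xi> t \<omega> = \<zeta> t \<omega>)"


section \<open>The Ito integral\<close>

text \<open>The simple process with partition \<open>S = p 0 \<le> \<dots> \<le> p N = u\<close> has the value \<open>\<eta> i\<close> on
  \<open>{p i<..p (Suc i)}\<close>, which is bounded and known at time \<open>p i\<close>.\<close>

definition simple_data ::
    "'w measure \<Rightarrow> (real \<Rightarrow> 'w \<Rightarrow> real) \<Rightarrow> real \<Rightarrow> real \<Rightarrow> nat \<Rightarrow> (nat \<Rightarrow> real) \<Rightarrow>
     (nat \<Rightarrow> 'w \<Rightarrow> 'b::euclidean_space) \<Rightarrow> bool" where
  "simple_data M W S u N p \<eta> \<longleftrightarrow>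
     p 0 = S \<and> p N = u \<and> (\<forall>i<N. p i \<le> p (Suc i)) \<and>
     (\<forall>i<N. \<eta> i \<in> borel_measurable (aug_filtration M W S (p i)) \<and>
            (\<exists>B. \<forall>\<omega>\<in>space M. norm (\<eta> i \<omega>) \<le> B))"

definition simple_process ::
    "nat \<Rightarrow> (nat \<Rightarrow> real) \<Rightarrow> (nat \<Rightarrow> 'w \<Rightarrow> 'b::euclidean_space) \<Rightarrow> real \<Rightarrow> 'w \<Rightarrow> 'b" where
  "simple_process N p \<eta> t \<omega> = (\<Sum>i<N. indicat_real {p i<..p (Suc i)} t *\<^sub>R \<eta> i \<omega>)"

definition simple_integral ::
    "(real \<Rightarrow> 'w \<Rightarrow> real) \<Rightarrow> nat \<Rightarrow> (nat \<Rightarrow> real) \<Rightarrow> (nat \<Rightarrow> 'w \<Rightarrow> 'b::euclidean_space) \<Rightarrow> 'w \<Rightarrow> 'b" where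
  "simple_integral W N p \<eta> \<omega> = (\<Sum>i<N. (W (p (Suc i)) \<omega> - W (p i) \<omega>) *\<^sub>R \<eta> i \<omega>)"

text \<open>\<open>X\<close> is a version of \<open>\<integral>\<^sub>S\<^sup>u Y(s) dW(s)\<close>: an \<open>L\<^sup>2\<close> limit of integrals of simple processes
  that converge to \<open>Y\<close>.\<close>

definition has_ito_integral ::
    "'w measure \<Rightarrow> (real \<Rightarrow> 'w \<Rightarrow> real) \<Rightarrow> real \<Rightarrow> real \<Rightarrow>
     (real \<Rightarrow> 'w \<Rightarrow> 'b::euclidean_space) \<Rightarrow> ('w \<Rightarrow> 'b) \<Rightarrow> bool" where
  "has_ito_integral M W S u Y X \<longleftrightarrow>
     Y \<in> L2_adapted M W S u \<and> X \<in> borel_measurable M \<and>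
     (\<exists>N p \<eta>. (\<forall>k::nat. simple_data M W S u (N k) (p k) (\<eta> k)) \<and>
        (\<lambda>k. process_sqnorm M S u (\<lambda>t \<omega>. simple_process (N k) (p k) (\<eta> k) t \<omega> - Y t \<omega>))
           \<longlonglongrightarrow> 0 \<and>
        (\<lambda>k. \<integral>\<^sup>+\<omega>. ennreal ((norm (simple_integral W (N k) (p k) (\<eta> k) \<omega> - X \<omega>))\<^sup>2) \<partial>M)
           \<longlonglongrightarrow> 0)"


section \<open>Simplices and iterated integrals\<close>

text \<open>A point \<open>(t\<^sub>1, \<dots>, t\<^sub>n)\<close> is an extensional function on \<open>{..<n}\<close>, indexed from \<open>0\<close>; the
  reference measure is \<open>n\<close>-dimensional Lebesgue measure (on Borel sets; for \<open>n = 0\<close>, a unit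
  point mass).  Functions on a simplex only matter up to null sets, so Borel measurability loses
  no generality.\<close>

definition ord_simplex :: "nat \<Rightarrow> real \<Rightarrow> real \<Rightarrow> (nat \<Rightarrow> real) set" where
  "ord_simplex n S T =
     {t. t \<in> extensional {..<n} \<and> (\<forall>i<n. S < t i \<and> t i < T) \<and> (\<forall>i j. i < j \<longrightarrow> j < n \<longrightarrow> t j < t i)}"

definition simplex_measure :: "nat \<Rightarrow> real \<Rightarrow> real \<Rightarrow> (nat \<Rightarrow> real) measure" where
  "simplex_measure n S T = restrict_space (Pi\<^sub>M {..<n} (\<lambda>_. lborel)) (ord_simplex n S T)"

definition L2_simplex :: "nat \<Rightarrow> real \<Rightarrow> real \<Rightarrow> ((nat \<Rightarrow> real) \<Rightarrow> 'b::euclidean_space) set" where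
  "L2_simplex n S T =
     {f \<in> borel_measurable (simplex_measure n S T).
        (\<integral>\<^sup>+t. ennreal ((norm (f t))\<^sup>2) \<partial>simplex_measure n S T) < \<infinity>}"

text \<open>\<open>X\<close> is a version of
  \<open>\<integral>\<^sub>S\<^sup>u \<integral>\<^sub>S\<^bsup>t\<^sub>1\<^esup> \<dots> f(t\<^sub>1, \<dots>, t\<^sub>n) dW(t\<^sub>n) \<dots> dW(t\<^sub>1)\<close>.  Here \<open>case_nat s r\<close> prepends \<open>s\<close> to the
  tuple \<open>r\<close>, and \<open>\<lambda>_. undefined\<close> is the empty tuple; \<open>Y s\<close> is the integral over \<open>t\<^sub>2, \<dots>, t\<^sub>n\<close>
  with \<open>t\<^sub>1 = s\<close>.\<close>

primrec has_iterated_integral ::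
    "'w measure \<Rightarrow> (real \<Rightarrow> 'w \<Rightarrow> real) \<Rightarrow> real \<Rightarrow> nat \<Rightarrow> real \<Rightarrow>
     ((nat \<Rightarrow> real) \<Rightarrow> 'b::euclidean_space) \<Rightarrow> ('w \<Rightarrow> 'b) \<Rightarrow> bool" where
  "has_iterated_integral M W S 0 u f X \<longleftrightarrow>
     X \<in> borel_measurable M \<and> (AE \<omega> in M. X \<omega> = f (\<lambda>_. undefined))"
| "has_iterated_integral M W S (Suc n) u f X \<longleftrightarrow>
     (\<exists>Y. (AE s in time_interval S u.
             has_iterated_integral M W S n s (\<lambda>r. f (case_nat s r)) (Y s)) \<and>
          has_ito_integral M W S u Y X)"

text \<open>\<open>\<xi>\<close> is a version of the process \<open>\<WW>\<^sub>n[f]\<close>, where \<open>f\<close> is a function of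
  \<open>(t, t\<^sub>1, \<dots>, t\<^sub>n)\<close>.\<close>

definition is_wiener_chaos ::
    "'w measure \<Rightarrow> (real \<Rightarrow> 'w \<Rightarrow> real) \<Rightarrow> real \<Rightarrow> real \<Rightarrow> nat \<Rightarrow>
     ((nat \<Rightarrow> real) \<Rightarrow> 'b::euclidean_space) \<Rightarrow> (real \<Rightarrow> 'w \<Rightarrow> 'b) \<Rightarrow> bool" where
  "is_wiener_chaos M W S T n f \<xi> \<longleftrightarrow>
     \<xi> \<in> L2_adapted M W S T \<and>
     (AE t in time_interval S T. has_iterated_integral M W S n t (\<lambda>r. f (case_nat t r)) (\<xi> t))"

text \<open>\<open>\<xi> = (\<Sum>n. \<WW>\<^sub>n[f n])\<close>, with convergence in the space of square-integrable adapted
  processes.\<close>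

definition has_chaos_expansion ::
    "'w measure \<Rightarrow> (real \<Rightarrow> 'w \<Rightarrow> real) \<Rightarrow> real \<Rightarrow> real \<Rightarrow>
     (real \<Rightarrow> 'w \<Rightarrow> 'b::euclidean_space) \<Rightarrow> (nat \<Rightarrow> (nat \<Rightarrow> real) \<Rightarrow> 'b) \<Rightarrow> bool" where
  "has_chaos_expansion M W S T \<xi> f \<longleftrightarrow>
     (\<forall>n. f n \<in> L2_simplex (Suc n) S T) \<and>
     (\<exists>\<Xi>. (\<forall>n. is_wiener_chaos M W S T n (f n) (\<Xi> n)) \<and>
          (\<lambda>N. process_sqnorm M S T (\<lambda>t \<omega>. \<xi> t \<omega> - (\<Sum>n<N. \<Xi> n t \<omega>))) \<longlonglongrightarrow> 0)"

text \<open>The sequence of chaos coefficients of \<open>\<xi>\<close>.  By the Wiener--Ito theorem it exists for every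
  square-integrable adapted process and is unique up to null sets, so only statements that are
  invariant under changes on null sets are meaningful for it.\<close>

definition chaos_coeff ::
    "'w measure \<Rightarrow> (real \<Rightarrow> 'w \<Rightarrow> real) \<Rightarrow> real \<Rightarrow> real \<Rightarrow>
     (real \<Rightarrow> 'w \<Rightarrow> 'b::euclidean_space) \<Rightarrow> nat \<Rightarrow> (nat \<Rightarrow> real) \<Rightarrow> 'b" where
  "chaos_coeff M W S T \<xi> = (SOME f. has_chaos_expansion M W S T \<xi> f)"


section \<open>Volterra kernels\<close>

definition op_norm :: "real^'d^'d \<Rightarrow> real" where
  "op_norm A = onorm (\<lambda>x. A *v x)"

definition sqrt_ennreal :: "ennreal \<Rightarrow> ennreal" where
  "sqrt_ennreal x = (if x = \<infinity> then \<infinity> else ennreal (sqrt (enn2real x)))"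

text \<open>The norm of the space \<open>\<V>\<close> with index \<open>n + 1\<close>.  For \<open>s \<in> ord_simplex n t T\<close>, the update
  \<open>s(n := t)\<close> is the point \<open>(s\<^sub>1, \<dots>, s\<^sub>n, t)\<close>.\<close>

definition volterra_norm :: "real \<Rightarrow> real \<Rightarrow> nat \<Rightarrow> ((nat \<Rightarrow> real) \<Rightarrow> real^'d^'d) \<Rightarrow> ennreal" where
  "volterra_norm S T n k =
     (if n = 0 then esssup (time_interval S T) (\<lambda>t. ennreal (op_norm (k (\<lambda>i\<in>{..<1}. t))))
      else esssup (time_interval S T)
             (\<lambda>t. sqrt_ennreal
                    (\<integral>\<^sup>+s. ennreal ((op_norm (k (s(n := t))))\<^sup>2) \<partial>simplex_measure n t T)))"

definition volterra_space :: "real \<Rightarrow> real \<Rightarrow> nat \<Rightarrow> ((nat \<Rightarrow> real) \<Rightarrow> real^'d^'d) set" where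
  "volterra_space S T n =
     {k \<in> borel_measurable (simplex_measure (Suc n) S T). volterra_norm S T n k < \<infinity>}"

text \<open>The membership condition \<open>has_chaos_expansion\<close> says that \<open>chaos_coeff\<close> is what its name
  says; by the Wiener--Ito theorem it is no restriction.\<close>

definition star_kernels ::
    "'w measure \<Rightarrow> (real \<Rightarrow> 'w \<Rightarrow> real) \<Rightarrow> real \<Rightarrow> real \<Rightarrow> (real \<Rightarrow> 'w \<Rightarrow> real^'d^'d) set" where
  "star_kernels M W S T =
     {K \<in> L2_adapted M W S T.
        has_chaos_expansion M W S T K (chaos_coeff M W S T K) \<and>
        (\<forall>n. chaos_coeff M W S T K n \<in> volterra_space S T n) \<and>
        (\<Sum>n. volterra_norm S T n (chaos_coeff M W S T K n)) < \<infinity>}"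

definition triangle_prod ::
    "nat \<Rightarrow> nat \<Rightarrow> ((nat \<Rightarrow> real) \<Rightarrow> real^'d^'d) \<Rightarrow> ((nat \<Rightarrow> real) \<Rightarrow> real^'d^'d) \<Rightarrow>
     (nat \<Rightarrow> real) \<Rightarrow> real^'d^'d" where
  "triangle_prod m n f g t = f (\<lambda>i\<in>{..m}. t i) ** g (\<lambda>i\<in>{..n}. t (m + i))"

text \<open>\<open>K\<^sub>1 \<star> K\<^sub>2\<close>, determined up to \<open>process_eq\<close>.\<close>

definition star_prod ::
    "'w measure \<Rightarrow> (real \<Rightarrow> 'w \<Rightarrow> real) \<Rightarrow> real \<Rightarrow> real \<Rightarrow>
     (real \<Rightarrow> 'w \<Rightarrow> real^'d^'d) \<Rightarrow> (real \<Rightarrow> 'w \<Rightarrow> real^'d^'d) \<Rightarrow> (real \<Rightarrow> 'w \<Rightarrow> real^'d^'d)" where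
  "star_prod M W S T K\<^sub>1 K\<^sub>2 =
     (SOME Z. Z \<in> star_kernels M W S T \<and>
        (\<forall>n. AE t in simplex_measure (Suc n) S T.
           chaos_coeff M W S T Z n t =
             (\<Sum>k=0..n. triangle_prod (n - k) k
                (chaos_coeff M W S T K\<^sub>1 (n - k)) (chaos_coeff M W S T K\<^sub>2 k) t)))"

definition star_resolvent ::
    "'w measure \<Rightarrow> (real \<Rightarrow> 'w \<Rightarrow> real) \<Rightarrow> real \<Rightarrow> real \<Rightarrow>
     (real \<Rightarrow> 'w \<Rightarrow> real^'d^'d) \<Rightarrow> (real \<Rightarrow> 'w \<Rightarrow> real^'d^'d) \<Rightarrow> bool" where
  "star_resolvent M W S T K R \<longleftrightarrow>
     R \<in> star_kernels M W S T \<and>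
     process_eq M S T R (\<lambda>t \<omega>. K t \<omega> + star_prod M W S T K R t \<omega>) \<and>
     process_eq M S T R (\<lambda>t \<omega>. K t \<omega> + star_prod M W S T R K t \<omega>)"

end

theory Submission
  imports Defs
begin

text \<open>Kernel sequences \<open>(f\<^sub>n)\<close> with \<open>f\<^sub>n\<close> a function on the simplex of dimension \<open>n + 1\<close> form a graded
  algebra under \<open>\<triangleright>\<close>-convolution, and a resolvent is \<open>(1 - K)\<^sup>-\<^sup>1 - 1\<close> in it.  Since \<open>|k\<^sub>0| < 1\<close>, the order
  \<open>0\<close> part of \<open>1 - K\<close> is inverted pointwise by a Neumann series, and the higher orders follow by recursion;
  with \<open>C = 1 / (1 - q)\<close> this gives coefficients bounded by \<open>C (1 + C)\<^sup>n\<close> times the product of the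
  \<open>a(t\<^sub>i\<^sub>-\<^sub>1 - t\<^sub>i)\<close>.  Replacing \<open>a(x)\<^sup>2\<close> by \<open>a(x)\<^sup>2 exp(- l x)\<close> for large \<open>l\<close> costs only a bounded factor and
  makes the norms of these products smaller than any geometric sequence, so the coefficients are those of
  a \<open>\<star>\<close>-Volterra kernel \<open>R\<close>.

  Turning coefficients into processes requires the Wiener--Ito theory: existence of iterated integrals
  (by density of indicators of products of ordered intervals) and the isometry.  The latter shows that the
  distance of two processes is determined by their coefficients, hence coefficients are unique and
  determine the process, so that \<open>R - K\<close> is a version of both \<open>K \<star> R\<close> and \<open>R \<star> K\<close>.\<close>

section \<open>Square-integrable functions\<close>

text \<open>At each level the definition of an iterated integral asks for one adapted, jointly
  measurable process whose value at almost every time is a version of the inner integral. Such a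
  process cannot be assembled from versions picked separately at each time. It is therefore built
  where it is explicit, for kernels on boxes with ordered sides, whose inner integral is a fixed
  random variable, and then as an L2 limit, since the isometry turns Cauchy sequences of kernels
  into Cauchy sequences of processes. All norms are squared and take values in
  \<open>ennreal\<close>. The triangle inequality then has factors 2, or weights
  \<open>1 + e\<close> and \<open>1 + 1/e\<close> where limits of norms have to be exact. Bounds on
  coefficients hold only almost everywhere, while the recursion for the inverse evaluates kernels on
  windows of a point and wants the bounds at every point. The kernel is therefore first changed on
  null sets, and the algebra is then done pointwise.\<close>

definition l2sq :: "'a measure \<Rightarrow> ('a \<Rightarrow> 'b::euclidean_space) \<Rightarrow> ennreal" where
  "l2sq N f = (\<integral>\<^sup>+x. ennreal ((norm (f x))\<^sup>2) \<partial>N)"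

lemma l2sq_cong_AE: "AE x in N. f x = g x \<Longrightarrow> l2sq N f = l2sq N g"
  unfolding l2sq_def by (rule nn_integral_cong_AE) auto

lemma l2sq_cong: "(\<And>x. x \<in> space N \<Longrightarrow> f x = g x) \<Longrightarrow> l2sq N f = l2sq N g"
  unfolding l2sq_def by (rule nn_integral_cong) auto

lemma l2sq_zero [simp]: "l2sq N (\<lambda>x. 0) = 0"
  by (simp add: l2sq_def)

lemma l2sq_eq_0_iff:
  assumes [measurable]: "f \<in> borel_measurable N"
  shows "l2sq N f = 0 \<longleftrightarrow> (AE x in N. f x = 0)"
  unfolding l2sq_def by (subst nn_integral_0_iff_AE) (auto simp: ennreal_eq_0_iff)

text \<open>Young's inequality for \<open>2 * (x \<bullet> y)\<close>. As \<open>e\<close> tends to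
  0 the weight of the first term tends to 1, which gives exact limits of norms whenever the second
  term is negligible.\<close>

lemma norm_add_sq_le:
  fixes x y :: "'b::real_inner"
  assumes "e > 0"
  shows "(norm (x + y))\<^sup>2 \<le> (1 + e) * (norm x)\<^sup>2 + (1 + 1/e) * (norm y)\<^sup>2"
proof -
  have "0 \<le> (e *\<^sub>R x - y) \<bullet> (e *\<^sub>R x - y)" by simp
  also have "\<dots> = e\<^sup>2 * (norm x)\<^sup>2 - 2 * e * (x \<bullet> y) + (norm y)\<^sup>2"
    unfolding power2_norm_eq_inner
    by (simp add: inner_diff inner_commute[of y x] power2_eq_square algebra_simps)
  finally have "2 * e * (x \<bullet> y) \<le> e\<^sup>2 * (norm x)\<^sup>2 + (norm y)\<^sup>2" by simp
  then have "2 * (x \<bullet> y) \<le> e * (norm x)\<^sup>2 + (1/e) * (norm y)\<^sup>2"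
    using assms by (simp add: field_simps power2_eq_square)
  moreover have "(norm (x + y))\<^sup>2 = (norm x)\<^sup>2 + 2 * (x \<bullet> y) + (norm y)\<^sup>2"
    by (simp add: power2_norm_eq_inner inner_add inner_commute)
  ultimately show ?thesis by (simp add: algebra_simps)
qed

lemma l2sq_add_le:
  assumes [measurable]: "f \<in> borel_measurable N" "g \<in> borel_measurable N" and "e > 0"
  shows "l2sq N (\<lambda>x. f x + g x) \<le> ennreal (1 + e) * l2sq N f + ennreal (1 + 1/e) * l2sq N g"
proof -
  have "l2sq N (\<lambda>x. f x + g x)
      \<le> (\<integral>\<^sup>+x. ennreal (1 + e) * ennreal ((norm (f x))\<^sup>2) + ennreal (1 + 1/e) * ennreal ((norm (g x))\<^sup>2) \<partial>N)"
    unfolding l2sq_def using norm_add_sq_le[OF \<open>e > 0\<close>] \<open>e > 0\<close>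
    by (intro nn_integral_mono)
      (auto simp: ennreal_mult'[symmetric] ennreal_plus[symmetric] simp del: ennreal_plus)
  also have "\<dots> = ennreal (1 + e) * l2sq N f + ennreal (1 + 1/e) * l2sq N g"
    unfolding l2sq_def by (simp add: nn_integral_add nn_integral_cmult)
  finally show ?thesis .
qed

lemma l2sq_add_le2:
  assumes "f \<in> borel_measurable N" "g \<in> borel_measurable N"
  shows "l2sq N (\<lambda>x. f x + g x) \<le> 2 * l2sq N f + 2 * l2sq N g"
  using l2sq_add_le[OF assms, of 1] by simp

lemma l2sq_minus_commute: "l2sq N (\<lambda>x. f x - g x) = l2sq N (\<lambda>x. g x - f x)"
  unfolding l2sq_def by (simp add: norm_minus_commute)

lemma l2sq_diff_triangle:
  assumes "f \<in> borel_measurable N" "g \<in> borel_measurable N" "h \<in> borel_measurable N"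
  shows "l2sq N (\<lambda>x. f x - h x) \<le> 2 * l2sq N (\<lambda>x. f x - g x) + 2 * l2sq N (\<lambda>x. g x - h x)"
  using l2sq_add_le2[of "\<lambda>x. f x - g x" N "\<lambda>x. g x - h x"] assms by simp

lemma l2sq_scaleR:
  "f \<in> borel_measurable N \<Longrightarrow> l2sq N (\<lambda>x. c *\<^sub>R f x) = ennreal (c\<^sup>2) * l2sq N f"
  unfolding l2sq_def by (simp add: power_mult_distrib ennreal_mult nn_integral_cmult)

lemma l2sq_add_finite:
  assumes "f \<in> borel_measurable N" "g \<in> borel_measurable N" "l2sq N f < \<infinity>" "l2sq N g < \<infinity>"
  shows "l2sq N (\<lambda>x. f x + g x) < \<infinity>"
  using l2sq_add_le2[OF assms(1,2)] assms(3,4)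
  by (auto simp: ennreal_mult_less_top elim!: order.strict_trans1)

lemma l2sq_lincomb_finite:
  assumes [measurable]: "f \<in> borel_measurable N" "g \<in> borel_measurable N"
    and "l2sq N f < \<infinity>" "l2sq N g < \<infinity>"
  shows "l2sq N (\<lambda>x. c *\<^sub>R f x + d *\<^sub>R g x) < \<infinity>"
  using assms(3,4) by (intro l2sq_add_finite) (auto simp: l2sq_scaleR ennreal_mult_less_top)

text \<open>Removes the factor \<open>1 + e\<close> left by \<open>l2sq_add_le\<close>: for finite
  \<open>y\<close> the right side is continuous in \<open>e\<close> at 0, and for infinite
  \<open>y\<close> there is nothing to show.\<close>

lemma ennreal_le_of_eps_mult:
  fixes x y :: ennreal
  assumes "\<And>e::real. e > 0 \<Longrightarrow> x \<le> ennreal (1 + e) * y"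
  shows "x \<le> y"
proof (cases y)
  case (real r)
  have "((\<lambda>e. ennreal ((1 + e) * r)) \<longlongrightarrow> ennreal ((1 + 0) * r)) (at_right (0::real))"
    by (intro tendsto_intros)
  moreover have "x \<le> ennreal ((1 + e) * r)" if "e > 0" for e
    using assms[OF that] real that by (simp add: ennreal_mult)
  ultimately have "x \<le> ennreal ((1 + 0) * r)"
    by (intro tendsto_lowerbound[where F="at_right (0::real)"])
      (auto simp: eventually_at_right_field intro!: exI[of _ 1])
  then show ?thesis using real by simp
qed auto

section \<open>Convergence and completeness in squared norm\<close>

lemma ennreal_cmult_tendsto_0:
  assumes "(f \<longlongrightarrow> 0) F"
  shows "((\<lambda>x. ennreal c * f x) \<longlongrightarrow> 0) F"
  using ennreal_tendsto_cmult[of "ennreal c" f 0 F] assms by simp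

lemma ennreal_add_tendsto_0:
  assumes "(f \<longlongrightarrow> (0::ennreal)) F" "(g \<longlongrightarrow> 0) F"
  shows "((\<lambda>x. f x + g x) \<longlongrightarrow> 0) F"
  using tendsto_add[OF assms] by simp

lemma ennreal_tendsto_0_le:
  assumes "(g \<longlongrightarrow> (0::ennreal)) F" "\<And>x. f x \<le> g x"
  shows "(f \<longlongrightarrow> 0) F"
  using tendsto_sandwich[of "\<lambda>_. 0" f F g 0] assms by auto

lemma l2sq_tendsto_0_triangle:
  fixes f g h :: "nat \<Rightarrow> 'a \<Rightarrow> 'b::euclidean_space"
  assumes "\<And>k. f k \<in> borel_measurable N" "\<And>k. g k \<in> borel_measurable N" "\<And>k. h k \<in> borel_measurable N"
    and "(\<lambda>k. l2sq N (\<lambda>x. f k x - g k x)) \<longlonglongrightarrow> 0" "(\<lambda>k. l2sq N (\<lambda>x. g k x - h k x)) \<longlonglongrightarrow> 0"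
  shows "(\<lambda>k. l2sq N (\<lambda>x. f k x - h k x)) \<longlonglongrightarrow> 0"
proof (rule ennreal_tendsto_0_le)
  show "(\<lambda>k. ennreal 2 * l2sq N (\<lambda>x. f k x - g k x) + ennreal 2 * l2sq N (\<lambda>x. g k x - h k x)) \<longlonglongrightarrow> 0"
    by (intro ennreal_add_tendsto_0 ennreal_cmult_tendsto_0 assms)
qed (simp add: l2sq_diff_triangle assms(1-3))

text \<open>The weighted triangle inequality is used in both directions. For fixed \<open>e\<close>
  the error carries the large factor \<open>1 + 1/e\<close> but vanishes as \<open>k\<close> grows;
  only afterwards is \<open>e\<close> removed. Everything stays in \<open>ennreal\<close>, so
  \<open>c\<close> may be infinite.\<close>

lemma l2sq_limit:
  fixes f :: "nat \<Rightarrow> 'a \<Rightarrow> 'b::euclidean_space"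
  assumes f [measurable]: "\<And>k. f k \<in> borel_measurable N" and g [measurable]: "g \<in> borel_measurable N"
    and lim: "(\<lambda>k. l2sq N (\<lambda>x. f k x - g x)) \<longlonglongrightarrow> 0"
    and c: "(\<lambda>k. l2sq N (f k)) \<longlonglongrightarrow> c"
  shows "l2sq N g = c"
proof (rule antisym)
  show "l2sq N g \<le> c"
  proof (rule ennreal_le_of_eps_mult)
    fix e :: real assume e: "e > 0"
    have "(\<lambda>k. ennreal (1 + e) * l2sq N (f k) + ennreal (1 + 1/e) * l2sq N (\<lambda>x. f k x - g x))
        \<longlonglongrightarrow> ennreal (1 + e) * c + 0"
      by (intro tendsto_add ennreal_tendsto_cmult c ennreal_cmult_tendsto_0 lim) auto
    moreover have "l2sq N g \<le> ennreal (1 + e) * l2sq N (f k) + ennreal (1 + 1/e) * l2sq N (\<lambda>x. f k x - g x)" for k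
      using l2sq_add_le[OF f, of "\<lambda>x. g x - f k x" e k] e
      by (simp add: l2sq_minus_commute[of _ g])
    ultimately show "l2sq N g \<le> ennreal (1 + e) * c"
      by (intro tendsto_lowerbound[where F=sequentially]) auto
  qed
  show "c \<le> l2sq N g"
  proof (rule ennreal_le_of_eps_mult)
    fix e :: real assume e: "e > 0"
    have "(\<lambda>k. ennreal (1 + e) * l2sq N g + ennreal (1 + 1/e) * l2sq N (\<lambda>x. f k x - g x))
        \<longlonglongrightarrow> ennreal (1 + e) * l2sq N g + 0"
      by (intro tendsto_add tendsto_const ennreal_cmult_tendsto_0 lim)
    moreover have "l2sq N (f k) \<le> ennreal (1 + e) * l2sq N g + ennreal (1 + 1/e) * l2sq N (\<lambda>x. f k x - g x)" for k
      using l2sq_add_le[OF g, of "\<lambda>x. f k x - g x" e] e by simp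
    ultimately show "c \<le> ennreal (1 + e) * l2sq N g"
      by (intro LIMSEQ_le[OF c]) auto
  qed
qed

text \<open>Along a subsequence with integrals below \<open>(1/2)^k\<close> the sum of all terms has
  finite integral, so it is finite almost everywhere and its terms tend to 0 there. This is how L2
  convergence of processes and kernels descends to almost every time slice.\<close>

lemma nn_integral_tendsto_0_AE_subseq:
  fixes h :: "nat \<Rightarrow> 'a \<Rightarrow> ennreal"
  assumes [measurable]: "\<And>k. h k \<in> borel_measurable N"
    and lim: "(\<lambda>k. \<integral>\<^sup>+x. h k x \<partial>N) \<longlonglongrightarrow> 0"
  shows "\<exists>r::nat \<Rightarrow> nat. strict_mono r \<and> (AE x in N. (\<lambda>k. h (r k) x) \<longlonglongrightarrow> 0)"
proof -
  have "\<exists>r. \<forall>k. (\<integral>\<^sup>+x. h (r k) x \<partial>N) < ennreal ((1/2)^k) \<and> (r k :: nat) < r (Suc k)"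
  proof (rule dependent_nat_choice)
    have "\<exists>n. \<forall>m\<ge>n. (\<integral>\<^sup>+x. h m x \<partial>N) < ennreal ((1/2)^k)" for k :: nat
      using order_tendstoD(2)[OF lim, of "ennreal ((1/2)^k)"] by (auto simp: eventually_sequentially)
    note * = this
    show "\<exists>x. (\<integral>\<^sup>+xa. h x xa \<partial>N) < ennreal ((1/2)^0)" using *[of 0] by blast
    fix x n
    show "\<exists>y. (\<integral>\<^sup>+x. h y x \<partial>N) < ennreal ((1/2)^Suc n) \<and> (x::nat) < y"
    proof -
      obtain n0 where "\<forall>m\<ge>n0. (\<integral>\<^sup>+x. h m x \<partial>N) < ennreal ((1/2)^Suc n)" using * by blast
      then show ?thesis by (intro exI[of _ "max n0 (Suc x)"]) auto
    qed
  qed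
  then obtain r where r: "\<And>k. (\<integral>\<^sup>+x. h (r k) x \<partial>N) < ennreal ((1/2)^k)" "\<And>k. (r k :: nat) < r (Suc k)"
    by blast
  have "(\<integral>\<^sup>+x. (\<Sum>k. h (r k) x) \<partial>N) = (\<Sum>k. \<integral>\<^sup>+x. h (r k) x \<partial>N)"
    by (rule nn_integral_suminf) auto
  also have "\<dots> \<le> (\<Sum>k. ennreal ((1/2)^k))"
    by (intro suminf_le order.strict_implies_order r) auto
  also have "\<dots> = ennreal (\<Sum>k. (1/2)^k)"
    by (intro suminf_ennreal2) (auto intro: summable_geometric)
  finally have "(\<integral>\<^sup>+x. (\<Sum>k. h (r k) x) \<partial>N) \<noteq> \<infinity>" by (auto simp: top_unique)
  then have "AE x in N. (\<Sum>k. h (r k) x) \<noteq> \<infinity>"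
    by (intro nn_integral_noteq_infinite) auto
  then have "AE x in N. (\<lambda>k. h (r k) x) \<longlonglongrightarrow> 0"
  proof eventually_elim
    case (elim x)
    then have nt: "(\<Sum>k. h (r k) x) < top" by (simp add: less_top)
    have fin: "h (r k) x < top" for k
    proof -
      have "h (r k) x = (\<Sum>i\<in>{k}. h (r i) x)" by simp
      also have "\<dots> \<le> (\<Sum>k. h (r k) x)" by (intro sum_le_suminf) auto
      finally show ?thesis using nt by (rule order.strict_trans1)
    qed
    then have e: "h (r k) x = ennreal (enn2real (h (r k) x))" for k by simp
    have "summable (\<lambda>k. enn2real (h (r k) x))"
    proof (rule summable_suminf_not_top)
      show "(\<Sum>i. ennreal (enn2real (h (r i) x))) \<noteq> \<top>" using elim e by (simp flip: e)
    qed auto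
    then have "(\<lambda>k. enn2real (h (r k) x)) \<longlonglongrightarrow> 0" by (rule summable_LIMSEQ_zero)
    then have "(\<lambda>k. ennreal (enn2real (h (r k) x))) \<longlonglongrightarrow> ennreal 0" by (rule tendsto_ennrealI)
    then show ?case by (simp flip: e)
  qed
  then show ?thesis using r(2) by (intro exI[of _ r]) (auto simp: strict_mono_Suc_iff)
qed

text \<open>The subsequence is chosen with gaps of size \<open>8\<^sup>-\<^sup>k\<close>; as the sum of \<open>4\<^sup>k\<close> times the squared gaps
  is integrable, the gaps are almost everywhere \<open>O(2\<^sup>-\<^sup>k)\<close>.\<close>

lemma l2sq_complete:
  fixes f :: "nat \<Rightarrow> 'a \<Rightarrow> 'b::euclidean_space"
  assumes f [measurable]: "\<And>k. f k \<in> borel_measurable N"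
    and cauchy: "\<And>e::real. e > 0 \<Longrightarrow> \<exists>k. \<forall>m\<ge>k. \<forall>n\<ge>k. l2sq N (\<lambda>x. f m x - f n x) < ennreal e"
  shows "\<exists>r::nat \<Rightarrow> nat. strict_mono r \<and> (\<lambda>k. l2sq N (\<lambda>x. f k x - lim (\<lambda>j. f (r j) x))) \<longlonglongrightarrow> 0"
proof -
  define Q where "Q k p \<longleftrightarrow> (\<forall>m\<ge>p. \<forall>n\<ge>p. l2sq N (\<lambda>x. f m x - f n x) < ennreal ((1/8)^k))" for k p :: nat
  have "\<exists>r. \<forall>k. Q k (r k) \<and> (r k :: nat) < r (Suc k)"
  proof (rule dependent_nat_choice)
    have *: "\<exists>p. Q k p" for k unfolding Q_def using cauchy[of "(1/8)^k"] by auto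
    then show "\<exists>x. Q 0 x" by blast
    fix x n
    obtain p where "Q (Suc n) p" using * by blast
    then have "Q (Suc n) (max p (Suc x))" unfolding Q_def by auto
    then show "\<exists>y. Q (Suc n) y \<and> x < y" by (meson less_max_iff_disj lessI)
  qed
  then obtain r where r: "\<And>k. Q k (r k)" "\<And>k. (r k :: nat) < r (Suc k)" by blast
  have mono: "strict_mono r" using r(2) by (auto simp: strict_mono_Suc_iff)
  define h where "h k x = ennreal ((norm (f (r (Suc k)) x - f (r k) x))\<^sup>2)" for k x
  have [measurable]: "h k \<in> borel_measurable N" for k unfolding h_def by measurable
  have hb: "(\<integral>\<^sup>+x. ennreal (4^k) * h k x \<partial>N) \<le> ennreal ((1/2)^k)" for k
  proof -
    have "(\<integral>\<^sup>+x. h k x \<partial>N) \<le> ennreal ((1/8)^k)"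
      using r(1)[of k] r(2)[of k] unfolding Q_def h_def l2sq_def by (auto simp: less_imp_le)
    then have "ennreal (4^k) * (\<integral>\<^sup>+x. h k x \<partial>N) \<le> ennreal (4^k) * ennreal ((1/8)^k)"
      by (rule mult_left_mono) auto
    also have "\<dots> = ennreal ((1/2)^k)"
      by (simp add: ennreal_mult[symmetric] power_mult_distrib[symmetric])
    finally show ?thesis by (simp add: nn_integral_cmult)
  qed
  have "(\<integral>\<^sup>+x. (\<Sum>k. ennreal (4^k) * h k x) \<partial>N) = (\<Sum>k. \<integral>\<^sup>+x. ennreal (4^k) * h k x \<partial>N)"
    by (rule nn_integral_suminf) auto
  also have "\<dots> \<le> (\<Sum>k. ennreal ((1/2)^k))"
    by (intro suminf_le hb) auto
  also have "\<dots> = ennreal (\<Sum>k. (1/2)^k)"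
    by (intro suminf_ennreal2) (auto intro: summable_geometric)
  finally have "(\<integral>\<^sup>+x. (\<Sum>k. ennreal (4^k) * h k x) \<partial>N) \<noteq> \<infinity>" by (auto simp: top_unique)
  then have "AE x in N. (\<Sum>k. ennreal (4^k) * h k x) \<noteq> \<infinity>"
    by (intro nn_integral_noteq_infinite) auto
  then have conv: "AE x in N. convergent (\<lambda>j. f (r j) x)"
  proof eventually_elim
    case (elim x)
    define C where "C = enn2real (\<Sum>k. ennreal (4^k) * h k x)"
    have C: "ennreal C = (\<Sum>k. ennreal (4^k) * h k x)" unfolding C_def using elim by (simp add: less_top)
    have "ennreal (4^k * (norm (f (r (Suc k)) x - f (r k) x))\<^sup>2) \<le> ennreal C" for k
    proof -
      have "ennreal (4^k * (norm (f (r (Suc k)) x - f (r k) x))\<^sup>2) = (\<Sum>i\<in>{k}. ennreal (4^i) * h i x)"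
        by (simp add: h_def ennreal_mult)
      also have "\<dots> \<le> (\<Sum>k. ennreal (4^k) * h k x)" by (intro sum_le_suminf) auto
      finally show ?thesis using C by simp
    qed
    then have "4^k * (norm (f (r (Suc k)) x - f (r k) x))\<^sup>2 \<le> C" for k
      by (subst (asm) ennreal_le_iff) (auto simp: C_def)
    then have "(2^k * norm (f (r (Suc k)) x - f (r k) x))\<^sup>2 \<le> C" for k
      by (simp add: power_mult_distrib power_mult[symmetric] mult.commute[of k] power_mult)
    then have "2^k * norm (f (r (Suc k)) x - f (r k) x) \<le> sqrt C" for k
      by (rule real_le_rsqrt)
    then have gap: "norm (f (r (Suc k)) x - f (r k) x) \<le> sqrt C * (1/2)^k" for k
      by (simp add: field_simps)
    have "summable (\<lambda>k. f (r (Suc k)) x - f (r k) x)"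
      by (rule summable_comparison_test'[OF _ gap]) (auto intro!: summable_mult summable_geometric)
    then have "convergent (\<lambda>n. \<Sum>k<n. f (r (Suc k)) x - f (r k) x)"
      by (simp add: summable_iff_convergent)
    then have "convergent (\<lambda>n. f (r n) x - f (r 0) x)"
      by (simp add: sum_lessThan_telescope[of "\<lambda>n. f (r n) x"])
    then show ?case using convergent_diff_const_right_iff[of "\<lambda>n. f (r n) x" "f (r 0) x"] by simp
  qed
  \<comment> \<open>A pointwise \<open>lim\<close> of measurable functions is measurable for smaller
    sigma-fields too; adaptedness of limit processes rests on this form of the limit.\<close>
  define g where "g x = lim (\<lambda>j. f (r j) x)" for x
  have [measurable]: "g \<in> borel_measurable N" unfolding g_def by measurable
  have "(\<lambda>k. l2sq N (\<lambda>x. f k x - g x)) \<longlonglongrightarrow> 0"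
  proof (rule order_tendstoI)
    fix e :: ennreal assume "0 < e"
    then obtain e' :: real where e': "0 < e'" "ennreal e' < e"
      by (metis dense ennreal_cases ennreal_less_zero_iff leD less_top order_less_trans top.not_eq_extremum)
    obtain k where k: "\<And>m n. m \<ge> k \<Longrightarrow> n \<ge> k \<Longrightarrow> l2sq N (\<lambda>x. f m x - f n x) < ennreal e'"
      using cauchy[OF e'(1)] by blast
    have "l2sq N (\<lambda>x. f m x - g x) < e" if "m \<ge> k" for m
    proof -
      \<comment> \<open>Fatou's lemma along \<open>r\<close> transfers the Cauchy bound to the
        limit.\<close>
      have "l2sq N (\<lambda>x. f m x - g x) = (\<integral>\<^sup>+x. liminf (\<lambda>j. ennreal ((norm (f m x - f (r j) x))\<^sup>2)) \<partial>N)"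
        unfolding l2sq_def
      proof (rule nn_integral_cong_AE, use conv in eventually_elim)
        case (elim x)
        then have "(\<lambda>j. f (r j) x) \<longlonglongrightarrow> g x" unfolding g_def by (simp add: convergent_LIMSEQ_iff)
        then have "(\<lambda>j. ennreal ((norm (f m x - f (r j) x))\<^sup>2)) \<longlonglongrightarrow> ennreal ((norm (f m x - g x))\<^sup>2)"
          by (intro tendsto_ennrealI tendsto_intros)
        then show ?case by (rule lim_imp_Liminf[OF sequentially_bot, symmetric])
      qed
      also have "\<dots> \<le> liminf (\<lambda>j. l2sq N (\<lambda>x. f m x - f (r j) x))"
        unfolding l2sq_def by (rule nn_integral_liminf) auto
      also have "\<dots> \<le> liminf (\<lambda>j. ennreal e')"
      proof (rule Liminf_mono)
        show "\<forall>\<^sub>F j in sequentially. l2sq N (\<lambda>x. f m x - f (r j) x) \<le> ennreal e'"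
          using eventually_ge_at_top[of k]
        proof eventually_elim
          case (elim j)
          then have "r j \<ge> k" using seq_suble[OF mono, of j] by simp
          then show ?case using k[OF that] by (simp add: less_imp_le)
        qed
      qed
      also have "\<dots> = ennreal e'" by (simp add: Liminf_const)
      finally show ?thesis using e' by simp
    qed
    then show "\<forall>\<^sub>F k in sequentially. l2sq N (\<lambda>x. f k x - g x) < e"
      by (auto simp: eventually_sequentially)
  qed auto
  then show ?thesis using mono unfolding g_def by blast
qed

lemma l2sq_tendsto_imp_cauchy:
  fixes f :: "nat \<Rightarrow> 'a \<Rightarrow> 'b::euclidean_space"
  assumes [measurable]: "\<And>k. f k \<in> borel_measurable N" "g \<in> borel_measurable N"
    and lim: "(\<lambda>k. l2sq N (\<lambda>x. f k x - g x)) \<longlonglongrightarrow> 0" and "(e::real) > 0"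
  shows "\<exists>k. \<forall>m\<ge>k. \<forall>n\<ge>k. l2sq N (\<lambda>x. f m x - f n x) < ennreal e"
proof -
  obtain k where k: "\<And>m. m \<ge> k \<Longrightarrow> l2sq N (\<lambda>x. f m x - g x) < ennreal (e/8)"
    using order_tendstoD(2)[OF lim, of "ennreal (e/8)"] \<open>e > 0\<close> by (auto simp: eventually_sequentially)
  have "l2sq N (\<lambda>x. f m x - f n x) < ennreal e" if "m \<ge> k" "n \<ge> k" for m n
  proof -
    have "l2sq N (\<lambda>x. f m x - f n x) \<le> 2 * l2sq N (\<lambda>x. f m x - g x) + 2 * l2sq N (\<lambda>x. g x - f n x)"
      by (rule l2sq_diff_triangle) auto
    also have "\<dots> \<le> 2 * ennreal (e/8) + 2 * ennreal (e/8)"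
      using k[OF that(1)] k[OF that(2)] unfolding l2sq_minus_commute[of N g]
      by (intro add_mono mult_left_mono) (auto simp: less_imp_le)
    also have "\<dots> = ennreal 2 * ennreal (e/8) + ennreal 2 * ennreal (e/8)" by simp
    also have "\<dots> = ennreal (e/2)" using \<open>e > 0\<close>
      by (simp add: ennreal_mult[symmetric] ennreal_plus[symmetric] del: ennreal_plus ennreal_numeral)
    also have "\<dots> < ennreal e" using \<open>e > 0\<close> by (simp add: ennreal_less_iff)
    finally show ?thesis .
  qed
  then show ?thesis by blast
qed

lemma ennreal_suminf_tail_tendsto_0:
  fixes f :: "nat \<Rightarrow> ennreal"
  assumes "(\<Sum>n. f n) < \<infinity>"
  shows "(\<lambda>N. \<Sum>n. f (n + N)) \<longlonglongrightarrow> 0"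
proof -
  have fin: "f n < top" for n
  proof -
    have "f n = (\<Sum>i\<in>{n}. f i)" by simp
    also have "\<dots> \<le> (\<Sum>k. f k)" by (intro sum_le_suminf) auto
    finally show ?thesis using assms by (auto elim: order.strict_trans1)
  qed
  define c where "c n = enn2real (f n)" for n
  have c: "f n = ennreal (c n)" "c n \<ge> 0" for n using fin[of n] by (auto simp: c_def)
  have s: "summable c"
    using assms c by (intro summable_suminf_not_top) auto
  have "(\<Sum>n. f (n + N)) = ennreal (\<Sum>n. c (n + N))" for N
    using c s by (simp add: suminf_ennreal2 summable_ignore_initial_segment)
  moreover have "(\<lambda>N. ennreal (\<Sum>n. c (n + N))) \<longlonglongrightarrow> ennreal 0"
    by (intro tendsto_ennrealI suminf_exist_split2 s)
  ultimately show ?thesis by simp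
qed

text \<open>Follows from \<open>l2sq_limit\<close> by compactness of \<open>ennreal\<close>: norms
  staying outside a neighbourhood of \<open>l2sq N g\<close> along a subsequence would converge
  along a further one to some \<open>c\<close>, and then \<open>c = l2sq N g\<close>.\<close>

lemma l2sq_tendsto:
  fixes f :: "nat \<Rightarrow> 'a \<Rightarrow> 'b::euclidean_space"
  assumes f [measurable]: "\<And>k. f k \<in> borel_measurable N" and g [measurable]: "g \<in> borel_measurable N"
    and lim: "(\<lambda>k. l2sq N (\<lambda>x. f k x - g x)) \<longlonglongrightarrow> 0"
  shows "(\<lambda>k. l2sq N (f k)) \<longlonglongrightarrow> l2sq N g"
proof (rule ccontr)
  assume "\<not> ?thesis"
  then obtain U where U: "open U" "l2sq N g \<in> U" "\<not> (\<forall>\<^sub>F k in sequentially. l2sq N (f k) \<in> U)"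
    by (auto simp: tendsto_def)
  then have inf: "infinite {k. l2sq N (f k) \<notin> U}"
    by (simp add: eventually_cofinite[symmetric] cofinite_eq_sequentially)
  define s where "s = enumerate {k. l2sq N (f k) \<notin> U}"
  have s: "strict_mono s" "\<And>k. l2sq N (f (s k)) \<notin> U"
    using strict_mono_enumerate[OF inf] enumerate_in_set[OF inf] by (auto simp: s_def)
  obtain c r where r: "strict_mono r" "((\<lambda>k. l2sq N (f (s k))) \<circ> r) \<longlonglongrightarrow> c"
    using compact_complete_linorder[of "\<lambda>k. l2sq N (f (s k))"] by blast
  have "l2sq N g = c"
  proof (rule l2sq_limit)
    show "(\<lambda>k. l2sq N (\<lambda>x. f (s (r k)) x - g x)) \<longlonglongrightarrow> 0"
      using LIMSEQ_subseq_LIMSEQ[OF lim strict_mono_o[OF s(1) r(1)]] by (simp add: o_def)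
  qed (use r(2) in \<open>auto simp: o_def\<close>)
  with r(2) have "((\<lambda>k. l2sq N (f (s k))) \<circ> r) \<longlonglongrightarrow> l2sq N g" by simp
  from topological_tendstoD[OF this U(1,2)] s(2) show False by (auto simp: eventually_sequentially)
qed

lemma l2sq_finite_iff_integrable:
  fixes f :: "'a \<Rightarrow> 'b::euclidean_space"
  assumes [measurable]: "f \<in> borel_measurable N"
  shows "l2sq N f < \<infinity> \<longleftrightarrow> integrable N (\<lambda>x. (norm (f x))\<^sup>2)"
  unfolding l2sq_def by (subst integrable_iff_bounded) auto

section \<open>Processes as functions on the product of time and probability space\<close>

lemma space_time_interval [simp]: "space (time_interval S T) = {S<..<T}"
  by (simp add: space_restrict_space)

lemma finite_measure_time_interval: "finite_measure (time_interval S T)"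
  by (rule finite_measureI) (cases "S \<le> T"; simp add: emeasure_restrict_space)

lemma nn_integral_time_interval:
  "(\<integral>\<^sup>+t. f t \<partial>time_interval S T) = (\<integral>\<^sup>+t. f t * indicator {S<..<T} t \<partial>lborel)"
  by (rule nn_integral_restrict_space) auto

context prob_space
begin

lemma pair_time_interval: "pair_sigma_finite (time_interval S T) M"
proof -
  interpret finite_measure "time_interval S T" by (rule finite_measure_time_interval)
  show ?thesis by standard
qed

text \<open>Tonelli: \<open>process_sqnorm\<close> has the time integral inside and the expectation
  outside. On the product space the results about \<open>l2sq\<close> become available; the opposite
  order, in the next lemma, gives access to single times.\<close>

lemma process_sqnorm_eq_l2sq:
  assumes [measurable]: "(\<lambda>(t, \<omega>). \<xi> t \<omega>) \<in> borel_measurable (time_interval S T \<Otimes>\<^sub>M M)"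
  shows "process_sqnorm M S T \<xi> = l2sq (time_interval S T \<Otimes>\<^sub>M M) (\<lambda>(t, \<omega>). \<xi> t \<omega>)"
proof -
  interpret pair_sigma_finite "time_interval S T" M by (rule pair_time_interval)
  have [measurable]: "(\<lambda>p. \<xi> (fst p) (snd p)) \<in> borel_measurable (time_interval S T \<Otimes>\<^sub>M M)"
    using assms by (simp add: case_prod_beta')
  show ?thesis
    unfolding process_sqnorm_def l2sq_def
    by (subst nn_integral_snd[symmetric]) (auto simp: case_prod_beta')
qed

lemma process_sqnorm_eq_nn_integral:
  assumes [measurable]: "(\<lambda>(t, \<omega>). \<xi> t \<omega>) \<in> borel_measurable (time_interval S T \<Otimes>\<^sub>M M)"
  shows "process_sqnorm M S T \<xi> = (\<integral>\<^sup>+t. l2sq M (\<xi> t) \<partial>time_interval S T)"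
proof -
  have [measurable]: "(\<lambda>p. \<xi> (fst p) (snd p)) \<in> borel_measurable (time_interval S T \<Otimes>\<^sub>M M)"
    using assms by (simp add: case_prod_beta')
  show ?thesis
    unfolding process_sqnorm_eq_l2sq[OF assms] unfolding l2sq_def
    using nn_integral_fst[of "\<lambda>p. ennreal ((norm (\<xi> (fst p) (snd p)))\<^sup>2)" "time_interval S T"]
    by (simp add: case_prod_beta')
qed

end

lemma measurable_process_section:
  assumes "(\<lambda>(t, \<omega>). \<xi> t \<omega>) \<in> borel_measurable (time_interval S T \<Otimes>\<^sub>M M)" "t \<in> {S<..<T}"
  shows "\<xi> t \<in> borel_measurable M"
  using measurable_compose[OF measurable_Pair1' assms(1), of t] assms(2) by simp

section \<open>Independence of increments and simple integrals\<close>

text \<open>Only the lower end \<open>S\<close> is fixed. The upper end has to vary, because the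
  induction over iterated integrals lowers it to the outermost time.\<close>

locale brownian = prob_space M for M :: "'w measure" +
  fixes W :: "real \<Rightarrow> 'w \<Rightarrow> real" and S :: real
  assumes brownian: "brownian_motion M W" and S_nonneg: "0 \<le> S"
begin

abbreviation "F \<equiv> aug_filtration M W S"

lemma W_measurable [measurable]: "0 \<le> t \<Longrightarrow> W t \<in> borel_measurable M"
  using brownian by (simp add: brownian_motion_def)

lemma space_F [simp]: "space (F a) = space M"
  unfolding aug_filtration_def by (rule space_measure_of) (auto dest: sets.sets_into_space)

lemma generator_F_subset:
  "{(\<lambda>\<omega>. W r \<omega> - W S \<omega>) -` A \<inter> space M | r A. r \<in> {S..a} \<and> A \<in> sets borel} \<union> null_sets M \<subseteq> sets M"
proof -
  have "(\<lambda>\<omega>. W r \<omega> - W S \<omega>) -` A \<inter> space M \<in> sets M" if "r \<in> {S..a}" "A \<in> sets borel" for r A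
  proof (rule measurable_sets[OF _ that(2)])
    have [measurable]: "W r \<in> borel_measurable M" "W S \<in> borel_measurable M"
      using that S_nonneg by (auto intro!: W_measurable)
    show "(\<lambda>\<omega>. W r \<omega> - W S \<omega>) \<in> borel_measurable M" by measurable
  qed
  then show ?thesis by auto
qed

lemma sets_F: "sets (F a) = sigma_sets (space M)
   ({(\<lambda>\<omega>. W r \<omega> - W S \<omega>) -` A \<inter> space M | r A. r \<in> {S..a} \<and> A \<in> sets borel} \<union> null_sets M)"
  unfolding aug_filtration_def by (rule sets_measure_of) (auto dest: sets.sets_into_space)

lemma sets_F_subset: "sets (F a) \<subseteq> sets M"
  unfolding sets_F by (rule sets.sigma_sets_subset[OF generator_F_subset])

lemma measurable_F_imp: "f \<in> borel_measurable (F a) \<Longrightarrow> f \<in> borel_measurable M"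
  using sets_F_subset[of a] by (auto simp: measurable_def)

lemma measurable_F_mono:
  assumes "a \<le> b" "f \<in> borel_measurable (F a)"
  shows "f \<in> borel_measurable (F b)"
proof -
  have "sets (F a) \<subseteq> sets (F b)"
    unfolding sets_F using assms(1) by (intro sigma_sets_mono') fastforce
  then show ?thesis using assms(2) by (auto simp: measurable_def)
qed

lemma increment_F:
  assumes "S \<le> r" "r \<le> s" "s \<le> a"
  shows "(\<lambda>\<omega>. W s \<omega> - W r \<omega>) \<in> borel_measurable (F a)"
proof -
  have *: "(\<lambda>\<omega>. W q \<omega> - W S \<omega>) \<in> borel_measurable (F a)" if "q \<in> {S..a}" for q
    using that by (intro measurableI) (auto simp: sets_F intro!: sigma_sets.Basic)
  have "(\<lambda>\<omega>. (W s \<omega> - W S \<omega>) - (W r \<omega> - W S \<omega>)) \<in> borel_measurable (F a)"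
    using assms by (intro borel_measurable_diff *) auto
  then show ?thesis by simp
qed

section \<open>Independence of increments from the augmented past\<close>

definition cylinders :: "real \<Rightarrow> 'w set set" where
  "cylinders a = {{\<omega>\<in>space M. \<forall>r\<in>J. W r \<omega> - W S \<omega> \<in> A r} | J A.
      finite J \<and> J \<subseteq> {S..a} \<and> (\<forall>r. A r \<in> sets borel)}"

lemma cylinders_sets: "E \<in> cylinders a \<Longrightarrow> E \<in> sets M"
proof -
  assume "E \<in> cylinders a"
  then obtain J A where E: "E = {\<omega>\<in>space M. \<forall>r\<in>J. W r \<omega> - W S \<omega> \<in> A r}"
    "finite J" "J \<subseteq> {S..a}" "\<And>r. A r \<in> sets borel" unfolding cylinders_def by blast
  have "{\<omega>\<in>space M. W r \<omega> - W S \<omega> \<in> A r} \<in> sets M" if "r \<in> J" for r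
  proof -
    have [measurable]: "W r \<in> borel_measurable M" "W S \<in> borel_measurable M" "A r \<in> sets borel"
      using that E S_nonneg by (auto intro!: W_measurable)
    show ?thesis by measurable
  qed
  with E show "E \<in> sets M" by (auto intro!: sets.sets_Collect_finite_All)
qed

lemma Int_stable_cylinders: "Int_stable (cylinders a)"
proof (rule Int_stableI)
  fix E E' assume "E \<in> cylinders a" "E' \<in> cylinders a"
  then obtain J A J' A' where E: "E = {\<omega>\<in>space M. \<forall>r\<in>J. W r \<omega> - W S \<omega> \<in> A r}"
    "finite J" "J \<subseteq> {S..a}" "\<And>r. A r \<in> sets borel"
   and E': "E' = {\<omega>\<in>space M. \<forall>r\<in>J'. W r \<omega> - W S \<omega> \<in> A' r}"
    "finite J'" "J' \<subseteq> {S..a}" "\<And>r. A' r \<in> sets borel" unfolding cylinders_def by blast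
  \<comment> \<open>A time missing in one of the two cylinders carries no condition there, which
    \<open>UNIV\<close> expresses.\<close>
  have "E \<inter> E' = {\<omega>\<in>space M. \<forall>r\<in>J\<union>J'. W r \<omega> - W S \<omega> \<in>
      (if r \<in> J then A r else UNIV) \<inter> (if r \<in> J' then A' r else UNIV)}"
    using E(1) E'(1) by auto
  then show "E \<inter> E' \<in> cylinders a"
    unfolding cylinders_def using E E'
    by (intro CollectI exI[of _ "J \<union> J'"]
       exI[of _ "\<lambda>r. (if r \<in> J then A r else UNIV) \<inter> (if r \<in> J' then A' r else UNIV)"]) auto
qed

text \<open>The Brownian axiom speaks of consecutive increments along a partition. The times of the
  cylinder together with \<open>S\<close> and \<open>a\<close>, sorted and followed by
  \<open>b\<close>, form one: the cylinder depends on all increments but the last, and the last is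
  \<open>W b - W a\<close>.\<close>

lemma cylinder_increment_indep:
  assumes E: "E \<in> cylinders a" and ab: "S \<le> a" "a \<le> b" and B: "B \<in> sets borel"
  shows "prob (E \<inter> ((\<lambda>\<omega>. W b \<omega> - W a \<omega>) -` B \<inter> space M)) =
    prob E * prob ((\<lambda>\<omega>. W b \<omega> - W a \<omega>) -` B \<inter> space M)"
proof -
  obtain J A where E: "E = {\<omega>\<in>space M. \<forall>r\<in>J. W r \<omega> - W S \<omega> \<in> A r}"
    "finite J" "J \<subseteq> {S..a}" and A [measurable]: "\<And>r. A r \<in> sets borel" using E unfolding cylinders_def by blast
  define L where "L = sorted_list_of_set (J \<union> {S, a})"
  have fin: "finite (J \<union> {S, a})" using E(2) by simp
  have "set L = J \<union> {S, a}" unfolding L_def by (rule set_sorted_list_of_set[OF fin])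
  moreover have "sorted L" unfolding L_def by (rule sorted_sorted_list_of_set)
  ultimately have L: "set L = J \<union> {S, a}" "sorted L" .
  have len: "length L > 0" using L by auto
  define n where "n = length L - 1"
  \<comment> \<open>Past the end of the list \<open>\<tau>\<close> is \<open>b\<close>, so
    \<open>\<tau> (Suc n) = b\<close> and the increment number \<open>n\<close> is
    \<open>W b - W a\<close>.\<close>
  define \<tau> where "\<tau> i = (if i < length L then L ! i else b)" for i
  have less: "k < length L" if "k \<le> n" for k using that len unfolding n_def by linarith
  have idx: "\<exists>k\<le>n. \<tau> k = r" if r: "r \<in> set L" for r
  proof -
    obtain i where "i < length L" "L ! i = r" using r by (auto simp: in_set_conv_nth)
    then show ?thesis by (intro exI[of _ i]) (auto simp: \<tau>_def n_def)
  qed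
  have bd: "S \<le> L ! i \<and> L ! i \<le> a" if "i < length L" for i
    using nth_mem[OF that] L(1) E(3) ab by auto
  have \<tau>0: "\<tau> 0 = S"
  proof -
    obtain k where "k \<le> n" "\<tau> k = S" using idx L by auto
    then have "L ! 0 \<le> S" using sorted_nth_mono[OF L(2), of 0 k] len less[of k] by (auto simp: \<tau>_def n_def split: if_splits)
    then show ?thesis using bd[of 0] len by (auto simp: \<tau>_def)
  qed
  have \<tau>n: "\<tau> n = a"
  proof -
    obtain k where "k \<le> n" "\<tau> k = a" using idx L by auto
    then have "a \<le> L ! n" using sorted_nth_mono[OF L(2), of k n] len less[of k] by (auto simp: \<tau>_def n_def split: if_splits)
    then show ?thesis using bd[of n] len by (auto simp: \<tau>_def n_def)
  qed
  have \<tau>Sn: "\<tau> (Suc n) = b" using len by (auto simp: \<tau>_def n_def)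
  have mono: "\<tau> i \<le> \<tau> (Suc i)" if "i < Suc n" for i
  proof (cases "i = n")
    case True then show ?thesis using \<tau>n \<tau>Sn ab by simp
  next
    case False then show ?thesis using that sorted_nth_mono[OF L(2), of i "Suc i"] by (auto simp: \<tau>_def n_def)
  qed
  define X where "X i \<omega> = W (\<tau> (Suc i)) \<omega> - W (\<tau> i) \<omega>" for i \<omega>
  have "\<forall>(n::nat) (\<tau>::nat \<Rightarrow> real). 0 \<le> \<tau> 0 \<longrightarrow> (\<forall>i<n. \<tau> i \<le> \<tau> (Suc i)) \<longrightarrow>
        indep_vars (\<lambda>_. borel) (\<lambda>i \<omega>. W (\<tau> (Suc i)) \<omega> - W (\<tau> i) \<omega>) {..<n}"
    using brownian unfolding brownian_motion_def by blast
  then have ind: "indep_vars (\<lambda>_. borel) X {..<Suc n}"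
    using mono \<tau>0 S_nonneg unfolding X_def by blast
  define X1 where "X1 \<omega> = restrict (\<lambda>i. X i \<omega>) {..<n}" for \<omega>
  define X2 where "X2 \<omega> = restrict (\<lambda>i. X i \<omega>) {n}" for \<omega>
  have iv: "indep_var (PiM {..<n} (\<lambda>_. borel)) X1 (PiM {n} (\<lambda>_. borel)) X2"
    unfolding X1_def X2_def by (rule indep_var_restrict[OF ind]) auto
  have "\<forall>r\<in>J. \<exists>k\<le>n. \<tau> k = r" using idx L by auto
  then obtain k where k: "\<And>r. r \<in> J \<Longrightarrow> k r \<le> n" "\<And>r. r \<in> J \<Longrightarrow> \<tau> (k r) = r" by metis
  \<comment> \<open>The values \<open>W r - W S\<close> are partial sums of the first
    \<open>n\<close> increments, hence the cylinder is an event for the vector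
    \<open>X1\<close>.\<close>
  define P1 where "P1 = {x\<in>space (PiM {..<n} (\<lambda>_. borel::real measure)). \<forall>r\<in>J. (\<Sum>i<k r. x i) \<in> A r}"
  define P2 where "P2 = {x\<in>space (PiM {n} (\<lambda>_. borel::real measure)). x n \<in> B}"
  have "{x\<in>space (PiM {..<n} (\<lambda>_. borel::real measure)). (\<Sum>i<k r. x i) \<in> A r}
    \<in> sets (PiM {..<n} (\<lambda>_. borel::real measure))" if "r \<in> J" for r
  proof -
    have [measurable]: "(\<lambda>x. \<Sum>i<k r. x i) \<in> borel_measurable (PiM {..<n} (\<lambda>_. borel::real measure))"
      using k(1)[OF that] by (intro borel_measurable_sum measurable_component_singleton) auto
    show ?thesis by measurable
  qed
  then have P1: "P1 \<in> sets (PiM {..<n} (\<lambda>_. borel))"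
    unfolding P1_def using E(2) by (intro sets.sets_Collect_finite_All) auto
  have P2: "P2 \<in> sets (PiM {n} (\<lambda>_. borel))" unfolding P2_def using B by measurable
  have sumX: "(\<Sum>i<k r. X1 \<omega> i) = W r \<omega> - W S \<omega>" if "r \<in> J" for r \<omega>
  proof -
    have "(\<Sum>i<k r. X1 \<omega> i) = (\<Sum>i<k r. W (\<tau> (Suc i)) \<omega> - W (\<tau> i) \<omega>)"
      using k(1)[OF that] by (intro sum.cong) (auto simp: X1_def X_def)
    also have "\<dots> = W r \<omega> - W S \<omega>"
      by (subst sum_lessThan_telescope[of "\<lambda>i. W (\<tau> i) \<omega>"]) (simp add: \<tau>0 k that)
    finally show ?thesis .
  qed
  have "X1 \<omega> \<in> space (PiM {..<n} (\<lambda>_. borel::real measure))" for \<omega>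
    unfolding X1_def by (simp add: space_PiM)
  then have "E = X1 -` P1 \<inter> space M"
    by (auto simp: E(1) P1_def sumX)
  moreover have "(\<lambda>\<omega>. W b \<omega> - W a \<omega>) -` B \<inter> space M = X2 -` P2 \<inter> space M"
    by (auto simp: P2_def X2_def X_def \<tau>n \<tau>Sn space_PiM)
  moreover have "(X1 -` P1 \<inter> space M) \<inter> (X2 -` P2 \<inter> space M) = (\<lambda>x. (X1 x, X2 x)) -` (P1 \<times> P2) \<inter> space M" by auto
  ultimately show ?thesis using indep_varD[OF iv P1 P2] by simp
qed

text \<open>Dynkin's argument: cylinders together with null sets are stable under intersection and
  generate the augmented past, and a null set is independent of every event.\<close>

lemma indep_increment:
  assumes h: "h \<in> borel_measurable (F a)" and ab: "S \<le> a" "a \<le> b"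
  shows "indep_var borel h borel (\<lambda>\<omega>. W b \<omega> - W a \<omega>)"
proof -
  let ?D = "\<lambda>\<omega>. W b \<omega> - W a \<omega>"
  have [measurable]: "W a \<in> borel_measurable M" "W b \<in> borel_measurable M"
    using ab S_nonneg by (auto intro!: W_measurable)
  let ?G = "cylinders a \<union> null_sets M" and ?H = "{?D -` A \<inter> space M | A. A \<in> sets borel}"
  have "indep_set ?G ?H"
  proof (rule indep_setI)
    show "?G \<subseteq> events" using cylinders_sets by auto
    show "?H \<subseteq> events" by auto
    fix x y assume x: "x \<in> ?G" and y: "y \<in> ?H"
    then obtain B where B: "B \<in> sets borel" "y = ?D -` B \<inter> space M" by auto
    show "prob (x \<inter> y) = prob x * prob y"
    proof (cases "x \<in> cylinders a")
      case True then show ?thesis using cylinder_increment_indep[OF True ab B(1)] B(2) by simp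
    next
      case False
      then have x: "x \<in> null_sets M" using x by auto
      have "x \<inter> y \<in> null_sets M" using B by (intro null_set_Int2[OF x]) auto
      then show ?thesis using x by (simp add: measure_eq_0_null_sets)
    qed
  qed
  moreover have "Int_stable ?G"
  proof (rule Int_stableI)
    fix x y assume xy: "x \<in> ?G" "y \<in> ?G"
    show "x \<inter> y \<in> ?G"
    proof (cases "x \<in> null_sets M \<or> y \<in> null_sets M")
      case True
      moreover have "x \<in> sets M" "y \<in> sets M" using xy cylinders_sets by auto
      ultimately have "x \<inter> y \<in> null_sets M" using null_set_Int1 null_set_Int2 by blast
      then show ?thesis by blast
    next
      case False then show ?thesis using xy Int_stable_cylinders by (auto dest: Int_stableD)
    qed
  qed
  moreover have "Int_stable ?H"
  proof (rule Int_stableI)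
    fix x y assume "x \<in> ?H" "y \<in> ?H"
    then obtain A B where "A \<in> sets borel" "B \<in> sets borel" "x = ?D -` A \<inter> space M" "y = ?D -` B \<inter> space M" by auto
    then show "x \<inter> y \<in> ?H" by (intro CollectI exI[of _ "A \<inter> B"]) auto
  qed
  ultimately have ind: "indep_set (sigma_sets (space M) ?G) (sigma_sets (space M) ?H)"
    by (rule indep_set_sigma_sets)
  have sub: "sets (F a) \<subseteq> sigma_sets (space M) ?G"
    unfolding sets_F
  proof (rule sigma_sets_mono)
    show "{(\<lambda>\<omega>. W r \<omega> - W S \<omega>) -` A \<inter> space M |r A. r \<in> {S..a} \<and> A \<in> sets borel} \<union> null_sets M
      \<subseteq> sigma_sets (space M) ?G"
    proof (intro Un_least subsetI)
      fix x assume "x \<in> {(\<lambda>\<omega>. W r \<omega> - W S \<omega>) -` A \<inter> space M |r A. r \<in> {S..a} \<and> A \<in> sets borel}"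
      then obtain r A where "r \<in> {S..a}" "A \<in> sets borel" "x = (\<lambda>\<omega>. W r \<omega> - W S \<omega>) -` A \<inter> space M" by auto
      then have "x \<in> cylinders a" unfolding cylinders_def
        by (intro CollectI exI[of _ "{r}"] exI[of _ "\<lambda>_. A"]) auto
      then show "x \<in> sigma_sets (space M) ?G" by (auto intro: sigma_sets.Basic)
    qed (auto intro: sigma_sets.Basic)
  qed
  have "{h -` A \<inter> space M | A. A \<in> sets borel} \<subseteq> sets (F a)"
    using measurable_sets[OF h] by auto
  then have "sigma_sets (space M) {h -` A \<inter> space M | A. A \<in> sets borel} \<subseteq> sigma_sets (space M) ?G"
    using sub by (intro sigma_sets_mono) auto
  then have "indep_set (sigma_sets (space M) {h -` A \<inter> space M | A. A \<in> sets borel}) (sigma_sets (space M) ?H)"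
    using ind unfolding indep_sets2_eq by (meson order_trans subsetD)
  then show ?thesis
    using measurable_F_imp[OF h] by (simp add: indep_var_eq)
qed

section \<open>Moments of increments and orthogonality\<close>

lemma increment_moments:
  assumes "S \<le> a" "a \<le> b"
  shows "integrable M (\<lambda>\<omega>. W b \<omega> - W a \<omega>)" "expectation (\<lambda>\<omega>. W b \<omega> - W a \<omega>) = 0"
    "integrable M (\<lambda>\<omega>. (W b \<omega> - W a \<omega>)\<^sup>2)" "expectation (\<lambda>\<omega>. (W b \<omega> - W a \<omega>)\<^sup>2) = b - a"
proof -
  let ?D = "\<lambda>\<omega>. W b \<omega> - W a \<omega>"
  have "integrable M ?D \<and> expectation ?D = 0 \<and> integrable M (\<lambda>\<omega>. (?D \<omega>)\<^sup>2) \<and> expectation (\<lambda>\<omega>. (?D \<omega>)\<^sup>2) = b - a"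
  \<comment> \<open>A normal density requires positive variance; for \<open>a = b\<close> the
    increment is identically 0.\<close>
  proof (cases "a = b")
    case False
    then have s: "a < b" "0 < sqrt (b - a)" using assms by auto
    have D: "distributed M lborel ?D (normal_density 0 (sqrt (b - a)))"
      using brownian assms S_nonneg s unfolding brownian_motion_def by auto
    have e: "expectation ?D = 0" by (rule normal_distributed_expectation[OF s(2) D])
    have v: "variance ?D = (sqrt (b - a))\<^sup>2" by (rule normal_distributed_variance[OF s(2) D])
    have 1: "integrable M ?D"
      by (subst distributed_integrable[OF D, of "\<lambda>x. x", symmetric])
        (use integrable_normal_moment_nz_1[OF s(2)] in auto)
    have 2: "integrable M (\<lambda>\<omega>. (?D \<omega>)\<^sup>2)"
      by (subst distributed_integrable[OF D, of "\<lambda>x. x\<^sup>2", symmetric])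
        (use integrable_normal_moment[OF s(2), of 0 2] in auto)
    show ?thesis using e v 1 2 s by simp
  qed simp
  then show "integrable M ?D" "expectation ?D = 0" "integrable M (\<lambda>\<omega>. (?D \<omega>)\<^sup>2)"
    "expectation (\<lambda>\<omega>. (?D \<omega>)\<^sup>2) = b - a" by auto
qed

text \<open>In the expanded square the cross term is the product of
  \<open>Z \<bullet> \<eta>\<close>, known at time \<open>a\<close>, with an independent centred
  increment, so it has mean 0. The last term factorises for the same reason, with variance
  \<open>b - a\<close>.\<close>

lemma l2sq_add_increment:
  fixes Z \<eta> :: "'w \<Rightarrow> 'b::euclidean_space"
  assumes Z: "Z \<in> borel_measurable (F a)" and \<eta>: "\<eta> \<in> borel_measurable (F a)"
    and fin: "l2sq M Z < \<infinity>" "l2sq M \<eta> < \<infinity>" and ab: "S \<le> a" "a \<le> b"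
  shows "l2sq M (\<lambda>\<omega>. Z \<omega> + (W b \<omega> - W a \<omega>) *\<^sub>R \<eta> \<omega>) = l2sq M Z + ennreal (b - a) * l2sq M \<eta>"
proof -
  let ?D = "\<lambda>\<omega>. W b \<omega> - W a \<omega>"
  note [measurable] = Z \<eta> measurable_F_imp[OF Z] measurable_F_imp[OF \<eta>]
  note mom = increment_moments[OF ab]
  have [measurable]: "W a \<in> borel_measurable M" "W b \<in> borel_measurable M"
    using ab S_nonneg by (auto intro!: W_measurable)
  have iZ: "integrable M (\<lambda>x. (norm (Z x))\<^sup>2)"
    by (rule iffD1[OF l2sq_finite_iff_integrable[OF measurable_F_imp[OF Z]] fin(1)])
  have i\<eta>: "integrable M (\<lambda>x. (norm (\<eta> x))\<^sup>2)"
    by (rule iffD1[OF l2sq_finite_iff_integrable[OF measurable_F_imp[OF \<eta>]] fin(2)])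
  have iZ\<eta>: "integrable M (\<lambda>\<omega>. Z \<omega> \<bullet> \<eta> \<omega>)"
  proof (rule Bochner_Integration.integrable_bound[OF Bochner_Integration.integrable_add[OF iZ i\<eta>]])
    have "\<bar>Z \<omega> \<bullet> \<eta> \<omega>\<bar> \<le> (norm (Z \<omega>))\<^sup>2 + (norm (\<eta> \<omega>))\<^sup>2" for \<omega>
    proof -
      have "\<bar>Z \<omega> \<bullet> \<eta> \<omega>\<bar> \<le> norm (Z \<omega>) * norm (\<eta> \<omega>)" by (rule Cauchy_Schwarz_ineq2)
      also have "\<dots> \<le> (norm (Z \<omega>))\<^sup>2 + (norm (\<eta> \<omega>))\<^sup>2"
        using sum_squares_bound[of "norm (Z \<omega>)" "norm (\<eta> \<omega>)"]
          mult_nonneg_nonneg[OF norm_ge_zero[of "Z \<omega>"] norm_ge_zero[of "\<eta> \<omega>"]] by linarith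
      finally show ?thesis .
    qed
    then show "AE \<omega> in M. norm (Z \<omega> \<bullet> \<eta> \<omega>) \<le> norm ((norm (Z \<omega>))\<^sup>2 + (norm (\<eta> \<omega>))\<^sup>2)"
      by (intro AE_I2) simp
  qed measurable
  have ind1: "indep_var borel (\<lambda>\<omega>. Z \<omega> \<bullet> \<eta> \<omega>) borel ?D"
    by (rule indep_increment[OF _ ab]) measurable
  have "indep_var borel (\<lambda>\<omega>. (norm (\<eta> \<omega>))\<^sup>2) borel ?D"
    by (rule indep_increment[OF _ ab]) measurable
  from indep_var_compose[OF this, of "\<lambda>x. x" borel "\<lambda>x. x\<^sup>2" borel]
  have ind2: "indep_var borel (\<lambda>\<omega>. (norm (\<eta> \<omega>))\<^sup>2) borel (\<lambda>\<omega>. (?D \<omega>)\<^sup>2)" by (simp add: o_def)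
  have c1: "expectation (\<lambda>\<omega>. (Z \<omega> \<bullet> \<eta> \<omega>) * ?D \<omega>) = 0" "integrable M (\<lambda>\<omega>. (Z \<omega> \<bullet> \<eta> \<omega>) * ?D \<omega>)"
    using indep_var_lebesgue_integral[OF ind1 iZ\<eta> mom(1)] indep_var_integrable[OF ind1 iZ\<eta> mom(1)] mom(2) by auto
  have c2: "expectation (\<lambda>\<omega>. (norm (\<eta> \<omega>))\<^sup>2 * (?D \<omega>)\<^sup>2) = expectation (\<lambda>\<omega>. (norm (\<eta> \<omega>))\<^sup>2) * (b - a)"
      "integrable M (\<lambda>\<omega>. (norm (\<eta> \<omega>))\<^sup>2 * (?D \<omega>)\<^sup>2)"
    using indep_var_lebesgue_integral[OF ind2 i\<eta> mom(3)] indep_var_integrable[OF ind2 i\<eta> mom(3)] mom(4) by auto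
  have eq: "(norm (Z \<omega> + ?D \<omega> *\<^sub>R \<eta> \<omega>))\<^sup>2 = ((norm (Z \<omega>))\<^sup>2 + 2 * ((Z \<omega> \<bullet> \<eta> \<omega>) * ?D \<omega>)) + (norm (\<eta> \<omega>))\<^sup>2 * (?D \<omega>)\<^sup>2" for \<omega>
    unfolding power2_norm_eq_inner
    by (simp add: inner_add inner_commute[of "\<eta> \<omega>" "Z \<omega>"] power2_eq_square algebra_simps)
  have "integrable M (\<lambda>\<omega>. (norm (Z \<omega> + ?D \<omega> *\<^sub>R \<eta> \<omega>))\<^sup>2)"
    unfolding eq using iZ c1 c2 by simp
  then have "l2sq M (\<lambda>\<omega>. Z \<omega> + ?D \<omega> *\<^sub>R \<eta> \<omega>) = ennreal (expectation (\<lambda>\<omega>. (norm (Z \<omega> + ?D \<omega> *\<^sub>R \<eta> \<omega>))\<^sup>2))"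
    unfolding l2sq_def by (intro nn_integral_eq_integral) auto
  also have "expectation (\<lambda>\<omega>. (norm (Z \<omega> + ?D \<omega> *\<^sub>R \<eta> \<omega>))\<^sup>2)
      = expectation (\<lambda>\<omega>. (norm (Z \<omega>))\<^sup>2) + expectation (\<lambda>\<omega>. (norm (\<eta> \<omega>))\<^sup>2) * (b - a)"
    unfolding eq using iZ c1 c2 by simp
  also have "ennreal \<dots> = ennreal (expectation (\<lambda>\<omega>. (norm (Z \<omega>))\<^sup>2))
      + ennreal (b - a) * ennreal (expectation (\<lambda>\<omega>. (norm (\<eta> \<omega>))\<^sup>2))"
    using ab by (simp add: ennreal_mult[symmetric] ennreal_plus[symmetric] mult.commute del: ennreal_plus)
  also have "\<dots> = l2sq M Z + ennreal (b - a) * l2sq M \<eta>"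
    unfolding l2sq_def using iZ i\<eta> by (simp add: nn_integral_eq_integral)
  finally show ?thesis .
qed

section \<open>Adapted processes and integrals of simple processes\<close>

lemma L2_adapted_measurable:
  "\<xi> \<in> L2_adapted M W S u \<Longrightarrow> (\<lambda>(t, \<omega>). \<xi> t \<omega>) \<in> borel_measurable (time_interval S u \<Otimes>\<^sub>M M)"
  unfolding L2_adapted_def by blast

lemma L2_adapted_section:
  "\<xi> \<in> L2_adapted M W S u \<Longrightarrow> t \<in> {S<..<u} \<Longrightarrow> \<xi> t \<in> borel_measurable M"
  by (rule measurable_process_section[OF L2_adapted_measurable])

lemma measurable_pair_lincomb:
  assumes "(\<lambda>(t, \<omega>). \<xi> t \<omega>) \<in> borel_measurable N" "(\<lambda>(t, \<omega>). \<zeta> t \<omega>) \<in> borel_measurable N"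
  shows "(\<lambda>(t, \<omega>). c *\<^sub>R \<xi> t \<omega> + d *\<^sub>R \<zeta> t \<omega> :: 'b::euclidean_space) \<in> borel_measurable N"
  using assms unfolding case_prod_beta'
  by (intro borel_measurable_add borel_measurable_diff borel_measurable_scaleR borel_measurable_const)

lemma measurable_pair_diff:
  assumes "(\<lambda>(t, \<omega>). \<xi> t \<omega>) \<in> borel_measurable N" "(\<lambda>(t, \<omega>). \<zeta> t \<omega>) \<in> borel_measurable N"
  shows "(\<lambda>(t, \<omega>). \<xi> t \<omega> - \<zeta> t \<omega> :: 'b::euclidean_space) \<in> borel_measurable N"
  using assms unfolding case_prod_beta'
  by (intro borel_measurable_add borel_measurable_diff borel_measurable_scaleR borel_measurable_const)

lemma process_sqnorm_diff_eq:
  fixes \<xi> \<zeta> :: "real \<Rightarrow> 'w \<Rightarrow> 'b::euclidean_space"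
  assumes "(\<lambda>(t, \<omega>). \<xi> t \<omega>) \<in> borel_measurable (time_interval S u \<Otimes>\<^sub>M M)"
    "(\<lambda>(t, \<omega>). \<zeta> t \<omega>) \<in> borel_measurable (time_interval S u \<Otimes>\<^sub>M M)"
  shows "process_sqnorm M S u (\<lambda>t \<omega>. \<xi> t \<omega> - \<zeta> t \<omega>) =
    l2sq (time_interval S u \<Otimes>\<^sub>M M) (\<lambda>x. (case x of (t, \<omega>) \<Rightarrow> \<xi> t \<omega>) - (case x of (t, \<omega>) \<Rightarrow> \<zeta> t \<omega>))"
  by (subst process_sqnorm_eq_l2sq[OF measurable_pair_diff[OF assms]]) (simp add: case_prod_beta')

lemma L2_adapted_lincomb:
  fixes \<xi> \<zeta> :: "real \<Rightarrow> 'w \<Rightarrow> 'b::euclidean_space"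
  assumes \<xi>: "\<xi> \<in> L2_adapted M W S u" and \<zeta>: "\<zeta> \<in> L2_adapted M W S u"
  shows "(\<lambda>t \<omega>. c *\<^sub>R \<xi> t \<omega> + d *\<^sub>R \<zeta> t \<omega>) \<in> L2_adapted M W S u"
proof -
  note m = L2_adapted_measurable[OF \<xi>] L2_adapted_measurable[OF \<zeta>]
  have "l2sq (time_interval S u \<Otimes>\<^sub>M M) (\<lambda>x. c *\<^sub>R (case x of (t, \<omega>) \<Rightarrow> \<xi> t \<omega>) + d *\<^sub>R (case x of (t, \<omega>) \<Rightarrow> \<zeta> t \<omega>)) < \<infinity>"
    using \<xi> \<zeta> by (intro l2sq_lincomb_finite m) (simp_all flip: process_sqnorm_eq_l2sq[OF m(1)]
       process_sqnorm_eq_l2sq[OF m(2)] add: L2_adapted_def)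
  then have "process_sqnorm M S u (\<lambda>t \<omega>. c *\<^sub>R \<xi> t \<omega> + d *\<^sub>R \<zeta> t \<omega>) < \<infinity>"
    by (subst process_sqnorm_eq_l2sq[OF measurable_pair_lincomb[OF m]]) (simp add: case_prod_beta')
  moreover have "(\<lambda>\<omega>. c *\<^sub>R \<xi> t \<omega> + d *\<^sub>R \<zeta> t \<omega>) \<in> borel_measurable (F t)" if "t \<in> {S<..<u}" for t
    using \<xi> \<zeta> that unfolding L2_adapted_def
    by (intro borel_measurable_add borel_measurable_scaleR borel_measurable_const) blast+
  ultimately show ?thesis
    using measurable_pair_lincomb[OF m, of c d] unfolding L2_adapted_def by blast
qed

lemma simple_data_bounds:
  assumes "simple_data M W S u N p \<eta>"
  shows "i \<le> j \<Longrightarrow> j \<le> N \<Longrightarrow> p i \<le> p j" "i \<le> N \<Longrightarrow> S \<le> p i" "i \<le> N \<Longrightarrow> p i \<le> u"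
proof -
  have *: "p i \<le> p j" if "i \<le> j" "j \<le> N" for i j
    using that assms by (induction rule: dec_induct) (auto simp: simple_data_def intro: order_trans)
  show "i \<le> j \<Longrightarrow> j \<le> N \<Longrightarrow> p i \<le> p j" by (rule *)
  show "i \<le> N \<Longrightarrow> S \<le> p i" "i \<le> N \<Longrightarrow> p i \<le> u"
    using *[of 0 i] *[of i N] assms by (auto simp: simple_data_def)
qed

lemma simple_data_l2:
  assumes "simple_data M W S u N p \<eta>" "i < N"
  shows "\<eta> i \<in> borel_measurable (F (p i))" "\<eta> i \<in> borel_measurable M" "l2sq M (\<eta> i) < \<infinity>"
proof -
  show 1: "\<eta> i \<in> borel_measurable (F (p i))" using assms by (auto simp: simple_data_def)
  then show 2: "\<eta> i \<in> borel_measurable M" by (rule measurable_F_imp)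
  have "\<exists>B. \<forall>\<omega>\<in>space M. norm (\<eta> i \<omega>) \<le> B"
    using assms unfolding simple_data_def by blast
  then obtain B where B: "\<And>\<omega>. \<omega> \<in> space M \<Longrightarrow> norm (\<eta> i \<omega>) \<le> B"
    by blast
  have "l2sq M (\<eta> i) \<le> (\<integral>\<^sup>+\<omega>. ennreal (B\<^sup>2) \<partial>M)"
    unfolding l2sq_def using B by (intro nn_integral_mono ennreal_leI power_mono) auto
  also have "\<dots> < \<infinity>" by (simp add: emeasure_space_1)
  finally show "l2sq M (\<eta> i) < \<infinity>" .
qed

lemma simple_process_measurable:
  assumes "simple_data M W S u N p \<eta>"
  shows "(\<lambda>(t, \<omega>). simple_process N p \<eta> t \<omega>) \<in> borel_measurable (time_interval S u \<Otimes>\<^sub>M M)"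
proof -
  have [measurable]: "\<eta> i \<in> borel_measurable M" if "i \<in> {..<N}" for i
    using simple_data_l2[OF assms, of i] that by simp
  have [measurable]: "(\<lambda>x. indicat_real {p i<..p (Suc i)} (fst x)) \<in> borel_measurable (time_interval S u \<Otimes>\<^sub>M M)" for i
    by (rule measurable_compose[OF measurable_fst]) (simp add: measurable_restrict_space1)
  show ?thesis unfolding simple_process_def case_prod_beta' by measurable
qed

lemma simple_integral_measurable:
  assumes "simple_data M W S u N p \<eta>"
  shows "simple_integral W N p \<eta> \<in> borel_measurable M"
proof -
  have [measurable]: "\<eta> i \<in> borel_measurable M" "W (p i) \<in> borel_measurable M"
    "W (p (Suc i)) \<in> borel_measurable M" if "i \<in> {..<N}" for i
    using simple_data_l2[OF assms, of i] that simple_data_bounds(2)[OF assms] S_nonneg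
    by (auto intro!: W_measurable intro: order_trans)
  have "simple_integral W N p \<eta> = (\<lambda>\<omega>. \<Sum>i<N. (W (p (Suc i)) \<omega> - W (p i) \<omega>) *\<^sub>R \<eta> i \<omega>)"
    by (rule ext) (simp add: simple_integral_def)
  also have "\<dots> \<in> borel_measurable M" by measurable
  finally show ?thesis .
qed

text \<open>At most one of the sets contains \<open>t\<close>, so the square of the sum has no cross
  terms.\<close>

lemma norm_sum_disjoint_sq:
  fixes v :: "nat \<Rightarrow> 'b::real_normed_vector"
  assumes "\<And>i j. i < N \<Longrightarrow> j < N \<Longrightarrow> i \<noteq> j \<Longrightarrow> \<not> (t \<in> I i \<and> t \<in> I j)"
  shows "(norm (\<Sum>i<N. indicat_real (I i) t *\<^sub>R v i))\<^sup>2 = (\<Sum>i<N. indicat_real (I i) t * (norm (v i))\<^sup>2)"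
proof (cases "\<exists>i0<N. t \<in> I i0")
  case True
  then obtain i0 where i0: "i0 < N" "t \<in> I i0" by blast
  then have ind: "indicat_real (I i) t = (if i = i0 then 1 else 0)" if "i < N" for i
    using assms[of i i0] that by (auto simp: indicator_def)
  have "(\<Sum>i<N. indicat_real (I i) t *\<^sub>R v i) = (\<Sum>i<N. if i = i0 then v i0 else 0)"
    using ind by (intro sum.cong) auto
  moreover have "(\<Sum>i<N. indicat_real (I i) t * (norm (v i))\<^sup>2) = (\<Sum>i<N. if i = i0 then (norm (v i0))\<^sup>2 else 0)"
    using ind by (intro sum.cong) auto
  ultimately show ?thesis using i0 by simp
qed (simp add: indicator_def)

lemma process_sqnorm_simple:
  fixes \<eta> :: "nat \<Rightarrow> 'w \<Rightarrow> 'b::euclidean_space"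
  assumes d: "simple_data M W S u N p \<eta>"
  shows "process_sqnorm M S u (simple_process N p \<eta>) = (\<Sum>i<N. ennreal (p (Suc i) - p i) * l2sq M (\<eta> i))"
proof -
  have [measurable]: "\<eta> i \<in> borel_measurable M" if "i \<in> {..<N}" for i
    using simple_data_l2[OF d, of i] that by simp
  have sec: "l2sq M (simple_process N p \<eta> t) = (\<Sum>i<N. indicator {p i<..p (Suc i)} t * l2sq M (\<eta> i))" for t
  proof -
    have disj: "\<not> (t \<in> {p i<..p (Suc i)} \<and> t \<in> {p j<..p (Suc j)})" if ij: "i < N" "j < N" "i \<noteq> j" for i j
    proof -
      have "p (Suc i) \<le> p j \<or> p (Suc j) \<le> p i"
        using simple_data_bounds(1)[OF d, of "Suc i" j] simple_data_bounds(1)[OF d, of "Suc j" i] ij by linarith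
      then show ?thesis by auto
    qed
    have "l2sq M (simple_process N p \<eta> t)
      = (\<integral>\<^sup>+\<omega>. (\<Sum>i<N. ennreal (indicat_real {p i<..p (Suc i)} t * (norm (\<eta> i \<omega>))\<^sup>2)) \<partial>M)"
      unfolding l2sq_def simple_process_def
      by (intro nn_integral_cong, subst norm_sum_disjoint_sq[OF disj]) auto
    also have "\<dots> = (\<Sum>i<N. \<integral>\<^sup>+\<omega>. ennreal (indicat_real {p i<..p (Suc i)} t * (norm (\<eta> i \<omega>))\<^sup>2) \<partial>M)"
      by (rule nn_integral_sum) measurable
    also have "\<dots> = (\<Sum>i<N. indicator {p i<..p (Suc i)} t * l2sq M (\<eta> i))"
      unfolding l2sq_def by (intro sum.cong refl) (auto simp: indicator_def)
    finally show ?thesis .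
  qed
  have len: "(\<integral>\<^sup>+t. indicator {p i<..p (Suc i)} t \<partial>time_interval S u) = ennreal (p (Suc i) - p i)" if "i < N" for i
  proof -
    have "(\<integral>\<^sup>+t. indicator {p i<..p (Suc i)} t \<partial>time_interval S u)
      = (\<integral>\<^sup>+t. indicator {p i<..p (Suc i)} t * indicator {S<..<u} t \<partial>lborel)"
      by (rule nn_integral_time_interval)
    \<comment> \<open>The intervals are closed on the right, so the last one may contain the end
      point \<open>u\<close>, which the open time interval misses; a single point is null.\<close>
    also have "\<dots> = (\<integral>\<^sup>+t. indicator {p i<..p (Suc i)} t \<partial>lborel)"
      using AE_lborel_singleton[of u] simple_data_bounds[OF d, of i] simple_data_bounds[OF d, of "Suc i"] that
      by (intro nn_integral_cong_AE) (auto elim!: eventually_mono split: split_indicator)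
    also have "\<dots> = ennreal (p (Suc i) - p i)"
      using simple_data_bounds(1)[OF d, of i "Suc i"] that by simp
    finally show ?thesis .
  qed
  have "process_sqnorm M S u (simple_process N p \<eta>) = (\<integral>\<^sup>+t. (\<Sum>i<N. indicator {p i<..p (Suc i)} t * l2sq M (\<eta> i)) \<partial>time_interval S u)"
    by (subst process_sqnorm_eq_nn_integral[OF simple_process_measurable[OF d]]) (simp only: sec)
  also have "\<dots> = (\<Sum>i<N. (\<integral>\<^sup>+t. indicator {p i<..p (Suc i)} t * l2sq M (\<eta> i) \<partial>time_interval S u))"
    by (rule nn_integral_sum) (auto intro!: borel_measurable_times_ennreal measurable_restrict_space1)
  also have "\<dots> = (\<Sum>i<N. (\<integral>\<^sup>+t. indicator {p i<..p (Suc i)} t \<partial>time_interval S u) * l2sq M (\<eta> i))"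
    by (intro sum.cong refl nn_integral_multc measurable_restrict_space1) auto
  finally show ?thesis using len by simp
qed

text \<open>When the steps are added one at a time, each partial sum is known at time
  \<open>p k\<close>, so \<open>l2sq_add_increment\<close> applies. The constant \<open>c\<close>
  starts the induction and later carries the order 0 term of a chaos sum.\<close>

lemma simple_integral_isometry:
  fixes \<eta> :: "nat \<Rightarrow> 'w \<Rightarrow> 'b::euclidean_space"
  assumes d: "simple_data M W S u N p \<eta>"
  shows "l2sq M (\<lambda>\<omega>. c + simple_integral W N p \<eta> \<omega>) =
    ennreal ((norm c)\<^sup>2) + process_sqnorm M S u (simple_process N p \<eta>)"
proof -
  let ?Z = "\<lambda>k \<omega>. c + (\<Sum>i<k. (W (p (Suc i)) \<omega> - W (p i) \<omega>) *\<^sub>R \<eta> i \<omega>)"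
  have "?Z k \<in> borel_measurable (F (p k)) \<and>
    l2sq M (?Z k) = ennreal ((norm c)\<^sup>2) + (\<Sum>i<k. ennreal (p (Suc i) - p i) * l2sq M (\<eta> i))" if "k \<le> N" for k
    using that
  proof (induction k)
    case 0
    show ?case by (simp add: l2sq_def emeasure_space_1)
  next
    case (Suc k)
    then have k: "k < N" and m: "?Z k \<in> borel_measurable (F (p k))"
      and eq: "l2sq M (?Z k) = ennreal ((norm c)\<^sup>2) + (\<Sum>i<k. ennreal (p (Suc i) - p i) * l2sq M (\<eta> i))" by auto
    note dk = simple_data_l2[OF d k]
    have ord: "S \<le> p k" "p k \<le> p (Suc k)" using simple_data_bounds(1)[OF d, of k "Suc k"] simple_data_bounds(2)[OF d, of k] k by auto
    have "l2sq M (?Z k) < \<infinity>"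
      unfolding eq using simple_data_l2(3)[OF d] k by (auto simp: ennreal_mult_less_top)
    then have "l2sq M (\<lambda>\<omega>. ?Z k \<omega> + (W (p (Suc k)) \<omega> - W (p k) \<omega>) *\<^sub>R \<eta> k \<omega>) = l2sq M (?Z k) + ennreal (p (Suc k) - p k) * l2sq M (\<eta> k)"
      by (rule l2sq_add_increment[OF m dk(1) _ dk(3) ord])
    moreover have "(\<lambda>\<omega>. ?Z k \<omega> + (W (p (Suc k)) \<omega> - W (p k) \<omega>) *\<^sub>R \<eta> k \<omega>) \<in> borel_measurable (F (p (Suc k)))"
      by (rule borel_measurable_add[OF measurable_F_mono[OF ord(2) m]
         borel_measurable_scaleR[OF increment_F[OF ord order_refl] measurable_F_mono[OF ord(2) dk(1)]]])
    ultimately show ?case by (simp add: eq add.assoc)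
  qed
  from this[of N] show ?thesis
    by (simp add: process_sqnorm_simple[OF d] simple_integral_def)
qed

text \<open>Quantifying over \<open>G\<close> treats the simple integral and the simple process at
  once: both are sums of increments of a function along the partition, namely of a path of
  \<open>W\<close> and of the indicator of the half-line from \<open>t\<close> on.\<close>

lemma simple_data_refine:
  fixes \<eta> :: "nat \<Rightarrow> 'w \<Rightarrow> 'b::euclidean_space"
  assumes d: "simple_data M W S u N p \<eta>"
    and q: "\<And>i j. i < j \<Longrightarrow> j \<le> m \<Longrightarrow> q i < q j" "q 0 = S" "q m = u" "p ` {..N} \<subseteq> q ` {..m}"
  shows "\<exists>g. simple_data M W S u m q g \<and>
    (\<forall>(G::real \<Rightarrow> real) \<omega>. (\<Sum>j<m. (G (q (Suc j)) - G (q j)) *\<^sub>R g j \<omega>) = (\<Sum>i<N. (G (p (Suc i)) - G (p i)) *\<^sub>R \<eta> i \<omega>))"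
proof -
  have qle: "q i \<le> q j \<longleftrightarrow> i \<le> j" if "i \<le> m" "j \<le> m" for i j
    using q(1)[of i j] q(1)[of j i] that by (cases i j rule: linorder_cases) auto
  have "\<forall>i\<in>{..N}. \<exists>k\<le>m. q k = p i" using q(4) by fastforce
  then obtain k where k: "\<And>i. i \<le> N \<Longrightarrow> k i \<le> m" "\<And>i. i \<le> N \<Longrightarrow> q (k i) = p i" by (metis atMost_iff)
  \<comment> \<open>On the subinterval number \<open>j\<close> the refined value is the
    \<open>\<eta> i\<close> whose interval contains it, that is, \<open>k i \<le> j\<close> and
    \<open>j < k (Suc i)\<close>; an interval of length 0 contributes to no \<open>j\<close>. As
    then \<open>p i \<le> q j\<close>, the value is known at time \<open>q j\<close>.\<close>
  define g where "g j \<omega> = (\<Sum>i<N. (if k i \<le> j \<and> j < k (Suc i) then 1 else (0::real)) *\<^sub>R \<eta> i \<omega>)" for j \<omega>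
  have kmono: "k i \<le> k (Suc i)" if "i < N" for i
    using simple_data_bounds(1)[OF d, of i "Suc i"] that k[of i] k[of "Suc i"] qle[of "k i" "k (Suc i)"] by simp
  have "simple_data M W S u m q g"
    unfolding simple_data_def
  proof (intro conjI allI impI)
    fix j assume j: "j < m"
    show "q j \<le> q (Suc j)" using q(1)[of j "Suc j"] j by simp
    have "(\<lambda>\<omega>. (if k i \<le> j \<and> j < k (Suc i) then 1 else (0::real)) *\<^sub>R \<eta> i \<omega>) \<in> borel_measurable (F (q j))" if "i < N" for i
    proof (cases "k i \<le> j \<and> j < k (Suc i)")
      case True
      then have "p i \<le> q j" using k[of i] that qle[of "k i" j] j by simp
      moreover have "(\<lambda>\<omega>. (if k i \<le> j \<and> j < k (Suc i) then 1 else (0::real)) *\<^sub>R \<eta> i \<omega>) = \<eta> i"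
        using True by auto
      ultimately show ?thesis using measurable_F_mono[OF _ simple_data_l2(1)[OF d that]] by (simp only:)
    next
      case False
      then have "(\<lambda>\<omega>. (if k i \<le> j \<and> j < k (Suc i) then 1 else (0::real)) *\<^sub>R \<eta> i \<omega>) = (\<lambda>\<omega>. 0)"
        by auto
      then show ?thesis by (simp only: borel_measurable_const)
    qed
    note term_F = this
    show "g j \<in> borel_measurable (F (q j))"
      unfolding g_def by (rule borel_measurable_sum, rule term_F) (simp only: lessThan_iff)
    have "\<forall>i<N. \<exists>B. \<forall>\<omega>\<in>space M. norm (\<eta> i \<omega>) \<le> B" using d by (auto simp: simple_data_def)
    then obtain B where B: "\<And>i \<omega>. i < N \<Longrightarrow> \<omega> \<in> space M \<Longrightarrow> norm (\<eta> i \<omega>) \<le> B i" by metis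
    show "\<exists>B. \<forall>\<omega>\<in>space M. norm (g j \<omega>) \<le> B"
    proof (intro exI[of _ "\<Sum>i<N. B i"] ballI)
      fix \<omega> assume "\<omega> \<in> space M"
      then have "norm (\<eta> i \<omega>) \<le> B i" "0 \<le> B i" if "i < N" for i
        using B[OF that] norm_ge_zero[of "\<eta> i \<omega>"] by (auto intro: order_trans[OF norm_ge_zero[of "\<eta> i \<omega>"]])
      then show "norm (g j \<omega>) \<le> (\<Sum>i<N. B i)"
        unfolding g_def by (intro sum_norm_le) auto
    qed
  qed (simp_all only: q)
  moreover have "(\<Sum>j<m. (G (q (Suc j)) - G (q j)) *\<^sub>R g j \<omega>) = (\<Sum>i<N. (G (p (Suc i)) - G (p i)) *\<^sub>R \<eta> i \<omega>)"
    for G :: "real \<Rightarrow> real" and \<omega>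
  proof -
    have "(\<Sum>j<m. (G (q (Suc j)) - G (q j)) *\<^sub>R g j \<omega>)
      = (\<Sum>i<N. \<Sum>j<m. ((G (q (Suc j)) - G (q j)) * (if k i \<le> j \<and> j < k (Suc i) then 1 else 0)) *\<^sub>R \<eta> i \<omega>)"
      unfolding g_def scaleR_sum_right by (subst sum.swap) (simp add: scaleR_scaleR)
    also have "\<dots> = (\<Sum>i<N. (G (p (Suc i)) - G (p i)) *\<^sub>R \<eta> i \<omega>)"
    proof (intro sum.cong refl)
      fix i assume i: "i \<in> {..<N}"
      have "(\<Sum>j<m. ((G (q (Suc j)) - G (q j)) * (if k i \<le> j \<and> j < k (Suc i) then 1 else 0)) *\<^sub>R \<eta> i \<omega>)
        = (\<Sum>j<m. (G (q (Suc j)) - G (q j)) * (if k i \<le> j \<and> j < k (Suc i) then 1 else 0)) *\<^sub>R \<eta> i \<omega>"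
        by (rule scaleR_sum_left[symmetric])
      also have "(\<Sum>j<m. (G (q (Suc j)) - G (q j)) * (if k i \<le> j \<and> j < k (Suc i) then 1 else 0))
        = (\<Sum>j\<in>{k i..<k (Suc i)}. G (q (Suc j)) - G (q j))"
        using k(1)[of "Suc i"] i by (intro sum.mono_neutral_cong_right) auto
      also have "\<dots> = G (p (Suc i)) - G (p i)"
        using sum_Suc_diff'[OF kmono[of i], where f="\<lambda>j. G (q j)"] k[of i] k[of "Suc i"] i by simp
      finally show "(\<Sum>j<m. ((G (q (Suc j)) - G (q j)) * (if k i \<le> j \<and> j < k (Suc i) then 1 else 0)) *\<^sub>R \<eta> i \<omega>)
        = (G (p (Suc i)) - G (p i)) *\<^sub>R \<eta> i \<omega>" .
    qed
    finally show ?thesis .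
  qed
  ultimately show ?thesis by blast
qed

text \<open>The form of the process to which \<open>simple_data_refine\<close> applies, with
  \<open>G x = (if t \<le> x then 1 else 0)\<close>.\<close>

lemma simple_process_telescope:
  assumes "simple_data M W S u N p \<eta>"
  shows "simple_process N p \<eta> t \<omega> =
    (\<Sum>i<N. ((if t \<le> p (Suc i) then 1 else 0) - (if t \<le> p i then 1 else (0::real))) *\<^sub>R \<eta> i \<omega>)"
  unfolding simple_process_def
proof (intro sum.cong refl arg_cong2[where f=scaleR])
  fix i assume "i \<in> {..<N}"
  then have "p i \<le> p (Suc i)" using assms by (simp add: simple_data_def)
  then show "indicat_real {p i<..p (Suc i)} t = (if t \<le> p (Suc i) then 1 else 0) - (if t \<le> p i then 1 else 0)"
    by (auto simp: indicator_def)
qed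

text \<open>Both are refined to the sorted list of all their partition points, which has no
  repetitions and so gives the strictly increasing partition that \<open>simple_data_refine\<close>
  requires. On a common partition the values are combined pointwise.\<close>

lemma simple_data_lincomb:
  fixes \<eta> \<eta>' :: "nat \<Rightarrow> 'w \<Rightarrow> 'b::euclidean_space"
  assumes d: "simple_data M W S u N p \<eta>" and d': "simple_data M W S u N' p' \<eta>'"
  shows "\<exists>m q g. simple_data M W S u m q g \<and>
    (\<forall>t \<omega>. simple_process m q g t \<omega> = c *\<^sub>R simple_process N p \<eta> t \<omega> + c' *\<^sub>R simple_process N' p' \<eta>' t \<omega>) \<and>
    (\<forall>\<omega>. simple_integral W m q g \<omega> = c *\<^sub>R simple_integral W N p \<eta> \<omega> + c' *\<^sub>R simple_integral W N' p' \<eta>' \<omega>)"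
proof -
  define P where "P = p ` {..N} \<union> p' ` {..N'}"
  have fin: "finite P" by (simp add: P_def)
  define L where "L = sorted_list_of_set P"
  have setL: "set L = P" unfolding L_def by (rule set_sorted_list_of_set[OF fin])
  have sortL: "sorted L" and distL: "distinct L" unfolding L_def by simp_all
  have "p 0 \<in> P" "p N \<in> P" by (auto simp: P_def)
  then have SP: "S \<in> P" "u \<in> P" using d by (auto simp: simple_data_def)
  have bd: "S \<le> x" "x \<le> u" if "x \<in> P" for x
    using that simple_data_bounds[OF d] simple_data_bounds[OF d'] by (auto simp: P_def)
  define m where "m = length L - 1"
  have len: "length L > 0" using SP setL by auto
  have less: "L ! i < L ! j" if "i < j" "j \<le> m" for i j
  proof -
    have "j < length L" using that len unfolding m_def by linarith
    moreover from this that have "L ! i \<noteq> L ! j" using distL by (simp add: nth_eq_iff_index_eq)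
    ultimately show ?thesis using sorted_nth_mono[OF sortL, of i j] that by simp
  qed
  have img: "P = (!) L ` {..m}"
  proof -
    have "length L = Suc m" using len unfolding m_def by linarith
    then have "{..m} = {..<length L}" by auto
    then show ?thesis unfolding setL[symmetric] set_conv_nth by auto
  qed
  have le: "L ! i \<le> L ! j" if "i \<le> j" "j \<le> m" for i j
    using less[of i j] that by (cases "i = j") auto
  have L0: "L ! 0 = S"
  proof (rule antisym)
    obtain i where "i \<le> m" "L ! i = S" using SP(1) img by auto
    then show "L ! 0 \<le> S" using le[of 0 i] by simp
    show "S \<le> L ! 0" by (rule bd) (auto simp: img)
  qed
  have Lm: "L ! m = u"
  proof (rule antisym)
    obtain i where "i \<le> m" "L ! i = u" using SP(2) img by auto
    then show "u \<le> L ! m" using le[of i m] by simp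
    show "L ! m \<le> u" by (rule bd) (auto simp: img)
  qed
  obtain g where g: "simple_data M W S u m ((!) L) g"
    "\<And>(G::real \<Rightarrow> real) \<omega>. (\<Sum>j<m. (G (L ! Suc j) - G (L ! j)) *\<^sub>R g j \<omega>) = (\<Sum>i<N. (G (p (Suc i)) - G (p i)) *\<^sub>R \<eta> i \<omega>)"
    using simple_data_refine[OF d less L0 Lm] img unfolding P_def by blast
  obtain g' where g': "simple_data M W S u m ((!) L) g'"
    "\<And>(G::real \<Rightarrow> real) \<omega>. (\<Sum>j<m. (G (L ! Suc j) - G (L ! j)) *\<^sub>R g' j \<omega>) = (\<Sum>i<N'. (G (p' (Suc i)) - G (p' i)) *\<^sub>R \<eta>' i \<omega>)"
    using simple_data_refine[OF d' less L0 Lm] img unfolding P_def by blast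
  define h where "h j \<omega> = c *\<^sub>R g j \<omega> + c' *\<^sub>R g' j \<omega>" for j \<omega>
  have h: "(\<Sum>j<m. (G (L ! Suc j) - G (L ! j)) *\<^sub>R h j \<omega>) =
     c *\<^sub>R (\<Sum>i<N. (G (p (Suc i)) - G (p i)) *\<^sub>R \<eta> i \<omega>) + c' *\<^sub>R (\<Sum>i<N'. (G (p' (Suc i)) - G (p' i)) *\<^sub>R \<eta>' i \<omega>)"
    for G :: "real \<Rightarrow> real" and \<omega>
    unfolding g(2)[symmetric] g'(2)[symmetric] scaleR_sum_right h_def
    by (simp add: scaleR_add_right sum.distrib mult.commute)
  have sd: "simple_data M W S u m ((!) L) h"
    unfolding simple_data_def
  proof (intro conjI allI impI)
    fix j assume j: "j < m"
    show "L ! j \<le> L ! Suc j" using le[of j "Suc j"] j by simp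
    show "h j \<in> borel_measurable (F (L ! j))" unfolding h_def
      using simple_data_l2(1)[OF g(1) j] simple_data_l2(1)[OF g'(1) j] by simp
    have "\<exists>B. \<forall>\<omega>\<in>space M. norm (g j \<omega>) \<le> B" "\<exists>B. \<forall>\<omega>\<in>space M. norm (g' j \<omega>) \<le> B"
      using g(1) g'(1) j unfolding simple_data_def by blast+
    then obtain B B' where "\<forall>\<omega>\<in>space M. norm (g j \<omega>) \<le> B" "\<forall>\<omega>\<in>space M. norm (g' j \<omega>) \<le> B'"
      by blast
    then show "\<exists>B. \<forall>\<omega>\<in>space M. norm (h j \<omega>) \<le> B"
      unfolding h_def by (intro exI[of _ "\<bar>c\<bar> * B + \<bar>c'\<bar> * B'"] ballI norm_triangle_le)
        (auto intro!: add_mono mult_left_mono)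
  qed (use L0 Lm in auto)
  show ?thesis
  proof (intro exI conjI allI)
    show "simple_data M W S u m ((!) L) h" by fact
    show "simple_process m ((!) L) h t \<omega> = c *\<^sub>R simple_process N p \<eta> t \<omega> + c' *\<^sub>R simple_process N' p' \<eta>' t \<omega>" for t \<omega>
      unfolding simple_process_telescope[OF sd] simple_process_telescope[OF d] simple_process_telescope[OF d']
      by (rule h[of "\<lambda>x. if t \<le> x then 1 else 0"])
    show "simple_integral W m ((!) L) h \<omega> = c *\<^sub>R simple_integral W N p \<eta> \<omega> + c' *\<^sub>R simple_integral W N' p' \<eta>' \<omega>" for \<omega>
      unfolding simple_integral_def by (rule h[of "\<lambda>x. W x \<omega>"])
  qed
qed

section \<open>The Ito integral\<close>

lemma has_ito_integralD:
  assumes "has_ito_integral M W S u Y X"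
  shows "Y \<in> L2_adapted M W S u" "X \<in> borel_measurable M"
  using assms unfolding has_ito_integral_def by blast+

lemma has_ito_integral_approx:
  assumes "has_ito_integral M W S u Y X" "e > 0"
  shows "\<exists>N p \<eta>. simple_data M W S u N p \<eta> \<and>
    process_sqnorm M S u (\<lambda>t \<omega>. simple_process N p \<eta> t \<omega> - Y t \<omega>) < e \<and>
    l2sq M (\<lambda>\<omega>. simple_integral W N p \<eta> \<omega> - X \<omega>) < e"
proof -
  from assms(1) obtain N p \<eta> where d: "\<And>k::nat. simple_data M W S u (N k) (p k) (\<eta> k)"
    and l: "(\<lambda>k. process_sqnorm M S u (\<lambda>t \<omega>. simple_process (N k) (p k) (\<eta> k) t \<omega> - Y t \<omega>)) \<longlonglongrightarrow> 0"
     "(\<lambda>k. l2sq M (\<lambda>\<omega>. simple_integral W (N k) (p k) (\<eta> k) \<omega> - X \<omega>)) \<longlonglongrightarrow> 0"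
    unfolding has_ito_integral_def l2sq_def by blast
  from order_tendstoD(2)[OF l(1) \<open>e > 0\<close>] order_tendstoD(2)[OF l(2) \<open>e > 0\<close>]
  have "\<forall>\<^sub>F k in sequentially. process_sqnorm M S u (\<lambda>t \<omega>. simple_process (N k) (p k) (\<eta> k) t \<omega> - Y t \<omega>) < e \<and>
    l2sq M (\<lambda>\<omega>. simple_integral W (N k) (p k) (\<eta> k) \<omega> - X \<omega>) < e"
    by eventually_elim blast
  then obtain k where "process_sqnorm M S u (\<lambda>t \<omega>. simple_process (N k) (p k) (\<eta> k) t \<omega> - Y t \<omega>) < e \<and>
    l2sq M (\<lambda>\<omega>. simple_integral W (N k) (p k) (\<eta> k) \<omega> - X \<omega>) < e"
    by (auto simp: eventually_sequentially)
  with d show ?thesis by blast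
qed

text \<open>Diagonal choice: the \<open>k\<close>-th approximant is a simple process within
  \<open>inverse (Suc k)\<close> of \<open>Yk k\<close> whose integral is equally close to
  \<open>Xk k\<close>.\<close>

lemma has_ito_integral_limit:
  fixes Y :: "real \<Rightarrow> 'w \<Rightarrow> 'b::euclidean_space"
  assumes ito: "\<And>k. has_ito_integral M W S u (Yk k) (Xk k)"
    and Y: "Y \<in> L2_adapted M W S u" and X: "X \<in> borel_measurable M"
    and limY: "(\<lambda>k. process_sqnorm M S u (\<lambda>t \<omega>. Yk k t \<omega> - Y t \<omega>)) \<longlonglongrightarrow> 0"
    and limX: "(\<lambda>k. l2sq M (\<lambda>\<omega>. Xk k \<omega> - X \<omega>)) \<longlonglongrightarrow> 0"
  shows "has_ito_integral M W S u Y X"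
proof -
  let ?P = "time_interval S u \<Otimes>\<^sub>M M"
  have "\<forall>k. \<exists>N p \<eta>. simple_data M W S u N p \<eta> \<and>
    process_sqnorm M S u (\<lambda>t \<omega>. simple_process N p \<eta> t \<omega> - Yk k t \<omega>) < ennreal (inverse (Suc k)) \<and>
    l2sq M (\<lambda>\<omega>. simple_integral W N p \<eta> \<omega> - Xk k \<omega>) < ennreal (inverse (Suc k))"
    using has_ito_integral_approx[OF ito] by (simp add: ennreal_zero_less_one)
  then obtain N p \<eta> where d: "\<And>k. simple_data M W S u (N k) (p k) (\<eta> k)"
    and b1: "\<And>k. process_sqnorm M S u (\<lambda>t \<omega>. simple_process (N k) (p k) (\<eta> k) t \<omega> - Yk k t \<omega>) < ennreal (inverse (Suc k))"
    and b2: "\<And>k. l2sq M (\<lambda>\<omega>. simple_integral W (N k) (p k) (\<eta> k) \<omega> - Xk k \<omega>) < ennreal (inverse (Suc k))"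
    by (subst (asm) choice_iff) (subst (asm) choice_iff | elim exE | blast)+
  have inv: "(\<lambda>k. ennreal (inverse (Suc k))) \<longlonglongrightarrow> 0"
    using tendsto_ennrealI[OF LIMSEQ_inverse_real_of_nat] by simp
  have l1: "(\<lambda>k. process_sqnorm M S u (\<lambda>t \<omega>. simple_process (N k) (p k) (\<eta> k) t \<omega> - Yk k t \<omega>)) \<longlonglongrightarrow> 0"
    by (rule ennreal_tendsto_0_le[OF inv]) (rule less_imp_le[OF b1])
  have l2: "(\<lambda>k. l2sq M (\<lambda>\<omega>. simple_integral W (N k) (p k) (\<eta> k) \<omega> - Xk k \<omega>)) \<longlonglongrightarrow> 0"
    by (rule ennreal_tendsto_0_le[OF inv]) (rule less_imp_le[OF b2])
  note m1 = simple_process_measurable[OF d]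
  note m2 = L2_adapted_measurable[OF has_ito_integralD(1)[OF ito]]
  note m3 = L2_adapted_measurable[OF Y]
  have "(\<lambda>k. process_sqnorm M S u (\<lambda>t \<omega>. simple_process (N k) (p k) (\<eta> k) t \<omega> - Y t \<omega>)) \<longlonglongrightarrow> 0"
    unfolding process_sqnorm_diff_eq[OF m1 m3]
    by (rule l2sq_tendsto_0_triangle[OF m1 m2 m3])
      (use l1 limY in \<open>simp_all only: process_sqnorm_diff_eq[OF m1 m2] process_sqnorm_diff_eq[OF m2 m3]\<close>)
  moreover have "(\<lambda>k. l2sq M (\<lambda>\<omega>. simple_integral W (N k) (p k) (\<eta> k) \<omega> - X \<omega>)) \<longlonglongrightarrow> 0"
    by (rule l2sq_tendsto_0_triangle[OF simple_integral_measurable[OF d] has_ito_integralD(2)[OF ito] X l2 limX])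
  ultimately show ?thesis
    using d Y X unfolding has_ito_integral_def l2sq_def by blast
qed

lemma has_ito_integral_simple:
  assumes d: "simple_data M W S u N p \<eta>"
    and L: "simple_process N p \<eta> \<in> L2_adapted M W S u"
  shows "has_ito_integral M W S u (simple_process N p \<eta>) (simple_integral W N p \<eta>)"
  unfolding has_ito_integral_def
proof (intro conjI exI allI)
  show "simple_data M W S u ((\<lambda>_. N) k) ((\<lambda>_. p) k) ((\<lambda>_. \<eta>) k)" for k :: nat using d by simp
qed (use L simple_integral_measurable[OF d] in \<open>simp_all add: process_sqnorm_def\<close>)

lemma has_ito_integral_lincomb:
  fixes Y Y' :: "real \<Rightarrow> 'w \<Rightarrow> 'b::euclidean_space"
  assumes i: "has_ito_integral M W S u Y X" "has_ito_integral M W S u Y' X'"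
  shows "has_ito_integral M W S u (\<lambda>t \<omega>. c *\<^sub>R Y t \<omega> + c' *\<^sub>R Y' t \<omega>) (\<lambda>\<omega>. c *\<^sub>R X \<omega> + c' *\<^sub>R X' \<omega>)"
proof -
  note D = has_ito_integralD[OF i(1)] and D' = has_ito_integralD[OF i(2)]
  note mY = L2_adapted_measurable[OF D(1)] and mY' = L2_adapted_measurable[OF D'(1)]
  from i(1) obtain N p \<eta> where d: "\<And>k::nat. simple_data M W S u (N k) (p k) (\<eta> k)"
    and l: "(\<lambda>k. process_sqnorm M S u (\<lambda>t \<omega>. simple_process (N k) (p k) (\<eta> k) t \<omega> - Y t \<omega>)) \<longlonglongrightarrow> 0"
     "(\<lambda>k. l2sq M (\<lambda>\<omega>. simple_integral W (N k) (p k) (\<eta> k) \<omega> - X \<omega>)) \<longlonglongrightarrow> 0"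
    unfolding has_ito_integral_def l2sq_def by blast
  from i(2) obtain N' p' \<eta>' where d': "\<And>k::nat. simple_data M W S u (N' k) (p' k) (\<eta>' k)"
    and l': "(\<lambda>k. process_sqnorm M S u (\<lambda>t \<omega>. simple_process (N' k) (p' k) (\<eta>' k) t \<omega> - Y' t \<omega>)) \<longlonglongrightarrow> 0"
     "(\<lambda>k. l2sq M (\<lambda>\<omega>. simple_integral W (N' k) (p' k) (\<eta>' k) \<omega> - X' \<omega>)) \<longlonglongrightarrow> 0"
    unfolding has_ito_integral_def l2sq_def by blast
  note m = simple_process_measurable[OF d] and m' = simple_process_measurable[OF d']
  \<comment> \<open>Stated for an arbitrary measure, as it is used on the product with time for the
    processes and on \<open>M\<close> for the integrals.\<close>
  have bnd: "l2sq Q (\<lambda>x. (c *\<^sub>R f x + c' *\<^sub>R f' x) - (c *\<^sub>R g x + c' *\<^sub>R g' x))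
     \<le> ennreal (2 * c\<^sup>2) * l2sq Q (\<lambda>x. f x - g x) + ennreal (2 * c'\<^sup>2) * l2sq Q (\<lambda>x. f' x - g' x)"
    if [measurable]: "f \<in> borel_measurable Q" "f' \<in> borel_measurable Q" "g \<in> borel_measurable Q" "g' \<in> borel_measurable Q"
    for Q :: "'x measure" and f f' g g' :: "'x \<Rightarrow> 'b"
  proof -
    have "l2sq Q (\<lambda>x. (c *\<^sub>R f x + c' *\<^sub>R f' x) - (c *\<^sub>R g x + c' *\<^sub>R g' x))
      = l2sq Q (\<lambda>x. c *\<^sub>R (f x - g x) + c' *\<^sub>R (f' x - g' x))"
      by (simp add: algebra_simps)
    also have "\<dots> \<le> 2 * l2sq Q (\<lambda>x. c *\<^sub>R (f x - g x)) + 2 * l2sq Q (\<lambda>x. c' *\<^sub>R (f' x - g' x))"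
      by (rule l2sq_add_le2) measurable
    also have "\<dots> = ennreal (2 * c\<^sup>2) * l2sq Q (\<lambda>x. f x - g x) + ennreal (2 * c'\<^sup>2) * l2sq Q (\<lambda>x. f' x - g' x)"
      by (simp add: l2sq_scaleR ennreal_mult mult.assoc)
    finally show ?thesis .
  qed
  have "\<forall>k. \<exists>m q g. simple_data M W S u m q g \<and>
    (\<forall>t \<omega>. simple_process m q g t \<omega> = c *\<^sub>R simple_process (N k) (p k) (\<eta> k) t \<omega> + c' *\<^sub>R simple_process (N' k) (p' k) (\<eta>' k) t \<omega>) \<and>
    (\<forall>\<omega>. simple_integral W m q g \<omega> = c *\<^sub>R simple_integral W (N k) (p k) (\<eta> k) \<omega> + c' *\<^sub>R simple_integral W (N' k) (p' k) (\<eta>' k) \<omega>)"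
    by (intro allI simple_data_lincomb d d')
  then obtain n q g where sd: "\<And>k. simple_data M W S u (n k) (q k) (g k)"
    and sp: "\<And>k t \<omega>. simple_process (n k) (q k) (g k) t \<omega> = c *\<^sub>R simple_process (N k) (p k) (\<eta> k) t \<omega> + c' *\<^sub>R simple_process (N' k) (p' k) (\<eta>' k) t \<omega>"
    and si: "\<And>k \<omega>. simple_integral W (n k) (q k) (g k) \<omega> = c *\<^sub>R simple_integral W (N k) (p k) (\<eta> k) \<omega> + c' *\<^sub>R simple_integral W (N' k) (p' k) (\<eta>' k) \<omega>"
    by (subst (asm) choice_iff) (subst (asm) choice_iff | elim exE | blast)+
  have t0: "(\<lambda>k. ennreal (2 * c\<^sup>2) * a k + ennreal (2 * c'\<^sup>2) * b k) \<longlonglongrightarrow> 0" if "a \<longlonglongrightarrow> 0" "b \<longlonglongrightarrow> 0" for a b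
    by (intro ennreal_add_tendsto_0 ennreal_cmult_tendsto_0 that)
  have "(\<lambda>k. process_sqnorm M S u (\<lambda>t \<omega>. simple_process (n k) (q k) (g k) t \<omega> - (c *\<^sub>R Y t \<omega> + c' *\<^sub>R Y' t \<omega>))) \<longlonglongrightarrow> 0"
  proof (rule ennreal_tendsto_0_le[OF t0[OF l(1) l'(1)]])
    fix k
    have eq: "(case x of (t, \<omega>) \<Rightarrow> c *\<^sub>R A t \<omega> + c' *\<^sub>R B t \<omega>) = c *\<^sub>R (case x of (t, \<omega>) \<Rightarrow> A t \<omega>) + c' *\<^sub>R (case x of (t, \<omega>) \<Rightarrow> B t \<omega>)"
      for x and A B :: "real \<Rightarrow> 'w \<Rightarrow> 'b" by (cases x) simp
    show "process_sqnorm M S u (\<lambda>t \<omega>. simple_process (n k) (q k) (g k) t \<omega> - (c *\<^sub>R Y t \<omega> + c' *\<^sub>R Y' t \<omega>))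
      \<le> ennreal (2 * c\<^sup>2) * process_sqnorm M S u (\<lambda>t \<omega>. simple_process (N k) (p k) (\<eta> k) t \<omega> - Y t \<omega>)
       + ennreal (2 * c'\<^sup>2) * process_sqnorm M S u (\<lambda>t \<omega>. simple_process (N' k) (p' k) (\<eta>' k) t \<omega> - Y' t \<omega>)"
      unfolding sp process_sqnorm_diff_eq[OF m mY] process_sqnorm_diff_eq[OF m' mY']
        process_sqnorm_diff_eq[OF measurable_pair_lincomb[OF m m'] measurable_pair_lincomb[OF mY mY']] eq
      by (rule bnd[OF m m' mY mY'])
  qed
  moreover have "(\<lambda>k. l2sq M (\<lambda>\<omega>. simple_integral W (n k) (q k) (g k) \<omega> - (c *\<^sub>R X \<omega> + c' *\<^sub>R X' \<omega>))) \<longlonglongrightarrow> 0"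
    unfolding si
    by (rule ennreal_tendsto_0_le[OF t0[OF l(2) l'(2)]])
      (rule bnd[OF simple_integral_measurable[OF d] simple_integral_measurable[OF d'] D(2) D'(2)])
  moreover have "(\<lambda>\<omega>. c *\<^sub>R X \<omega> + c' *\<^sub>R X' \<omega>) \<in> borel_measurable M"
    by (intro borel_measurable_add borel_measurable_scaleR borel_measurable_const D D')
  ultimately show ?thesis
    using sd L2_adapted_lincomb[OF D(1) D'(1), of c c'] unfolding has_ito_integral_def l2sq_def by blast
qed

text \<open>The isometry for simple integrals passes to the limit on both sides. The constant
  \<open>c\<close> separates off because Ito integrals are orthogonal to constants.\<close>

lemma has_ito_integral_isometry:
  fixes Y :: "real \<Rightarrow> 'w \<Rightarrow> 'b::euclidean_space"
  assumes i: "has_ito_integral M W S u Y X"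
  shows "l2sq M (\<lambda>\<omega>. c + X \<omega>) = ennreal ((norm c)\<^sup>2) + process_sqnorm M S u Y"
proof -
  note D = has_ito_integralD[OF i]
  note mY = L2_adapted_measurable[OF D(1)]
  from i obtain N p \<eta> where d: "\<And>k::nat. simple_data M W S u (N k) (p k) (\<eta> k)"
    and l: "(\<lambda>k. process_sqnorm M S u (\<lambda>t \<omega>. simple_process (N k) (p k) (\<eta> k) t \<omega> - Y t \<omega>)) \<longlonglongrightarrow> 0"
     "(\<lambda>k. l2sq M (\<lambda>\<omega>. simple_integral W (N k) (p k) (\<eta> k) \<omega> - X \<omega>)) \<longlonglongrightarrow> 0"
    unfolding has_ito_integral_def l2sq_def by blast
  note m = simple_process_measurable[OF d]
  show ?thesis
  proof (rule l2sq_limit[where f="\<lambda>k \<omega>. c + simple_integral W (N k) (p k) (\<eta> k) \<omega>"])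
    show "(\<lambda>\<omega>. c + simple_integral W (N k) (p k) (\<eta> k) \<omega>) \<in> borel_measurable M" for k
      by (intro borel_measurable_add borel_measurable_const simple_integral_measurable[OF d])
    show "(\<lambda>\<omega>. c + X \<omega>) \<in> borel_measurable M"
      by (intro borel_measurable_add borel_measurable_const D)
    show "(\<lambda>k. l2sq M (\<lambda>\<omega>. c + simple_integral W (N k) (p k) (\<eta> k) \<omega> - (c + X \<omega>))) \<longlonglongrightarrow> 0"
      using l(2) by simp
    have "(\<lambda>k. process_sqnorm M S u (simple_process (N k) (p k) (\<eta> k))) \<longlonglongrightarrow> process_sqnorm M S u Y"
      using l(1) unfolding process_sqnorm_diff_eq[OF m mY] process_sqnorm_eq_l2sq[OF m] process_sqnorm_eq_l2sq[OF mY]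
      by (rule l2sq_tendsto[OF m mY])
    then show "(\<lambda>k. l2sq M (\<lambda>\<omega>. c + simple_integral W (N k) (p k) (\<eta> k) \<omega>))
      \<longlonglongrightarrow> ennreal ((norm c)\<^sup>2) + process_sqnorm M S u Y"
      unfolding simple_integral_isometry[OF d] by (intro tendsto_add tendsto_const)
  qed
qed

section \<open>Ito integrals of a single random step\<close>

lemma L2_adapted_piece:
  fixes \<eta> :: "'w \<Rightarrow> 'b::euclidean_space"
  assumes \<eta>: "\<eta> \<in> borel_measurable (F a)" and fin: "l2sq M \<eta> < \<infinity>"
  shows "(\<lambda>s \<omega>. indicat_real {a<..b} s *\<^sub>R \<eta> \<omega>) \<in> L2_adapted M W S u"
    "process_sqnorm M S u (\<lambda>s \<omega>. indicat_real {a<..b} s *\<^sub>R \<eta> \<omega>) \<le> ennreal (b - a) * l2sq M \<eta>"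
proof -
  have \<eta>M: "\<eta> \<in> borel_measurable M" by (rule measurable_F_imp[OF \<eta>])
  have ind: "(\<lambda>x. indicat_real {a<..b} (fst x)) \<in> borel_measurable (time_interval S u \<Otimes>\<^sub>M M)"
    by (rule measurable_compose[OF measurable_fst]) (simp add: measurable_restrict_space1)
  have m: "(\<lambda>(t, \<omega>). indicat_real {a<..b} t *\<^sub>R \<eta> \<omega>) \<in> borel_measurable (time_interval S u \<Otimes>\<^sub>M M)"
    unfolding case_prod_beta'
    by (rule borel_measurable_scaleR[OF ind measurable_compose[OF measurable_snd \<eta>M]])
  have "process_sqnorm M S u (\<lambda>s \<omega>. indicat_real {a<..b} s *\<^sub>R \<eta> \<omega>)
     = (\<integral>\<^sup>+t. indicator {a<..b} t * l2sq M \<eta> \<partial>time_interval S u)"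
    unfolding process_sqnorm_eq_nn_integral[OF m]
    by (intro nn_integral_cong) (simp add: l2sq_scaleR[OF \<eta>M] indicator_def)
  also have "\<dots> = (\<integral>\<^sup>+t. indicator {a<..b} t \<partial>time_interval S u) * l2sq M \<eta>"
    by (intro nn_integral_multc measurable_restrict_space1) auto
  also have "(\<integral>\<^sup>+t. indicator {a<..b} t \<partial>time_interval S u) \<le> (\<integral>\<^sup>+t. indicator {a<..b} t \<partial>lborel)"
    unfolding nn_integral_time_interval by (intro nn_integral_mono) (auto simp: indicator_def)
  also have "(\<integral>\<^sup>+t. indicator {a<..b} t \<partial>lborel) \<le> ennreal (b - a)"
    by (cases "a \<le> b") auto
  finally show *: "process_sqnorm M S u (\<lambda>s \<omega>. indicat_real {a<..b} s *\<^sub>R \<eta> \<omega>) \<le> ennreal (b - a) * l2sq M \<eta>"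
    by (simp add: mult_right_mono)
  then have "process_sqnorm M S u (\<lambda>s \<omega>. indicat_real {a<..b} s *\<^sub>R \<eta> \<omega>) < \<infinity>"
    using fin by (auto simp: ennreal_mult_less_top elim!: order.strict_trans1)
  moreover have "(\<lambda>\<omega>. indicat_real {a<..b} t *\<^sub>R \<eta> \<omega>) \<in> borel_measurable (F t)" for t
  proof (cases "t \<in> {a<..b}")
    case True
    then have "(\<lambda>\<omega>. indicat_real {a<..b} t *\<^sub>R \<eta> \<omega>) = \<eta>" by auto
    moreover have "\<eta> \<in> borel_measurable (F t)" using True by (intro measurable_F_mono[OF _ \<eta>]) auto
    ultimately show ?thesis by (simp only:)
  next
    case False
    then have "(\<lambda>\<omega>. indicat_real {a<..b} t *\<^sub>R \<eta> \<omega>) = (\<lambda>_. 0)" by auto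
    then show ?thesis by (simp only: borel_measurable_const)
  qed
  ultimately show "(\<lambda>s \<omega>. indicat_real {a<..b} s *\<^sub>R \<eta> \<omega>) \<in> L2_adapted M W S u"
    using m unfolding L2_adapted_def by blast
qed

text \<open>A single step is a simple process on the partition with points \<open>S\<close>,
  \<open>a\<close>, \<open>b\<close>, \<open>u\<close> whose two outer values are 0.\<close>

lemma has_ito_integral_piece_bounded:
  fixes \<eta> :: "'w \<Rightarrow> 'b::euclidean_space"
  assumes ord: "S \<le> a" "a \<le> b" "b \<le> u" and \<eta>: "\<eta> \<in> borel_measurable (F a)" and B: "\<And>\<omega>. norm (\<eta> \<omega>) \<le> B"
  shows "has_ito_integral M W S u (\<lambda>s \<omega>. indicat_real {a<..b} s *\<^sub>R \<eta> \<omega>) (\<lambda>\<omega>. (W b \<omega> - W a \<omega>) *\<^sub>R \<eta> \<omega>)"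
proof -
  define p where "p = (\<lambda>i::nat. if i = 0 then S else if i = 1 then a else if i = 2 then b else u)"
  define e where "e = (\<lambda>i::nat. if i = 1 then \<eta> else (\<lambda>_. 0))"
  have lt3: "i < 3 \<longleftrightarrow> i = 0 \<or> i = 1 \<or> i = 2" for i :: nat by auto
  have d: "simple_data M W S u 3 p e"
    unfolding simple_data_def
  proof (intro conjI allI impI)
    fix i :: nat assume i: "i < 3"
    show "p i \<le> p (Suc i)" using i ord unfolding lt3 by (auto simp: p_def)
    show "e i \<in> borel_measurable (F (p i))"
    proof (cases "i = 1")
      case True
      then have "e i = \<eta>" "p i = a" by (simp_all add: e_def p_def)
      then show ?thesis using \<eta> by (simp only:)
    next
      case False then show ?thesis unfolding e_def by (simp only: if_False borel_measurable_const)
    qed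
    show "\<exists>B. \<forall>\<omega>\<in>space M. norm (e i \<omega>) \<le> B"
      using B by (intro exI[of _ B]) (auto simp: e_def intro: order_trans[OF norm_ge_zero B])
  qed (auto simp: p_def)
  have sum3: "(\<Sum>i<(3::nat). f i) = f 0 + f 1 + f 2" for f :: "nat \<Rightarrow> 'b"
    by (simp add: eval_nat_numeral lessThan_Suc add_ac)
  have sp: "simple_process 3 p e = (\<lambda>s \<omega>. indicat_real {a<..b} s *\<^sub>R \<eta> \<omega>)"
    by (intro ext) (simp add: simple_process_def sum3 p_def e_def)
  have si: "simple_integral W 3 p e = (\<lambda>\<omega>. (W b \<omega> - W a \<omega>) *\<^sub>R \<eta> \<omega>)"
    by (intro ext) (simp add: simple_integral_def sum3 p_def e_def)
  have "l2sq M \<eta> \<le> (\<integral>\<^sup>+\<omega>. ennreal (B\<^sup>2) \<partial>M)"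
    unfolding l2sq_def using B by (intro nn_integral_mono ennreal_leI power_mono) auto
  also have "\<dots> < \<infinity>" by (simp add: emeasure_space_1)
  finally have "l2sq M \<eta> < \<infinity>" .
  from has_ito_integral_simple[OF d] show ?thesis
    unfolding sp si using L2_adapted_piece(1)[OF \<eta> \<open>l2sq M \<eta> < \<infinity>\<close>] by blast
qed

text \<open>Inner iterated integrals are products of increments and hence unbounded, while
  \<open>simple_data\<close> asks for bounded values. Truncation of \<open>\<eta>\<close> at level
  \<open>k\<close> bridges this, and independence of the increment controls the error in the
  integral.\<close>

lemma has_ito_integral_piece:
  fixes \<eta> :: "'w \<Rightarrow> 'b::euclidean_space"
  assumes ord: "S \<le> a" "a \<le> b" "b \<le> u" and \<eta>: "\<eta> \<in> borel_measurable (F a)" and fin: "l2sq M \<eta> < \<infinity>"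
  shows "has_ito_integral M W S u (\<lambda>s \<omega>. indicat_real {a<..b} s *\<^sub>R \<eta> \<omega>) (\<lambda>\<omega>. (W b \<omega> - W a \<omega>) *\<^sub>R \<eta> \<omega>)"
proof -
  define e where "e k \<omega> = indicat_real {\<omega>. norm (\<eta> \<omega>) \<le> real k} \<omega> *\<^sub>R \<eta> \<omega>" for k :: nat and \<omega>
  have \<eta>M: "\<eta> \<in> borel_measurable M" by (rule measurable_F_imp[OF \<eta>])
  have ek: "e k \<in> borel_measurable (F a)" for k
  proof -
    have "(\<lambda>\<omega>. indicat_real {x. norm x \<le> real k} (\<eta> \<omega>) *\<^sub>R \<eta> \<omega>) \<in> borel_measurable (F a)"
      by (intro borel_measurable_scaleR \<eta> measurable_compose[OF \<eta> borel_measurable_indicator]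
         borel_closed closed_Collect_le continuous_intros)
    moreover have "e k = (\<lambda>\<omega>. indicat_real {x. norm x \<le> real k} (\<eta> \<omega>) *\<^sub>R \<eta> \<omega>)"
      by (intro ext) (simp add: e_def indicator_def)
    ultimately show ?thesis by (simp only:)
  qed
  note ekM = measurable_F_imp[OF ek]
  have eb: "norm (e k \<omega>) \<le> real k" for k \<omega> by (simp add: e_def indicator_def)
  have lim: "(\<lambda>k. l2sq M (\<lambda>\<omega>. e k \<omega> - \<eta> \<omega>)) \<longlonglongrightarrow> 0"
  proof -
    have "(\<lambda>k. \<integral>\<^sup>+\<omega>. ennreal ((norm (e k \<omega> - \<eta> \<omega>))\<^sup>2) \<partial>M) \<longlonglongrightarrow> (\<integral>\<^sup>+\<omega>. 0 \<partial>M)"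
    proof (rule nn_integral_dominated_convergence[where w="\<lambda>\<omega>. ennreal ((norm (\<eta> \<omega>))\<^sup>2)"])
      show "AE \<omega> in M. ennreal ((norm (e k \<omega> - \<eta> \<omega>))\<^sup>2) \<le> ennreal ((norm (\<eta> \<omega>))\<^sup>2)" for k
        by (intro AE_I2) (simp add: e_def indicator_def)
      show "AE \<omega> in M. (\<lambda>k. ennreal ((norm (e k \<omega> - \<eta> \<omega>))\<^sup>2)) \<longlonglongrightarrow> 0"
      proof (intro AE_I2)
        fix \<omega>
        obtain k0 where k0: "norm (\<eta> \<omega>) \<le> real k0" using real_arch_simple by blast
        have "ennreal ((norm (e k \<omega> - \<eta> \<omega>))\<^sup>2) = 0" if "k \<ge> k0" for k
          using k0 that by (simp add: e_def indicator_def)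
        then show "(\<lambda>k. ennreal ((norm (e k \<omega> - \<eta> \<omega>))\<^sup>2)) \<longlonglongrightarrow> 0"
          by (intro tendsto_eventually) (auto simp: eventually_sequentially)
      qed
    qed (use ekM \<eta>M fin in \<open>simp_all add: l2sq_def\<close>)
    then show ?thesis by (simp add: l2sq_def)
  qed
  have dF: "(\<lambda>\<omega>. e k \<omega> - \<eta> \<omega>) \<in> borel_measurable (F a)" for k by (rule borel_measurable_diff[OF ek \<eta>])
  have dfin: "l2sq M (\<lambda>\<omega>. e k \<omega> - \<eta> \<omega>) < \<infinity>" for k
  proof -
    have "l2sq M (\<lambda>\<omega>. e k \<omega> - \<eta> \<omega>) \<le> l2sq M \<eta>"
      unfolding l2sq_def by (intro nn_integral_mono) (simp add: e_def indicator_def)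
    then show ?thesis using fin by (rule order.strict_trans1)
  qed
  show ?thesis
  proof (rule has_ito_integral_limit[OF has_ito_integral_piece_bounded[OF ord ek eb]])
    show "(\<lambda>s \<omega>. indicat_real {a<..b} s *\<^sub>R \<eta> \<omega>) \<in> L2_adapted M W S u" by (rule L2_adapted_piece[OF \<eta> fin])
    show "(\<lambda>\<omega>. (W b \<omega> - W a \<omega>) *\<^sub>R \<eta> \<omega>) \<in> borel_measurable M"
      by (rule borel_measurable_scaleR[OF measurable_F_imp[OF increment_F[OF ord(1,2) order_refl]] \<eta>M])
    show "(\<lambda>k. process_sqnorm M S u (\<lambda>t \<omega>. indicat_real {a<..b} t *\<^sub>R e k \<omega> - indicat_real {a<..b} t *\<^sub>R \<eta> \<omega>)) \<longlonglongrightarrow> 0"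
      unfolding scaleR_diff_right[symmetric]
      by (rule ennreal_tendsto_0_le[OF ennreal_cmult_tendsto_0[OF lim]]) (rule L2_adapted_piece(2)[OF dF dfin])
    \<comment> \<open>The isometry for one step, with \<open>Z = 0\<close>, applied to the
      truncation error.\<close>
    have "l2sq M (\<lambda>\<omega>. (W b \<omega> - W a \<omega>) *\<^sub>R (e k \<omega> - \<eta> \<omega>)) = ennreal (b - a) * l2sq M (\<lambda>\<omega>. e k \<omega> - \<eta> \<omega>)" for k
      using l2sq_add_increment[OF borel_measurable_const dF _ dfin ord(1,2), of 0] by simp
    then show "(\<lambda>k. l2sq M (\<lambda>\<omega>. (W b \<omega> - W a \<omega>) *\<^sub>R e k \<omega> - (W b \<omega> - W a \<omega>) *\<^sub>R \<eta> \<omega>)) \<longlonglongrightarrow> 0"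
      unfolding scaleR_diff_right[symmetric] using ennreal_cmult_tendsto_0[OF lim] by simp
  qed
qed

lemma has_ito_integral_zero:
  assumes "S \<le> u"
  shows "has_ito_integral M W S u (\<lambda>_ _. 0) (\<lambda>_. 0 :: 'b::euclidean_space)"
  using has_ito_integral_piece[of S S u "\<lambda>_. 0::'b"] assms by simp

lemma has_ito_integral_sum:
  fixes Y :: "nat \<Rightarrow> real \<Rightarrow> 'w \<Rightarrow> 'b::euclidean_space"
  assumes "S \<le> u" "\<And>n. n < N \<Longrightarrow> has_ito_integral M W S u (Y n) (X n)"
  shows "has_ito_integral M W S u (\<lambda>t \<omega>. \<Sum>n<N. Y n t \<omega>) (\<lambda>\<omega>. \<Sum>n<N. X n \<omega>)"
  using assms(2)
proof (induction N)
  case 0 then show ?case using has_ito_integral_zero[OF assms(1)] by simp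
next
  case (Suc N)
  then have "has_ito_integral M W S u (\<lambda>t \<omega>. \<Sum>n<N. Y n t \<omega>) (\<lambda>\<omega>. \<Sum>n<N. X n \<omega>)"
    and "has_ito_integral M W S u (Y N) (X N)" by auto
  from has_ito_integral_lincomb[OF this, of 1 1] show ?case by simp
qed

end

section \<open>Simplices\<close>

abbreviation lborel_n :: "nat \<Rightarrow> (nat \<Rightarrow> real) measure" where
  "lborel_n n \<equiv> Pi\<^sub>M {..<n} (\<lambda>_. lborel)"

lemma product_lborel: "product_sigma_finite (\<lambda>_::nat. lborel :: real measure)"
  by (intro product_sigma_finite.intro sigma_finite_lborel)

lemma sigma_finite_lborel_n: "sigma_finite_measure (lborel_n n)"
  by (rule product_sigma_finite.sigma_finite[OF product_lborel]) simp

lemma measurable_case_nat_lborel_n: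
  "(\<lambda>x. case_nat (fst x) (snd x)) \<in> lborel \<Otimes>\<^sub>M lborel_n n \<rightarrow>\<^sub>M lborel_n (Suc n)"
proof (rule measurable_PiM_single')
  fix i assume i: "i \<in> {..<Suc n}"
  show "(\<lambda>x. case_nat (fst x) (snd x) i) \<in> lborel \<Otimes>\<^sub>M lborel_n n \<rightarrow>\<^sub>M lborel"
  proof (cases i)
    case 0 then show ?thesis by simp
  next
    case (Suc j)
    then have "(\<lambda>x. snd x j) \<in> lborel \<Otimes>\<^sub>M lborel_n n \<rightarrow>\<^sub>M lborel"
      using i by (intro measurable_compose[OF measurable_snd measurable_component_singleton]) auto
    with Suc show ?thesis by simp
  qed
next
  show "(\<lambda>x. case_nat (fst x) (snd x)) \<in> space (lborel \<Otimes>\<^sub>M lborel_n n) \<rightarrow> (\<Pi>\<^sub>E i\<in>{..<Suc n}. space lborel)"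
    by (auto simp: space_pair_measure space_PiM PiE_def extensional_def split: nat.splits)
qed

text \<open>The product measure is determined by its values on boxes, and the preimage of a box
  under prepending a coordinate is again a product of its sides.\<close>

lemma distr_case_nat_lborel_n:
  "distr (lborel \<Otimes>\<^sub>M lborel_n n) (lborel_n (Suc n)) (\<lambda>x. case_nat (fst x) (snd x)) = lborel_n (Suc n)"
proof (rule product_sigma_finite.PiM_eqI[OF product_lborel])
  interpret P: sigma_finite_measure "lborel_n n" by (rule sigma_finite_lborel_n)
  fix A :: "nat \<Rightarrow> real set" assume A: "\<And>i. i \<in> {..<Suc n} \<Longrightarrow> A i \<in> sets lborel"
  have "(\<lambda>x. case_nat (fst x) (snd x)) -` Pi\<^sub>E {..<Suc n} A \<inter> space (lborel \<Otimes>\<^sub>M lborel_n n)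
      = A 0 \<times> Pi\<^sub>E {..<n} (\<lambda>i. A (Suc i))"
  proof (intro set_eqI iffI)
    fix x assume x: "x \<in> (\<lambda>x. case_nat (fst x) (snd x)) -` Pi\<^sub>E {..<Suc n} A \<inter> space (lborel \<Otimes>\<^sub>M lborel_n n)"
    then have *: "case_nat (fst x) (snd x) i \<in> A i" if "i < Suc n" for i using that by (auto dest!: PiE_mem)
    have "snd x \<in> extensional {..<n}" using x by (auto simp: space_pair_measure space_PiM PiE_def)
    then show "x \<in> A 0 \<times> Pi\<^sub>E {..<n} (\<lambda>i. A (Suc i))"
      using *[of 0] *[of "Suc _"] by (cases x) (auto simp: PiE_def Pi_def)
  next
    fix x assume "x \<in> A 0 \<times> Pi\<^sub>E {..<n} (\<lambda>i. A (Suc i))"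
    then show "x \<in> (\<lambda>x. case_nat (fst x) (snd x)) -` Pi\<^sub>E {..<Suc n} A \<inter> space (lborel \<Otimes>\<^sub>M lborel_n n)"
      by (auto simp: space_pair_measure space_PiM PiE_def extensional_def Pi_def split: nat.splits)
  qed
  moreover have "emeasure (lborel_n n) (Pi\<^sub>E {..<n} (\<lambda>i. A (Suc i))) = (\<Prod>i<n. emeasure lborel (A (Suc i)))"
    using A by (intro product_sigma_finite.emeasure_PiM[OF product_lborel]) auto
  ultimately show "emeasure (distr (lborel \<Otimes>\<^sub>M lborel_n n) (lborel_n (Suc n)) (\<lambda>x. case_nat (fst x) (snd x))) (Pi\<^sub>E {..<Suc n} A)
     = (\<Prod>i<Suc n. emeasure lborel (A i))"
    using A by (subst emeasure_distr[OF measurable_case_nat_lborel_n])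
      (simp_all add: sets_PiM_I_finite P.emeasure_pair_measure_Times
        prod.lessThan_Suc_shift del: prod.lessThan_Suc)
qed simp_all

lemma nn_integral_lborel_n_head:
  assumes h: "h \<in> borel_measurable (lborel_n (Suc n))"
  shows "(\<integral>\<^sup>+x. h x \<partial>lborel_n (Suc n)) = (\<integral>\<^sup>+s. (\<integral>\<^sup>+r. h (case_nat s r) \<partial>lborel_n n) \<partial>lborel)"
    "(\<lambda>s. \<integral>\<^sup>+r. h (case_nat s r) \<partial>lborel_n n) \<in> borel_measurable lborel"
proof -
  interpret P: sigma_finite_measure "lborel_n n" by (rule sigma_finite_lborel_n)
  have m: "(\<lambda>x. h (case_nat (fst x) (snd x))) \<in> borel_measurable (lborel \<Otimes>\<^sub>M lborel_n n)"
    by (rule measurable_compose[OF measurable_case_nat_lborel_n h])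
  have "(\<integral>\<^sup>+x. h x \<partial>lborel_n (Suc n)) = (\<integral>\<^sup>+x. h (case_nat (fst x) (snd x)) \<partial>(lborel \<Otimes>\<^sub>M lborel_n n))"
    by (subst distr_case_nat_lborel_n[symmetric]) (rule nn_integral_distr[OF measurable_case_nat_lborel_n], simp add: h)
  also have "\<dots> = (\<integral>\<^sup>+s. (\<integral>\<^sup>+r. h (case_nat s r) \<partial>lborel_n n) \<partial>lborel)"
    using P.nn_integral_fst[OF m] by simp
  finally show "(\<integral>\<^sup>+x. h x \<partial>lborel_n (Suc n)) = (\<integral>\<^sup>+s. (\<integral>\<^sup>+r. h (case_nat s r) \<partial>lborel_n n) \<partial>lborel)" .
  show "(\<lambda>s. \<integral>\<^sup>+r. h (case_nat s r) \<partial>lborel_n n) \<in> borel_measurable lborel"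
    using P.borel_measurable_nn_integral_fst[OF m] by simp
qed

lemma ord_simplex_sets: "ord_simplex n S T \<in> sets (lborel_n n)"
proof -
  have c: "(\<lambda>t. t i) \<in> borel_measurable (lborel_n n)" if "i < n" for i
    using measurable_component_singleton[of i "{..<n}" "\<lambda>_. lborel"] that by simp
  have "ord_simplex n S T = {t\<in>space (lborel_n n). (\<forall>i\<in>{..<n}. S < t i \<and> t i < T) \<and>
     (\<forall>i\<in>{..<n}. \<forall>j\<in>{..<n}. i < j \<longrightarrow> t j < t i)}"
    by (auto simp: ord_simplex_def space_PiM PiE_def)
  also have "\<dots> \<in> sets (lborel_n n)"
    by (intro sets.sets_Collect_conj sets.sets_Collect_finite_All sets.sets_Collect_imp sets.sets_Collect_const
      borel_measurable_less borel_measurable_const c) auto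
  finally show ?thesis .
qed

lemma ord_simplex_subset_space: "ord_simplex n S T \<inter> space (lborel_n n) = ord_simplex n S T"
  using sets.sets_into_space[OF ord_simplex_sets] by auto

lemma space_simplex_measure [simp]: "space (simplex_measure n S T) = ord_simplex n S T"
  by (simp add: simplex_measure_def space_restrict_space ord_simplex_subset_space)

lemma nn_integral_simplex:
  "(\<integral>\<^sup>+x. h x \<partial>simplex_measure n S T) = (\<integral>\<^sup>+x. h x * indicator (ord_simplex n S T) x \<partial>lborel_n n)"
  unfolding simplex_measure_def
  by (rule nn_integral_restrict_space) (simp add: ord_simplex_subset_space ord_simplex_sets)

lemma measurable_simplex_indicator:
  fixes h :: "_ \<Rightarrow> ennreal"
  assumes "h \<in> borel_measurable (simplex_measure n S T)"
  shows "(\<lambda>x. h x * indicator (ord_simplex n S T) x) \<in> borel_measurable (lborel_n n)"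
  using assms unfolding simplex_measure_def
  by (subst (asm) borel_measurable_restrict_space_iff_ennreal) (simp_all add: ord_simplex_subset_space ord_simplex_sets)

lemma case_nat_ord_simplex:
  "case_nat s r \<in> ord_simplex (Suc n) S u \<longleftrightarrow> S < s \<and> s < u \<and> r \<in> ord_simplex n S s"
proof
  assume "case_nat s r \<in> ord_simplex (Suc n) S u"
  then have *: "case_nat s r \<in> extensional {..<Suc n}" "\<And>i. i < Suc n \<Longrightarrow> S < case_nat s r i \<and> case_nat s r i < u"
    "\<And>i j. i < j \<Longrightarrow> j < Suc n \<Longrightarrow> case_nat s r j < case_nat s r i" by (auto simp: ord_simplex_def)
  have "r \<in> extensional {..<n}"
    unfolding extensional_def
  proof (intro CollectI allI impI)
    fix i assume "i \<notin> {..<n}"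
    then show "r i = undefined" using extensional_arb[OF *(1), of "Suc i"] by simp
  qed
  then show "S < s \<and> s < u \<and> r \<in> ord_simplex n S s"
    using *(2)[of 0] *(2)[of "Suc _"] *(3)[of 0 "Suc _"] *(3)[of "Suc _" "Suc _"] by (auto simp: ord_simplex_def)
next
  assume "S < s \<and> s < u \<and> r \<in> ord_simplex n S s"
  then show "case_nat s r \<in> ord_simplex (Suc n) S u"
    by (auto simp: ord_simplex_def extensional_def split: nat.splits)
qed

lemma ord_simplex_0 [simp]: "ord_simplex 0 S u = {\<lambda>_. undefined}"
  by (auto simp: ord_simplex_def)

lemma nn_integral_simplex_head:
  fixes h :: "_ \<Rightarrow> ennreal"
  assumes h: "h \<in> borel_measurable (simplex_measure (Suc n) S u)"
  shows "(\<integral>\<^sup>+x. h x \<partial>simplex_measure (Suc n) S u) =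
      (\<integral>\<^sup>+s. (\<integral>\<^sup>+r. h (case_nat s r) \<partial>simplex_measure n S s) \<partial>time_interval S u)"
    "(\<lambda>s. \<integral>\<^sup>+r. h (case_nat s r) \<partial>simplex_measure n S s) \<in> borel_measurable (time_interval S u)"
proof -
  let ?h = "\<lambda>x. h x * indicator (ord_simplex (Suc n) S u) x"
  have eq: "(\<integral>\<^sup>+r. ?h (case_nat s r) \<partial>lborel_n n) = (\<integral>\<^sup>+r. h (case_nat s r) \<partial>simplex_measure n S s) * indicator {S<..<u} s" for s
    unfolding nn_integral_simplex
  proof (cases "s \<in> {S<..<u}")
    case True
    then show "(\<integral>\<^sup>+r. ?h (case_nat s r) \<partial>lborel_n n) = (\<integral>\<^sup>+r. h (case_nat s r) * indicator (ord_simplex n S s) r \<partial>lborel_n n) * indicator {S<..<u} s"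
      by (simp add: indicator_def case_nat_ord_simplex)
  next
    case False
    then have "case_nat s r \<notin> ord_simplex (Suc n) S u" for r by (auto simp: case_nat_ord_simplex)
    with False show "(\<integral>\<^sup>+r. ?h (case_nat s r) \<partial>lborel_n n) = (\<integral>\<^sup>+r. h (case_nat s r) * indicator (ord_simplex n S s) r \<partial>lborel_n n) * indicator {S<..<u} s"
      by simp
  qed
  note hd = nn_integral_lborel_n_head[OF measurable_simplex_indicator[OF h], unfolded eq]
  show "(\<integral>\<^sup>+x. h x \<partial>simplex_measure (Suc n) S u) =
      (\<integral>\<^sup>+s. (\<integral>\<^sup>+r. h (case_nat s r) \<partial>simplex_measure n S s) \<partial>time_interval S u)"
    unfolding nn_integral_time_interval using hd(1) by (simp add: nn_integral_simplex[where n="Suc n"])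
  show "(\<lambda>s. \<integral>\<^sup>+r. h (case_nat s r) \<partial>simplex_measure n S s) \<in> borel_measurable (time_interval S u)"
    using hd(2) by (subst borel_measurable_restrict_space_iff_ennreal) simp_all
qed

text \<open>Companion of the decomposition by the first coordinate: iterated integrals freeze the
  largest time, the Volterra norm freezes the smallest.\<close>

lemma nn_integral_lborel_n_last:
  assumes h: "h \<in> borel_measurable (lborel_n (Suc n))"
  shows "(\<integral>\<^sup>+x. h x \<partial>lborel_n (Suc n)) = (\<integral>\<^sup>+t. (\<integral>\<^sup>+s. h (s(n := t)) \<partial>lborel_n n) \<partial>lborel)"
    "(\<lambda>t. \<integral>\<^sup>+s. h (s(n := t)) \<partial>lborel_n n) \<in> borel_measurable lborel"
proof -
  interpret product_sigma_finite "\<lambda>_::nat. lborel::real measure" by (rule product_lborel)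
  interpret P: sigma_finite_measure "lborel_n n" by (rule sigma_finite_lborel_n)
  show "(\<integral>\<^sup>+x. h x \<partial>lborel_n (Suc n)) = (\<integral>\<^sup>+t. (\<integral>\<^sup>+s. h (s(n := t)) \<partial>lborel_n n) \<partial>lborel)"
    using h by (simp add: lessThan_Suc product_nn_integral_insert_rev)
  have "(\<lambda>x. (snd x)(n := fst x)) \<in> lborel \<Otimes>\<^sub>M lborel_n n \<rightarrow>\<^sub>M lborel_n (Suc n)"
    unfolding lessThan_Suc by measurable
  then have m: "(\<lambda>x. h ((snd x)(n := fst x))) \<in> borel_measurable (lborel \<Otimes>\<^sub>M lborel_n n)"
    by (rule measurable_compose[OF _ h])
  show "(\<lambda>t. \<integral>\<^sup>+s. h (s(n := t)) \<partial>lborel_n n) \<in> borel_measurable lborel"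
    using P.borel_measurable_nn_integral_fst[OF m] by simp
qed

lemma fun_upd_ord_simplex:
  assumes "s \<in> space (lborel_n n)" "t < T"
  shows "s(n := t) \<in> ord_simplex (Suc n) S T \<longleftrightarrow> S < t \<and> s \<in> ord_simplex n t T"
proof
  assume "s(n := t) \<in> ord_simplex (Suc n) S T"
  then have *: "\<And>i. i < Suc n \<Longrightarrow> S < (s(n := t)) i \<and> (s(n := t)) i < T"
    "\<And>i j. i < j \<Longrightarrow> j < Suc n \<Longrightarrow> (s(n := t)) j < (s(n := t)) i" by (auto simp: ord_simplex_def)
  have "t < s i \<and> s i < T" if "i < n" for i using *(2)[of i n] *(1)[of i] that by simp
  moreover have "s j < s i" if "i < j" "j < n" for i j using *(2)[of i j] that by simp
  ultimately show "S < t \<and> s \<in> ord_simplex n t T"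
    using *(1)[of n] assms by (auto simp: ord_simplex_def space_PiM PiE_def)
next
  assume "S < t \<and> s \<in> ord_simplex n t T"
  then show "s(n := t) \<in> ord_simplex (Suc n) S T" using assms(2)
    by (auto simp: ord_simplex_def extensional_def less_Suc_eq intro: less_trans)
qed

lemma nn_integral_simplex_last:
  fixes h :: "_ \<Rightarrow> ennreal"
  assumes h: "h \<in> borel_measurable (simplex_measure (Suc n) S T)"
  shows "(\<integral>\<^sup>+x. h x \<partial>simplex_measure (Suc n) S T) =
      (\<integral>\<^sup>+t. (\<integral>\<^sup>+s. h (s(n := t)) \<partial>simplex_measure n t T) \<partial>time_interval S T)"
    "(\<lambda>t. \<integral>\<^sup>+s. h (s(n := t)) \<partial>simplex_measure n t T) \<in> borel_measurable (time_interval S T)"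
proof -
  let ?h = "\<lambda>x. h x * indicator (ord_simplex (Suc n) S T) x"
  have eq: "(\<integral>\<^sup>+s. ?h (s(n := t)) \<partial>lborel_n n) = (\<integral>\<^sup>+s. h (s(n := t)) \<partial>simplex_measure n t T) * indicator {S<..<T} t" for t
  proof (cases "t \<in> {S<..<T}")
    case True
    then have "(\<integral>\<^sup>+s. ?h (s(n := t)) \<partial>lborel_n n) = (\<integral>\<^sup>+s. h (s(n := t)) * indicator (ord_simplex n t T) s \<partial>lborel_n n)"
      by (intro nn_integral_cong) (auto simp: indicator_def fun_upd_ord_simplex)
    then show ?thesis using True by (simp add: nn_integral_simplex)
  next
    case False
    then have "s(n := t) \<notin> ord_simplex (Suc n) S T" for s :: "nat \<Rightarrow> real"
      by (auto simp: ord_simplex_def intro!: exI[of _ n])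
    then show ?thesis using False by (simp add: indicator_def)
  qed
  note hd = nn_integral_lborel_n_last[OF measurable_simplex_indicator[OF h], unfolded eq]
  show "(\<integral>\<^sup>+x. h x \<partial>simplex_measure (Suc n) S T) =
      (\<integral>\<^sup>+t. (\<integral>\<^sup>+s. h (s(n := t)) \<partial>simplex_measure n t T) \<partial>time_interval S T)"
    unfolding nn_integral_time_interval using hd(1) by (simp add: nn_integral_simplex[where n="Suc n"])
  show "(\<lambda>t. \<integral>\<^sup>+s. h (s(n := t)) \<partial>simplex_measure n t T) \<in> borel_measurable (time_interval S T)"
    using hd(2) by (subst borel_measurable_restrict_space_iff_ennreal) simp_all
qed

lemma measurable_simplex_slice:
  assumes f: "f \<in> simplex_measure (Suc n) S u \<rightarrow>\<^sub>M N" and s: "s \<in> {S<..<u}"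
  shows "(\<lambda>r. f (case_nat s r)) \<in> simplex_measure n S s \<rightarrow>\<^sub>M N"
proof -
  have "case_nat s \<in> lborel_n n \<rightarrow>\<^sub>M lborel_n (Suc n)"
    using measurable_compose[OF measurable_Pair1' measurable_case_nat_lborel_n, of s] by simp
  then have "case_nat s \<in> simplex_measure n S s \<rightarrow>\<^sub>M simplex_measure (Suc n) S u"
    unfolding simplex_measure_def using s
    by (intro measurable_restrict_space3) (auto simp: case_nat_ord_simplex)
  then show ?thesis by (rule measurable_compose[OF _ f])
qed

lemma measurable_simplex_last_slice:
  assumes f: "f \<in> simplex_measure (Suc n) S T \<rightarrow>\<^sub>M N" and t: "t \<in> {S<..<T}"
  shows "(\<lambda>s. f (s(n := t))) \<in> simplex_measure n t T \<rightarrow>\<^sub>M N"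
proof -
  have "(\<lambda>s. s(n := t)) \<in> lborel_n n \<rightarrow>\<^sub>M lborel_n (Suc n)"
    unfolding lessThan_Suc by measurable
  moreover have "s(n := t) \<in> ord_simplex (Suc n) S T" if "s \<in> ord_simplex n t T" for s
    using that t ord_simplex_subset_space[of n t T] by (subst fun_upd_ord_simplex) auto
  ultimately have "(\<lambda>s. s(n := t)) \<in> simplex_measure n t T \<rightarrow>\<^sub>M simplex_measure (Suc n) S T"
    unfolding simplex_measure_def by (intro measurable_restrict_space3) auto
  then show ?thesis by (rule measurable_compose[OF _ f])
qed

section \<open>Null sets of simplices under slicing and coordinate projections\<close>

lemma AE_simplex_last:
  assumes "AE x in simplex_measure (Suc n) S T. P x"
  shows "AE t in time_interval S T. AE s in simplex_measure n t T. P (s(n := t))"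
proof -
  obtain N where N: "N \<in> null_sets (simplex_measure (Suc n) S T)" "{x\<in>space (simplex_measure (Suc n) S T). \<not> P x} \<subseteq> N"
    using assms by (auto simp: eventually_ae_filter)
  have m: "indicator N \<in> borel_measurable (simplex_measure (Suc n) S T)" using N(1) by auto
  have "(\<integral>\<^sup>+x. indicator N x \<partial>simplex_measure (Suc n) S T) = 0"
    using null_setsD1[OF N(1)] null_setsD2[OF N(1)] by simp
  then have "AE t in time_interval S T. (\<integral>\<^sup>+s. indicator N (s(n := t)) \<partial>simplex_measure n t T) = 0"
    unfolding nn_integral_simplex_last(1)[OF m]
    using nn_integral_0_iff_AE[OF nn_integral_simplex_last(2)[OF m]] by simp
  then show ?thesis
    using AE_space
  proof eventually_elim
    case (elim t)
    have m': "(\<lambda>s. indicator N (s(n := t)) :: ennreal) \<in> borel_measurable (simplex_measure n t T)"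
      using measurable_simplex_last_slice[OF m, of t] elim(2) by simp
    from elim(1) have "AE s in simplex_measure n t T. indicator N (s(n := t)) = (0::ennreal)"
      using nn_integral_0_iff_AE[OF m'] by simp
    then show ?case using AE_space
    proof eventually_elim
      case (elim s)
      then have "s(n := t) \<in> ord_simplex (Suc n) S T"
        using \<open>t \<in> space (time_interval S T)\<close> ord_simplex_subset_space[of n t T] by (subst fun_upd_ord_simplex) auto
      then show ?case using elim(1) N(2) by (auto simp: indicator_def split: if_splits)
    qed
  qed
qed

text \<open>For coordinate maps between simplices the only question is whether preimages of null
  sets are null; the assumption \<open>null\<close> isolates it.\<close>

lemma AE_simplex_pullback:
  assumes AE: "AE x in simplex_measure m S T. P x"
    and g: "g \<in> simplex_measure n S T \<rightarrow>\<^sub>M simplex_measure m S T"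
    and null: "\<And>N. N \<in> null_sets (simplex_measure m S T) \<Longrightarrow> (\<integral>\<^sup>+x. indicator N (g x) \<partial>simplex_measure n S T) = 0"
  shows "AE x in simplex_measure n S T. P (g x)"
proof -
  obtain N where N: "N \<in> null_sets (simplex_measure m S T)" "{x\<in>space (simplex_measure m S T). \<not> P x} \<subseteq> N"
    using AE by (auto simp: eventually_ae_filter)
  have m: "indicator N \<in> borel_measurable (simplex_measure m S T)" using N(1) by auto
  have m': "(\<lambda>x. indicator N (g x) :: ennreal) \<in> borel_measurable (simplex_measure n S T)"
    by (rule measurable_compose[OF g m])
  have "AE x in simplex_measure n S T. indicator N (g x) = (0::ennreal)"
    using null[OF N(1)] nn_integral_0_iff_AE[OF m'] by simp
  then show ?thesis using AE_space
  proof eventually_elim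
    case (elim x)
    then show ?case using N(2) measurable_space[OF g elim(2)] by (auto simp: indicator_def split: if_splits)
  qed
qed

lemma ord_simplex_mono: "S \<le> S' \<Longrightarrow> T' \<le> T \<Longrightarrow> ord_simplex n S' T' \<subseteq> ord_simplex n S T"
  by (force simp: ord_simplex_def)

lemma nn_integral_simplex_null_mono:
  assumes N: "N \<in> null_sets (simplex_measure n S T)" and le: "S \<le> S'" "T' \<le> T"
  shows "(\<integral>\<^sup>+x. indicator N x \<partial>simplex_measure n S' T') = 0"
proof -
  have "(\<integral>\<^sup>+x. indicator N x \<partial>simplex_measure n S' T') \<le> (\<integral>\<^sup>+x. indicator N x \<partial>simplex_measure n S T)"
    unfolding nn_integral_simplex using ord_simplex_mono[OF le]
    by (intro nn_integral_mono) (auto simp: indicator_def)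
  also have "\<dots> = 0" using null_setsD1[OF N] null_setsD2[OF N] by simp
  finally show ?thesis by simp
qed

lemma AE_simplex_tail:
  assumes "AE x in simplex_measure n S T. P x"
  shows "AE x in simplex_measure (Suc n) S T. P (\<lambda>i\<in>{..<n}. x (Suc i))"
proof (rule AE_simplex_pullback[OF assms])
  have "(\<lambda>x. \<lambda>i\<in>{..<n}. x (Suc i)) \<in> lborel_n (Suc n) \<rightarrow>\<^sub>M lborel_n n"
    by (intro measurable_restrict measurable_component_singleton) auto
  then show g: "(\<lambda>x. \<lambda>i\<in>{..<n}. x (Suc i)) \<in> simplex_measure (Suc n) S T \<rightarrow>\<^sub>M simplex_measure n S T"
    unfolding simplex_measure_def by (intro measurable_restrict_space3) (auto simp: ord_simplex_def)
  fix N assume N: "N \<in> null_sets (simplex_measure n S T)"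
  have m: "indicator N \<in> borel_measurable (simplex_measure n S T)" using N by auto
  have m': "(\<lambda>x. indicator N (\<lambda>i\<in>{..<n}. x (Suc i)) :: ennreal) \<in> borel_measurable (simplex_measure (Suc n) S T)"
    by (rule measurable_compose[OF g m])
  have "(\<integral>\<^sup>+r. indicator N (\<lambda>i\<in>{..<n}. case_nat s r (Suc i)) \<partial>simplex_measure n S s) = 0" if "s \<in> {S<..<T}" for s
  proof -
    have "(\<integral>\<^sup>+r. indicator N (\<lambda>i\<in>{..<n}. case_nat s r (Suc i)) \<partial>simplex_measure n S s) = (\<integral>\<^sup>+r. indicator N r \<partial>simplex_measure n S s)"
      by (intro nn_integral_cong arg_cong[where f="indicator N"]) (auto simp: ord_simplex_def extensional_restrict)
    then show ?thesis using nn_integral_simplex_null_mono[OF N, of S s] that by simp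
  qed
  then show "(\<integral>\<^sup>+x. indicator N (\<lambda>i\<in>{..<n}. x (Suc i)) \<partial>simplex_measure (Suc n) S T) = 0"
    unfolding nn_integral_simplex_head(1)[OF m']
    by (subst nn_integral_cong[where v="\<lambda>_. 0"]) auto
qed

lemma AE_simplex_butlast:
  assumes "AE x in simplex_measure n S T. P x"
  shows "AE x in simplex_measure (Suc n) S T. P (\<lambda>i\<in>{..<n}. x i)"
proof (rule AE_simplex_pullback[OF assms])
  have "(\<lambda>x. \<lambda>i\<in>{..<n}. x i) \<in> lborel_n (Suc n) \<rightarrow>\<^sub>M lborel_n n"
    by (intro measurable_restrict measurable_component_singleton) auto
  then show g: "(\<lambda>x. \<lambda>i\<in>{..<n}. x i) \<in> simplex_measure (Suc n) S T \<rightarrow>\<^sub>M simplex_measure n S T"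
    unfolding simplex_measure_def by (intro measurable_restrict_space3) (auto simp: ord_simplex_def)
  fix N assume N: "N \<in> null_sets (simplex_measure n S T)"
  have m: "indicator N \<in> borel_measurable (simplex_measure n S T)" using N by auto
  have m': "(\<lambda>x. indicator N (\<lambda>i\<in>{..<n}. x i) :: ennreal) \<in> borel_measurable (simplex_measure (Suc n) S T)"
    by (rule measurable_compose[OF g m])
  have *: "(\<integral>\<^sup>+s. indicator N (\<lambda>i\<in>{..<n}. (s(n := t)) i) \<partial>simplex_measure n t T) = 0" if "t \<in> {S<..<T}" for t
  proof -
    have "(\<integral>\<^sup>+s. indicator N (\<lambda>i\<in>{..<n}. (s(n := t)) i) \<partial>simplex_measure n t T) = (\<integral>\<^sup>+r. indicator N r \<partial>simplex_measure n t T)"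
      by (intro nn_integral_cong arg_cong[where f="indicator N"])
        (auto simp: ord_simplex_def extensional_def fun_eq_iff)
    then show ?thesis using nn_integral_simplex_null_mono[OF N, of t T] that by simp
  qed
  have "(\<integral>\<^sup>+x. indicator N (\<lambda>i\<in>{..<n}. x i) \<partial>simplex_measure (Suc n) S T) = (\<integral>\<^sup>+t. 0 \<partial>time_interval S T)"
    unfolding nn_integral_simplex_last(1)[OF m']
    by (intro nn_integral_cong *) (simp only: space_time_interval)
  then show "(\<integral>\<^sup>+x. indicator N (\<lambda>i\<in>{..<n}. x i) \<partial>simplex_measure (Suc n) S T) = 0" by simp
qed

text \<open>Coordinates are dropped one at a time, in front and then behind. Chaos coefficients are
  known only up to null sets, and a star product evaluates them on such windows.\<close>

lemma AE_simplex_window: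
  assumes "AE x in simplex_measure n S T. P x"
  shows "AE x in simplex_measure (k + n + j) S T. P (\<lambda>i\<in>{..<n}. x (k + i))"
proof -
  have 1: "AE x in simplex_measure (k + n) S T. P (\<lambda>i\<in>{..<n}. x (k + i))"
  proof (induction k)
    case 0
    from assms AE_space have "AE x in simplex_measure n S T. P (\<lambda>i\<in>{..<n}. x i)"
    proof eventually_elim
      case (elim x)
      then have "(\<lambda>i\<in>{..<n}. x i) = x" by (auto simp: ord_simplex_def extensional_restrict)
      then show ?case using elim(1) by simp
    qed
    then show ?case by (simp only: add_0)
  next
    case (Suc k)
    have "(\<lambda>i\<in>{..<n}. (\<lambda>i\<in>{..<k + n}. x (Suc i)) (k + i)) = (\<lambda>i\<in>{..<n}. x (Suc k + i))" for x :: "nat \<Rightarrow> real"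
      by (auto simp: fun_eq_iff)
    with AE_simplex_tail[OF Suc] show ?case by (simp only: add_Suc)
  qed
  show ?thesis
  proof (induction j)
    case 0 show ?case using 1 by (simp only: add_0_right)
  next
    case (Suc j)
    have "(\<lambda>i\<in>{..<n}. (\<lambda>i\<in>{..<k + n + j}. x i) (k + i)) = (\<lambda>i\<in>{..<n}. x (k + i))" for x :: "nat \<Rightarrow> real"
      by (auto simp: fun_eq_iff)
    with AE_simplex_butlast[OF Suc] show ?case by (simp only: add_Suc_right)
  qed
qed

section \<open>Square-integrable kernels on simplices\<close>

lemma l2sq_simplex_head:
  assumes f: "f \<in> borel_measurable (simplex_measure (Suc n) S u)"
  shows "l2sq (simplex_measure (Suc n) S u) f = (\<integral>\<^sup>+s. l2sq (simplex_measure n S s) (\<lambda>r. f (case_nat s r)) \<partial>time_interval S u)"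
    "(\<lambda>s. l2sq (simplex_measure n S s) (\<lambda>r. f (case_nat s r))) \<in> borel_measurable (time_interval S u)"
proof -
  have "(\<lambda>x. ennreal ((norm (f x))\<^sup>2)) \<in> borel_measurable (simplex_measure (Suc n) S u)"
    using f by measurable
  from nn_integral_simplex_head[OF this] show
    "l2sq (simplex_measure (Suc n) S u) f = (\<integral>\<^sup>+s. l2sq (simplex_measure n S s) (\<lambda>r. f (case_nat s r)) \<partial>time_interval S u)"
    "(\<lambda>s. l2sq (simplex_measure n S s) (\<lambda>r. f (case_nat s r))) \<in> borel_measurable (time_interval S u)"
    unfolding l2sq_def by simp_all
qed

lemma nn_integral_simplex_0: "(\<integral>\<^sup>+x. h x \<partial>simplex_measure 0 S u) = h (\<lambda>_. undefined)"
proof -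
  have "(\<integral>\<^sup>+x. h x \<partial>simplex_measure 0 S u) = (\<integral>\<^sup>+x. h x * indicator {\<lambda>_. undefined} x \<partial>lborel_n 0)"
    unfolding nn_integral_simplex by simp
  also have "\<dots> = (\<integral>\<^sup>+x. h (\<lambda>_. undefined) \<partial>lborel_n 0)"
    by (intro nn_integral_cong) (simp add: space_PiM)
  also have "\<dots> = h (\<lambda>_. undefined)"
    by (simp add: PiM_empty)
  finally show ?thesis .
qed

lemma l2sq_simplex_0: "l2sq (simplex_measure 0 S u) f = ennreal ((norm (f (\<lambda>_. undefined)))\<^sup>2)"
  by (simp add: l2sq_def nn_integral_simplex_0)

lemma L2_simplexD:
  assumes "f \<in> L2_simplex n S u"
  shows "f \<in> borel_measurable (simplex_measure n S u)" "l2sq (simplex_measure n S u) f < \<infinity>"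
  using assms unfolding L2_simplex_def l2sq_def by blast+

lemma L2_simplexI:
  assumes "f \<in> borel_measurable (simplex_measure n S u)" "l2sq (simplex_measure n S u) f < \<infinity>"
  shows "f \<in> L2_simplex n S u"
  using assms unfolding L2_simplex_def l2sq_def by blast

lemma L2_simplex_slice:
  assumes f: "f \<in> L2_simplex (Suc n) S u"
  shows "AE s in time_interval S u. (\<lambda>r. f (case_nat s r)) \<in> L2_simplex n S s"
proof -
  note m = L2_simplexD(1)[OF f]
  have "(\<integral>\<^sup>+s. l2sq (simplex_measure n S s) (\<lambda>r. f (case_nat s r)) \<partial>time_interval S u) \<noteq> \<infinity>"
    using L2_simplexD(2)[OF f] unfolding l2sq_simplex_head(1)[OF m] by simp
  then have "AE s in time_interval S u. l2sq (simplex_measure n S s) (\<lambda>r. f (case_nat s r)) \<noteq> \<infinity>"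
    by (rule nn_integral_noteq_infinite[OF l2sq_simplex_head(2)[OF m]])
  then show ?thesis using AE_space
  proof eventually_elim
    case (elim s)
    then show ?case using measurable_simplex_slice[OF m, of s]
      by (intro L2_simplexI) (simp_all add: less_top)
  qed
qed

lemma L2_simplex_lincomb:
  fixes f g :: "_ \<Rightarrow> 'b::euclidean_space"
  assumes "f \<in> L2_simplex n S u" "g \<in> L2_simplex n S u"
  shows "(\<lambda>x. c *\<^sub>R f x + d *\<^sub>R g x) \<in> L2_simplex n S u"
proof (rule L2_simplexI)
  show "(\<lambda>x. c *\<^sub>R f x + d *\<^sub>R g x) \<in> borel_measurable (simplex_measure n S u)"
    by (intro borel_measurable_add borel_measurable_scaleR borel_measurable_const L2_simplexD assms)
  show "l2sq (simplex_measure n S u) (\<lambda>x. c *\<^sub>R f x + d *\<^sub>R g x) < \<infinity>"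
    by (intro l2sq_lincomb_finite L2_simplexD assms)
qed

section \<open>Isometry and closedness of iterated integrals\<close>

context brownian
begin

lemma process_section_l2sq_measurable:
  fixes \<xi> :: "real \<Rightarrow> 'w \<Rightarrow> 'b::euclidean_space"
  assumes "(\<lambda>(t, \<omega>). \<xi> t \<omega>) \<in> borel_measurable (time_interval S u \<Otimes>\<^sub>M M)"
  shows "(\<lambda>t. l2sq M (\<xi> t)) \<in> borel_measurable (time_interval S u)"
proof -
  have "(\<lambda>p. ennreal ((norm (case p of (t, \<omega>) \<Rightarrow> \<xi> t \<omega>))\<^sup>2)) \<in> borel_measurable (time_interval S u \<Otimes>\<^sub>M M)"
    using assms by measurable
  from borel_measurable_nn_integral_fst[OF this] show ?thesis unfolding l2sq_def by simp
qed

text \<open>By completeness on the product space. The limit has to be measurable for the filtration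
  at every time, and it is, being a pointwise \<open>lim\<close> of adapted processes.\<close>

lemma L2_adapted_complete:
  fixes \<Xi> :: "nat \<Rightarrow> real \<Rightarrow> 'w \<Rightarrow> 'b::euclidean_space"
  assumes \<Xi>: "\<And>k. \<Xi> k \<in> L2_adapted M W S u"
    and cauchy: "\<And>e::real. e > 0 \<Longrightarrow> \<exists>k. \<forall>m\<ge>k. \<forall>n\<ge>k. process_sqnorm M S u (\<lambda>t \<omega>. \<Xi> m t \<omega> - \<Xi> n t \<omega>) < ennreal e"
  shows "\<exists>\<xi>\<in>L2_adapted M W S u. (\<lambda>k. process_sqnorm M S u (\<lambda>t \<omega>. \<Xi> k t \<omega> - \<xi> t \<omega>)) \<longlonglongrightarrow> 0"
proof -
  let ?P = "time_interval S u \<Otimes>\<^sub>M M"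
  note m = L2_adapted_measurable[OF \<Xi>]
  obtain r :: "nat \<Rightarrow> nat" where r: "(\<lambda>k. l2sq ?P (\<lambda>x. (case x of (t, \<omega>) \<Rightarrow> \<Xi> k t \<omega>) - lim (\<lambda>j. case x of (t, \<omega>) \<Rightarrow> \<Xi> (r j) t \<omega>))) \<longlonglongrightarrow> 0"
    using l2sq_complete[OF m cauchy[unfolded process_sqnorm_diff_eq[OF m m]]] by blast
  define \<xi> where "\<xi> t \<omega> = lim (\<lambda>j. \<Xi> (r j) t \<omega>)" for t \<omega>
  have eq: "(case x of (t, \<omega>) \<Rightarrow> \<xi> t \<omega>) = lim (\<lambda>j. case x of (t, \<omega>) \<Rightarrow> \<Xi> (r j) t \<omega>)" for x
    by (cases x) (simp add: \<xi>_def)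
  have m\<xi>: "(\<lambda>(t, \<omega>). \<xi> t \<omega>) \<in> borel_measurable ?P"
    unfolding eq by (rule borel_measurable_lim_metric[OF m])
  have lim: "(\<lambda>k. process_sqnorm M S u (\<lambda>t \<omega>. \<Xi> k t \<omega> - \<xi> t \<omega>)) \<longlonglongrightarrow> 0"
    using r unfolding process_sqnorm_diff_eq[OF m m\<xi>] eq .
  have "process_sqnorm M S u \<xi> < \<infinity>"
  proof -
    obtain k where k: "l2sq ?P (\<lambda>x. (case x of (t, \<omega>) \<Rightarrow> \<Xi> k t \<omega>) - (case x of (t, \<omega>) \<Rightarrow> \<xi> t \<omega>)) < \<infinity>"
      using order_tendstoD(2)[OF lim, of \<infinity>] unfolding process_sqnorm_diff_eq[OF m m\<xi>]
      by (auto simp: eventually_sequentially)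
    have "l2sq ?P (\<lambda>(t, \<omega>). \<Xi> k t \<omega>) < \<infinity>"
      using \<Xi>[of k] unfolding process_sqnorm_eq_l2sq[OF m, symmetric] L2_adapted_def by blast
    then have "l2sq ?P (\<lambda>x. (case x of (t, \<omega>) \<Rightarrow> \<Xi> k t \<omega>) + ((case x of (t, \<omega>) \<Rightarrow> \<xi> t \<omega>) - (case x of (t, \<omega>) \<Rightarrow> \<Xi> k t \<omega>))) < \<infinity>"
      using k l2sq_minus_commute[of ?P "\<lambda>(t, \<omega>). \<Xi> k t \<omega>" "\<lambda>(t, \<omega>). \<xi> t \<omega>"]
      by (intro l2sq_add_finite borel_measurable_diff m m\<xi>) simp_all
    moreover have "(\<lambda>x. (case x of (t, \<omega>) \<Rightarrow> \<Xi> k t \<omega>) + ((case x of (t, \<omega>) \<Rightarrow> \<xi> t \<omega>) - (case x of (t, \<omega>) \<Rightarrow> \<Xi> k t \<omega>))) = (\<lambda>(t, \<omega>). \<xi> t \<omega>)"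
      by (auto simp: fun_eq_iff)
    ultimately show ?thesis by (simp only: process_sqnorm_eq_l2sq[OF m\<xi>])
  qed
  moreover have "\<xi> t \<in> borel_measurable (F t)" if "t \<in> {S<..<u}" for t
    unfolding \<xi>_def
  proof (rule borel_measurable_lim_metric)
    show "\<Xi> (r i) t \<in> borel_measurable (F t)" for i using \<Xi>[of "r i"] that unfolding L2_adapted_def by blast
  qed
  ultimately have "\<xi> \<in> L2_adapted M W S u" using m\<xi> unfolding L2_adapted_def by blast
  with lim show ?thesis by blast
qed

text \<open>Convergence in the mean over time passes to single times only along a subsequence; the
  next lemma is the counterpart for kernels.\<close>

lemma process_sections_AE_subseq:
  fixes \<Xi> :: "nat \<Rightarrow> real \<Rightarrow> 'w \<Rightarrow> 'b::euclidean_space"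
  assumes m: "\<And>k. (\<lambda>(t, \<omega>). \<Xi> k t \<omega>) \<in> borel_measurable (time_interval S u \<Otimes>\<^sub>M M)"
    and m\<xi>: "(\<lambda>(t, \<omega>). \<xi> t \<omega>) \<in> borel_measurable (time_interval S u \<Otimes>\<^sub>M M)"
    and lim: "(\<lambda>k. process_sqnorm M S u (\<lambda>t \<omega>. \<Xi> k t \<omega> - \<xi> t \<omega>)) \<longlonglongrightarrow> 0"
  shows "\<exists>r::nat \<Rightarrow> nat. strict_mono r \<and> (AE t in time_interval S u. (\<lambda>k. l2sq M (\<lambda>\<omega>. \<Xi> (r k) t \<omega> - \<xi> t \<omega>)) \<longlonglongrightarrow> 0)"
  using lim unfolding process_sqnorm_eq_nn_integral[OF measurable_pair_diff[OF m m\<xi>]]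
  by (rule nn_integral_tendsto_0_AE_subseq[OF process_section_l2sq_measurable[OF measurable_pair_diff[OF m m\<xi>]]])

lemma simplex_slices_AE_subseq:
  fixes f :: "nat \<Rightarrow> (nat \<Rightarrow> real) \<Rightarrow> 'b::euclidean_space"
  assumes "\<And>k. f k \<in> borel_measurable (simplex_measure (Suc n) S u)" "g \<in> borel_measurable (simplex_measure (Suc n) S u)"
    and lim: "(\<lambda>k. l2sq (simplex_measure (Suc n) S u) (\<lambda>x. f k x - g x)) \<longlonglongrightarrow> 0"
  shows "\<exists>r::nat \<Rightarrow> nat. strict_mono r \<and> (AE s in time_interval S u.
     (\<lambda>k. l2sq (simplex_measure n S s) (\<lambda>x. f (r k) (case_nat s x) - g (case_nat s x))) \<longlonglongrightarrow> 0)"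
proof -
  have m: "(\<lambda>x. f k x - g x) \<in> borel_measurable (simplex_measure (Suc n) S u)" for k
    by (intro borel_measurable_diff assms)
  show ?thesis
    using lim unfolding l2sq_simplex_head(1)[OF m]
    by (rule nn_integral_tendsto_0_AE_subseq[OF l2sq_simplex_head(2)[OF m]])
qed

lemma is_wiener_chaosD:
  assumes "is_wiener_chaos M W S u n f \<xi>"
  shows "\<xi> \<in> L2_adapted M W S u"
    "AE t in time_interval S u. has_iterated_integral M W S n t (\<lambda>r. f (case_nat t r)) (\<xi> t)"
  using assms unfolding is_wiener_chaos_def by blast+

text \<open>The Ito integral already forces its integrand to be adapted and square-integrable, so
  that integrand is a chaos of one order less. Inductions on \<open>n\<close> therefore alternate
  between the two notions.\<close>

lemma has_iterated_integral_Suc_iff: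
  "has_iterated_integral M W S (Suc n) u f X \<longleftrightarrow>
    (\<exists>Y. is_wiener_chaos M W S u n f Y \<and> has_ito_integral M W S u Y X)"
  unfolding is_wiener_chaos_def has_iterated_integral.simps has_ito_integral_def by blast

text \<open>Half of an induction step, with the claim for iterated integrals of order
  \<open>n\<close> as the hypothesis \<open>lin\<close>. It serves inside the induction over
  \<open>n\<close> and again afterwards, once that claim is proved.
  \<open>chaos_isometry_step\<close> and \<open>is_wiener_chaos_limit_step\<close> are organised in
  the same way.\<close>

lemma is_wiener_chaos_lincomb_step:
  fixes \<xi> \<zeta> :: "real \<Rightarrow> 'w \<Rightarrow> 'b::euclidean_space"
  assumes lin: "\<And>u f g X X'. has_iterated_integral M W S n u f X \<Longrightarrow> has_iterated_integral M W S n u g X' \<Longrightarrow>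
      has_iterated_integral M W S n u (\<lambda>r. c *\<^sub>R f r + d *\<^sub>R g r) (\<lambda>\<omega>. c *\<^sub>R X \<omega> + d *\<^sub>R X' \<omega> :: 'b)"
    and 1: "is_wiener_chaos M W S u n f \<xi>" and 2: "is_wiener_chaos M W S u n g \<zeta>"
  shows "is_wiener_chaos M W S u n (\<lambda>r. c *\<^sub>R f r + d *\<^sub>R g r) (\<lambda>t \<omega>. c *\<^sub>R \<xi> t \<omega> + d *\<^sub>R \<zeta> t \<omega>)"
  unfolding is_wiener_chaos_def
proof
  show "(\<lambda>t \<omega>. c *\<^sub>R \<xi> t \<omega> + d *\<^sub>R \<zeta> t \<omega>) \<in> L2_adapted M W S u"
    by (intro L2_adapted_lincomb is_wiener_chaosD[OF 1] is_wiener_chaosD[OF 2])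
  show "AE t in time_interval S u. has_iterated_integral M W S n t
     (\<lambda>r. c *\<^sub>R f (case_nat t r) + d *\<^sub>R g (case_nat t r)) (\<lambda>\<omega>. c *\<^sub>R \<xi> t \<omega> + d *\<^sub>R \<zeta> t \<omega>)"
    using is_wiener_chaosD(2)[OF 1] is_wiener_chaosD(2)[OF 2] by eventually_elim (rule lin)
qed

lemma has_iterated_integral_lincomb:
  fixes X X' :: "'w \<Rightarrow> 'b::euclidean_space"
  assumes "has_iterated_integral M W S n u f X" "has_iterated_integral M W S n u g X'"
  shows "has_iterated_integral M W S n u (\<lambda>r. c *\<^sub>R f r + d *\<^sub>R g r) (\<lambda>\<omega>. c *\<^sub>R X \<omega> + d *\<^sub>R X' \<omega>)"
  using assms
proof (induction n arbitrary: u f g X X')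
  case 0
  then have "X \<in> borel_measurable M" "X' \<in> borel_measurable M" "AE \<omega> in M. X \<omega> = f (\<lambda>_. undefined)"
    "AE \<omega> in M. X' \<omega> = g (\<lambda>_. undefined)" by simp_all
  moreover from this(3,4) have "AE \<omega> in M. c *\<^sub>R X \<omega> + d *\<^sub>R X' \<omega> = c *\<^sub>R f (\<lambda>_. undefined) + d *\<^sub>R g (\<lambda>_. undefined)"
    by eventually_elim simp
  ultimately show ?case
    unfolding has_iterated_integral.simps by (intro conjI borel_measurable_add borel_measurable_scaleR borel_measurable_const)
next
  case (Suc n)
  from Suc.prems obtain Y Y' where
    "is_wiener_chaos M W S u n f Y" "has_ito_integral M W S u Y X"
    "is_wiener_chaos M W S u n g Y'" "has_ito_integral M W S u Y' X'"
    unfolding has_iterated_integral_Suc_iff by blast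
  note Y = this
  have "is_wiener_chaos M W S u n (\<lambda>r. c *\<^sub>R f r + d *\<^sub>R g r) (\<lambda>t \<omega>. c *\<^sub>R Y t \<omega> + d *\<^sub>R Y' t \<omega>)"
    by (rule is_wiener_chaos_lincomb_step[OF _ Y(1,3)]) (rule Suc.IH)
  with has_ito_integral_lincomb[OF Y(2,4)] show ?case unfolding has_iterated_integral_Suc_iff by blast
qed

lemma is_wiener_chaos_lincomb:
  fixes \<xi> \<zeta> :: "real \<Rightarrow> 'w \<Rightarrow> 'b::euclidean_space"
  assumes "is_wiener_chaos M W S u n f \<xi>" "is_wiener_chaos M W S u n g \<zeta>"
  shows "is_wiener_chaos M W S u n (\<lambda>r. c *\<^sub>R f r + d *\<^sub>R g r) (\<lambda>t \<omega>. c *\<^sub>R \<xi> t \<omega> + d *\<^sub>R \<zeta> t \<omega>)"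
  by (rule is_wiener_chaos_lincomb_step[OF _ assms]) (rule has_iterated_integral_lincomb)

lemma is_wiener_chaos_diff:
  fixes \<xi> \<zeta> :: "real \<Rightarrow> 'w \<Rightarrow> 'b::euclidean_space"
  assumes "is_wiener_chaos M W S u n f \<xi>" "is_wiener_chaos M W S u n g \<zeta>"
  shows "is_wiener_chaos M W S u n (\<lambda>r. f r - g r) (\<lambda>t \<omega>. \<xi> t \<omega> - \<zeta> t \<omega>)"
  using is_wiener_chaos_lincomb[OF assms, of 1 "-1"] by simp

lemma has_iterated_integral_zero:
  "S \<le> u \<Longrightarrow> has_iterated_integral M W S n u (\<lambda>_. 0) (\<lambda>_. 0 :: 'b::euclidean_space)"
proof (induction n arbitrary: u)
  case (Suc n)
  have "AE t in time_interval S u. has_iterated_integral M W S n t (\<lambda>_. 0) (\<lambda>_. 0 :: 'b)"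
    using AE_space by eventually_elim (simp add: Suc.IH)
  with has_ito_integral_zero[OF Suc.prems] show ?case by auto
qed simp

text \<open>The isometry is proved for whole finite sums over the chaos orders, because then the orthogonality
  of different orders comes out of the same induction: the Ito isometry with an additive constant splits
  off order \<open>0\<close>, and the remaining orders go down by one inside a single Ito integral.\<close>

lemma chaos_isometry_step:
  fixes f :: "nat \<Rightarrow> (nat \<Rightarrow> real) \<Rightarrow> 'b::euclidean_space"
  assumes iso: "\<And>u f X. S \<le> u \<Longrightarrow>
      (\<And>n. n < N \<Longrightarrow> f n \<in> L2_simplex n S u \<and> has_iterated_integral M W S n u (f n) (X n)) \<Longrightarrow>
      l2sq M (\<lambda>\<omega>. \<Sum>n<N. X n \<omega> :: 'b) = (\<Sum>n<N. l2sq (simplex_measure n S u) (f n))"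
    and f: "\<And>n. n < N \<Longrightarrow> f n \<in> L2_simplex (Suc n) S u \<and> is_wiener_chaos M W S u n (f n) (\<Xi> n)"
  shows "process_sqnorm M S u (\<lambda>t \<omega>. \<Sum>n<N. \<Xi> n t \<omega>) = (\<Sum>n<N. l2sq (simplex_measure (Suc n) S u) (f n))"
proof -
  have m: "(\<lambda>(t, \<omega>). \<Sum>n<N. \<Xi> n t \<omega>) \<in> borel_measurable (time_interval S u \<Otimes>\<^sub>M M)"
  proof -
    have "(\<lambda>x. \<Xi> n (fst x) (snd x)) \<in> borel_measurable (time_interval S u \<Otimes>\<^sub>M M)" if "n \<in> {..<N}" for n
    proof -
      have "is_wiener_chaos M W S u n (f n) (\<Xi> n)" using f that by blast
      from L2_adapted_measurable[OF is_wiener_chaosD(1)[OF this]] show ?thesis by (simp only: case_prod_beta')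
    qed
    then show ?thesis unfolding case_prod_beta' by (rule borel_measurable_sum)
  qed
  have ae: "AE t in time_interval S u. \<forall>n\<in>{..<N}. (\<lambda>r. f n (case_nat t r)) \<in> L2_simplex n S t \<and>
     has_iterated_integral M W S n t (\<lambda>r. f n (case_nat t r)) (\<Xi> n t)"
  proof (intro AE_finite_allI AE_conjI)
    fix n assume "n \<in> {..<N}"
    then have "f n \<in> L2_simplex (Suc n) S u" "is_wiener_chaos M W S u n (f n) (\<Xi> n)" using f by blast+
    note fn = this
    show "AE t in time_interval S u. (\<lambda>r. f n (case_nat t r)) \<in> L2_simplex n S t"
      by (rule L2_simplex_slice[OF fn(1)])
    show "AE t in time_interval S u. has_iterated_integral M W S n t (\<lambda>r. f n (case_nat t r)) (\<Xi> n t)"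
      by (rule is_wiener_chaosD(2)[OF fn(2)])
  qed simp
  have "process_sqnorm M S u (\<lambda>t \<omega>. \<Sum>n<N. \<Xi> n t \<omega>) = (\<integral>\<^sup>+t. l2sq M (\<lambda>\<omega>. \<Sum>n<N. \<Xi> n t \<omega>) \<partial>time_interval S u)"
    by (rule process_sqnorm_eq_nn_integral[OF m])
  also have "\<dots> = (\<integral>\<^sup>+t. (\<Sum>n<N. l2sq (simplex_measure n S t) (\<lambda>r. f n (case_nat t r))) \<partial>time_interval S u)"
  proof (rule nn_integral_cong_AE)
    show "AE t in time_interval S u. l2sq M (\<lambda>\<omega>. \<Sum>n<N. \<Xi> n t \<omega>) = (\<Sum>n<N. l2sq (simplex_measure n S t) (\<lambda>r. f n (case_nat t r)))"
      using ae AE_space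
    proof eventually_elim
      case (elim t)
      show ?case using elim by (intro iso) simp_all
    qed
  qed
  also have "\<dots> = (\<Sum>n<N. \<integral>\<^sup>+t. l2sq (simplex_measure n S t) (\<lambda>r. f n (case_nat t r)) \<partial>time_interval S u)"
  proof (rule nn_integral_sum)
    fix n assume "n \<in> {..<N}"
    then have "f n \<in> L2_simplex (Suc n) S u" using f by blast
    from l2sq_simplex_head(2)[OF L2_simplexD(1)[OF this]]
    show "(\<lambda>t. l2sq (simplex_measure n S t) (\<lambda>r. f n (case_nat t r))) \<in> borel_measurable (time_interval S u)" .
  qed
  also have "\<dots> = (\<Sum>n<N. l2sq (simplex_measure (Suc n) S u) (f n))"
  proof (intro sum.cong refl)
    fix n assume "n \<in> {..<N}"
    then have "f n \<in> L2_simplex (Suc n) S u" using f by blast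
    from l2sq_simplex_head(1)[OF L2_simplexD(1)[OF this]]
    show "(\<integral>\<^sup>+t. l2sq (simplex_measure n S t) (\<lambda>r. f n (case_nat t r)) \<partial>time_interval S u) = l2sq (simplex_measure (Suc n) S u) (f n)"
      by simp
  qed
  finally show ?thesis .
qed

lemma has_iterated_integral_isometry_sum:
  fixes f :: "nat \<Rightarrow> (nat \<Rightarrow> real) \<Rightarrow> 'b::euclidean_space"
  assumes "S \<le> u" "\<And>n. n < N \<Longrightarrow> f n \<in> L2_simplex n S u \<and> has_iterated_integral M W S n u (f n) (X n)"
  shows "l2sq M (\<lambda>\<omega>. \<Sum>n<N. X n \<omega>) = (\<Sum>n<N. l2sq (simplex_measure n S u) (f n))"
  using assms
proof (induction N arbitrary: u f X)
  case (Suc N)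
  have X0: "AE \<omega> in M. X 0 \<omega> = f 0 (\<lambda>_. undefined)" using Suc.prems(2)[of 0] by simp
  have "\<exists>Y. is_wiener_chaos M W S u n (f (Suc n)) Y \<and> has_ito_integral M W S u Y (X (Suc n))" if "n < N" for n
    using Suc.prems(2)[of "Suc n"] that has_iterated_integral_Suc_iff by blast
  then obtain Y where Y: "\<And>n. n < N \<Longrightarrow> is_wiener_chaos M W S u n (f (Suc n)) (Y n)"
    "\<And>n. n < N \<Longrightarrow> has_ito_integral M W S u (Y n) (X (Suc n))" by metis
  have "l2sq M (\<lambda>\<omega>. \<Sum>n<Suc N. X n \<omega>) = l2sq M (\<lambda>\<omega>. f 0 (\<lambda>_. undefined) + (\<Sum>n<N. X (Suc n) \<omega>))"
    by (rule l2sq_cong_AE, use X0 in eventually_elim) (simp add: sum.lessThan_Suc_shift del: sum.lessThan_Suc)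
  also have "\<dots> = ennreal ((norm (f 0 (\<lambda>_. undefined)))\<^sup>2) + process_sqnorm M S u (\<lambda>t \<omega>. \<Sum>n<N. Y n t \<omega>)"
    by (rule has_ito_integral_isometry[OF has_ito_integral_sum[OF Suc.prems(1) Y(2)]])
  also have "process_sqnorm M S u (\<lambda>t \<omega>. \<Sum>n<N. Y n t \<omega>) = (\<Sum>n<N. l2sq (simplex_measure (Suc n) S u) (f (Suc n)))"
    using Suc.prems(2) Y(1) by (intro chaos_isometry_step Suc.IH) simp_all
  finally show ?case
    by (simp add: sum.lessThan_Suc_shift l2sq_simplex_0 del: sum.lessThan_Suc)
qed simp

lemma wiener_chaos_isometry_sum:
  fixes f :: "nat \<Rightarrow> (nat \<Rightarrow> real) \<Rightarrow> 'b::euclidean_space"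
  assumes "\<And>n. n < N \<Longrightarrow> f n \<in> L2_simplex (Suc n) S u" "\<And>n. n < N \<Longrightarrow> is_wiener_chaos M W S u n (f n) (\<Xi> n)"
  shows "process_sqnorm M S u (\<lambda>t \<omega>. \<Sum>n<N. \<Xi> n t \<omega>) = (\<Sum>n<N. l2sq (simplex_measure (Suc n) S u) (f n))"
  using assms by (intro chaos_isometry_step has_iterated_integral_isometry_sum) simp_all

lemma is_wiener_chaos_zero: "is_wiener_chaos M W S u n (\<lambda>_. 0) (\<lambda>_ _. 0 :: 'b::euclidean_space)"
proof -
  have "(\<lambda>_ _. 0 :: 'b) \<in> L2_adapted M W S u"
    using L2_adapted_piece(1)[of "\<lambda>_. 0::'b" S S u] by simp
  moreover have "AE t in time_interval S u. has_iterated_integral M W S n t (\<lambda>_. 0) (\<lambda>_. 0 :: 'b)"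
    using AE_space by eventually_elim (simp add: has_iterated_integral_zero)
  ultimately show ?thesis unfolding is_wiener_chaos_def by blast
qed

lemma L2_simplex_zero: "(\<lambda>_. 0 :: 'b::euclidean_space) \<in> L2_simplex n S u"
  by (rule L2_simplexI) simp_all

lemma wiener_chaos_isometry:
  fixes f :: "(nat \<Rightarrow> real) \<Rightarrow> 'b::euclidean_space"
  assumes f: "f \<in> L2_simplex (Suc n) S u" and \<xi>: "is_wiener_chaos M W S u n f \<xi>"
  shows "process_sqnorm M S u \<xi> = l2sq (simplex_measure (Suc n) S u) f"
proof -
  let ?f = "\<lambda>k. if k = n then f else (\<lambda>_. 0)" and ?\<Xi> = "\<lambda>k. if k = n then \<xi> else (\<lambda>_ _. 0)"
  have "process_sqnorm M S u (\<lambda>t \<omega>. \<Sum>k<Suc n. ?\<Xi> k t \<omega>) = (\<Sum>k<Suc n. l2sq (simplex_measure (Suc k) S u) (?f k))"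
    by (rule wiener_chaos_isometry_sum) (simp_all add: f \<xi> L2_simplex_zero is_wiener_chaos_zero)
  then show ?thesis by simp
qed

text \<open>By the isometry the processes are Cauchy, which provides an adapted limit. At almost
  every time it is identified by the hypothesis \<open>closed\<close>, applied to slices of the
  kernels and sections of the processes.\<close>

lemma is_wiener_chaos_limit_step:
  fixes f :: "nat \<Rightarrow> (nat \<Rightarrow> real) \<Rightarrow> 'b::euclidean_space"
  assumes closed: "\<And>u h h' X Z. S \<le> u \<Longrightarrow> (\<And>k::nat. h k \<in> L2_simplex n S u) \<Longrightarrow> h' \<in> L2_simplex n S u \<Longrightarrow>
      (\<And>k. has_iterated_integral M W S n u (h k) (X k)) \<Longrightarrow> Z \<in> borel_measurable M \<Longrightarrow>
      (\<lambda>k. l2sq (simplex_measure n S u) (\<lambda>x. h k x - h' x)) \<longlonglongrightarrow> 0 \<Longrightarrow>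
      (\<lambda>k. l2sq M (\<lambda>\<omega>. X k \<omega> - Z \<omega> :: 'b)) \<longlonglongrightarrow> 0 \<Longrightarrow> has_iterated_integral M W S n u h' Z"
    and f: "\<And>k. f k \<in> L2_simplex (Suc n) S u" and g: "g \<in> L2_simplex (Suc n) S u"
    and lim: "(\<lambda>k. l2sq (simplex_measure (Suc n) S u) (\<lambda>x. f k x - g x)) \<longlonglongrightarrow> 0"
    and ch: "\<And>k. is_wiener_chaos M W S u n (f k) (\<Xi> k)"
  shows "\<exists>\<xi>. is_wiener_chaos M W S u n g \<xi> \<and> (\<lambda>k. process_sqnorm M S u (\<lambda>t \<omega>. \<Xi> k t \<omega> - \<xi> t \<omega>)) \<longlonglongrightarrow> 0"
proof -
  have diff: "(\<lambda>x. f k x - f j x) \<in> L2_simplex (Suc n) S u" for k j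
    using L2_simplex_lincomb[OF f f, of 1 _ "-1"] by simp
  have iso: "process_sqnorm M S u (\<lambda>t \<omega>. \<Xi> k t \<omega> - \<Xi> j t \<omega>) = l2sq (simplex_measure (Suc n) S u) (\<lambda>x. f k x - f j x)" for k j
    by (rule wiener_chaos_isometry[OF diff is_wiener_chaos_diff[OF ch ch]])
  note \<Xi> = is_wiener_chaosD(1)[OF ch]
  obtain \<xi> where \<xi>: "\<xi> \<in> L2_adapted M W S u" and lim\<xi>: "(\<lambda>k. process_sqnorm M S u (\<lambda>t \<omega>. \<Xi> k t \<omega> - \<xi> t \<omega>)) \<longlonglongrightarrow> 0"
    using L2_adapted_complete[OF \<Xi>, unfolded iso, OF l2sq_tendsto_imp_cauchy[OF L2_simplexD(1)[OF f] L2_simplexD(1)[OF g] lim]]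
    by blast
  obtain r1 :: "nat \<Rightarrow> nat" where r1: "strict_mono r1" "AE t in time_interval S u.
      (\<lambda>k. l2sq (simplex_measure n S t) (\<lambda>x. f (r1 k) (case_nat t x) - g (case_nat t x))) \<longlonglongrightarrow> 0"
    using simplex_slices_AE_subseq[OF L2_simplexD(1)[OF f] L2_simplexD(1)[OF g] lim] by blast
  \<comment> \<open>The second subsequence is taken inside the first, so that slices and sections
    converge along the same indices.\<close>
  have "(\<lambda>k. process_sqnorm M S u (\<lambda>t \<omega>. \<Xi> (r1 k) t \<omega> - \<xi> t \<omega>)) \<longlonglongrightarrow> 0"
    using LIMSEQ_subseq_LIMSEQ[OF lim\<xi> r1(1)] by (simp add: o_def)
  from process_sections_AE_subseq[OF L2_adapted_measurable[OF \<Xi>] L2_adapted_measurable[OF \<xi>] this]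
  obtain r2 :: "nat \<Rightarrow> nat" where r2: "strict_mono r2"
    "AE t in time_interval S u. (\<lambda>k. l2sq M (\<lambda>\<omega>. \<Xi> (r1 (r2 k)) t \<omega> - \<xi> t \<omega>)) \<longlonglongrightarrow> 0" by blast
  have fs: "AE t in time_interval S u. \<forall>k. (\<lambda>r. f k (case_nat t r)) \<in> L2_simplex n S t"
    using L2_simplex_slice[OF f] by (simp add: AE_all_countable)
  have hs: "AE t in time_interval S u. \<forall>k. has_iterated_integral M W S n t (\<lambda>r. f k (case_nat t r)) (\<Xi> k t)"
    using is_wiener_chaosD(2)[OF ch] by (simp add: AE_all_countable)
  have "AE t in time_interval S u. has_iterated_integral M W S n t (\<lambda>r. g (case_nat t r)) (\<xi> t)"
    using fs hs L2_simplex_slice[OF g] r1(2) r2(2) AE_space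
  proof eventually_elim
    case (elim t)
    show ?case
    proof (rule closed[of t "\<lambda>k r. f (r1 (r2 k)) (case_nat t r)" "\<lambda>r. g (case_nat t r)" "\<lambda>k. \<Xi> (r1 (r2 k)) t" "\<xi> t"])
      show "S \<le> t" using elim(6) by simp
      show "(\<lambda>k. l2sq (simplex_measure n S t) (\<lambda>x. f (r1 (r2 k)) (case_nat t x) - g (case_nat t x))) \<longlonglongrightarrow> 0"
        using LIMSEQ_subseq_LIMSEQ[OF elim(4) r2(1)] by (simp add: o_def)
      show "\<xi> t \<in> borel_measurable M" using elim(6) L2_adapted_section[OF \<xi>] by (simp only: space_time_interval)
    qed (use elim in blast)+
  qed
  with \<xi> lim\<xi> show ?thesis unfolding is_wiener_chaos_def by blast
qed

lemma has_iterated_integral_limit: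
  fixes f :: "nat \<Rightarrow> (nat \<Rightarrow> real) \<Rightarrow> 'b::euclidean_space"
  assumes "S \<le> u" "\<And>k. f k \<in> L2_simplex n S u" "g \<in> L2_simplex n S u"
    "\<And>k. has_iterated_integral M W S n u (f k) (X k)" "Z \<in> borel_measurable M"
    "(\<lambda>k. l2sq (simplex_measure n S u) (\<lambda>x. f k x - g x)) \<longlonglongrightarrow> 0"
    "(\<lambda>k. l2sq M (\<lambda>\<omega>. X k \<omega> - Z \<omega>)) \<longlonglongrightarrow> 0"
  shows "has_iterated_integral M W S n u g Z"
  using assms
proof (induction n arbitrary: u f X g Z)
  case 0
  let ?c = "g (\<lambda>_. undefined)"
  have X: "X k \<in> borel_measurable M" "AE \<omega> in M. X k \<omega> = f k (\<lambda>_. undefined)" for k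
    using 0(4)[of k] by simp_all
  have "l2sq M (\<lambda>\<omega>. X k \<omega> - ?c) = l2sq (simplex_measure 0 S u) (\<lambda>x. f k x - g x)" for k
  proof -
    have "l2sq M (\<lambda>\<omega>. X k \<omega> - ?c) = l2sq M (\<lambda>\<omega>. f k (\<lambda>_. undefined) - ?c)"
      by (rule l2sq_cong_AE, use X(2)[of k] in eventually_elim) simp
    then show ?thesis by (simp add: l2sq_simplex_0) (simp add: l2sq_def emeasure_space_1)
  qed
  then have "(\<lambda>k. l2sq M (\<lambda>\<omega>. X k \<omega> - ?c)) \<longlonglongrightarrow> 0" using 0(6) by simp
  \<comment> \<open>The distance of \<open>Z\<close> from the constant \<open>?c\<close> does not
    depend on \<open>k\<close> and is bounded by quantities tending to 0, hence it is 0.\<close>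
  then have "(\<lambda>k::nat. l2sq M (\<lambda>\<omega>. Z \<omega> - ?c)) \<longlonglongrightarrow> 0"
    using 0(7) by (intro l2sq_tendsto_0_triangle[where f="\<lambda>_. Z" and g=X and h="\<lambda>_ _. ?c"] X 0(5) borel_measurable_const)
      (simp_all add: l2sq_minus_commute[of M Z])
  then have "l2sq M (\<lambda>\<omega>. Z \<omega> - ?c) = 0" by (simp add: LIMSEQ_const_iff)
  then have "AE \<omega> in M. Z \<omega> - ?c = 0"
    using l2sq_eq_0_iff[OF borel_measurable_diff[OF 0(5) borel_measurable_const]] by blast
  then have "AE \<omega> in M. Z \<omega> = ?c" by eventually_elim simp
  with 0(5) show ?case unfolding has_iterated_integral.simps by blast
next
  case (Suc n)
  have "\<exists>Y. is_wiener_chaos M W S u n (f k) Y \<and> has_ito_integral M W S u Y (X k)" for k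
    using Suc.prems(4) has_iterated_integral_Suc_iff by blast
  then obtain Y where Y: "\<And>k. is_wiener_chaos M W S u n (f k) (Y k)" "\<And>k. has_ito_integral M W S u (Y k) (X k)"
    by metis
  obtain \<xi> where \<xi>: "is_wiener_chaos M W S u n g \<xi>" "(\<lambda>k. process_sqnorm M S u (\<lambda>t \<omega>. Y k t \<omega> - \<xi> t \<omega>)) \<longlonglongrightarrow> 0"
    using is_wiener_chaos_limit_step[OF _ Suc.prems(2,3,6) Y(1)] Suc.IH by blast
  have "has_ito_integral M W S u \<xi> Z"
    by (rule has_ito_integral_limit[OF Y(2) is_wiener_chaosD(1)[OF \<xi>(1)] Suc.prems(5) \<xi>(2) Suc.prems(7)])
  with \<xi>(1) show ?case unfolding has_iterated_integral_Suc_iff by blast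
qed

lemma is_wiener_chaos_limit:
  fixes f :: "nat \<Rightarrow> (nat \<Rightarrow> real) \<Rightarrow> 'b::euclidean_space"
  assumes "\<And>k. f k \<in> L2_simplex (Suc n) S u" "g \<in> L2_simplex (Suc n) S u"
    "(\<lambda>k. l2sq (simplex_measure (Suc n) S u) (\<lambda>x. f k x - g x)) \<longlonglongrightarrow> 0"
    "\<And>k. is_wiener_chaos M W S u n (f k) (\<Xi> k)"
  shows "\<exists>\<xi>. is_wiener_chaos M W S u n g \<xi>"
  using is_wiener_chaos_limit_step[OF _ assms] has_iterated_integral_limit by blast

end

section \<open>Existence of iterated integrals\<close>

text \<open>A half-space in one coordinate is a countable union of orthants whose other bounds grow.
  Orthants are chosen as generators because they are stable under intersection and cut a box in a
  box.\<close>

lemma sets_lborel_n_orthants: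
  "sets (lborel_n n) = sigma_sets (space (lborel_n n)) (range (\<lambda>d. {x\<in>space (lborel_n n). \<forall>i<n. x i \<le> d i}))"
    (is "_ = sigma_sets ?\<Omega> ?G")
proof (rule antisym)
  let ?N = "sigma ?\<Omega> ?G"
  have N: "space ?N = ?\<Omega>" "sets ?N = sigma_sets ?\<Omega> ?G" by (auto intro!: space_measure_of sets_measure_of)
  have m: "(\<lambda>x. x i) \<in> borel_measurable ?N" if i: "i < n" for i
  proof (rule borel_measurableI_le)
    fix y :: real
    have "{x \<in> space ?N. x i \<le> y} = (\<Union>k::nat. {x\<in>?\<Omega>. \<forall>j<n. x j \<le> (if j = i then y else real k)})"
    proof (intro set_eqI iffI)
      fix x assume x: "x \<in> {x \<in> space ?N. x i \<le> y}"
      obtain k :: nat where k: "(\<Sum>j<n. \<bar>x j\<bar>) \<le> real k" using real_arch_simple by blast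
      have "x j \<le> real k" if "j < n" for j
      proof -
        have "\<bar>x j\<bar> \<le> (\<Sum>j<n. \<bar>x j\<bar>)" using that by (intro member_le_sum) auto
        then show ?thesis using k by linarith
      qed
      then show "x \<in> (\<Union>k::nat. {x\<in>?\<Omega>. \<forall>j<n. x j \<le> (if j = i then y else real k)})"
        using x unfolding N by (intro UN_I[of k]) auto
    next
      fix x assume "x \<in> (\<Union>k::nat. {x\<in>?\<Omega>. \<forall>j<n. x j \<le> (if j = i then y else real k)})"
      then show "x \<in> {x \<in> space ?N. x i \<le> y}" using i unfolding N by (auto split: if_splits)
    qed
    also have "\<dots> \<in> sets ?N" unfolding N by (intro sigma_sets.Union sigma_sets.Basic) auto
    finally show "{x \<in> space ?N. x i \<le> y} \<in> sets ?N" .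
  qed
  show "sets (lborel_n n) \<subseteq> sigma_sets ?\<Omega> ?G"
    unfolding sets_PiM_single[of "{..<n}" "\<lambda>_. lborel", folded space_PiM]
  proof (rule sigma_sets_mono, intro subsetI)
    fix B assume "B \<in> {{f \<in> ?\<Omega>. f i \<in> A} |i A. i \<in> {..<n} \<and> A \<in> sets lborel}"
    then obtain i A where B: "B = {f \<in> ?\<Omega>. f i \<in> A}" "i < n" "A \<in> sets borel" by auto
    then have "B = (\<lambda>x. x i) -` A \<inter> space ?N" unfolding N by auto
    also have "\<dots> \<in> sets ?N" by (rule measurable_sets[OF m[OF B(2)] B(3)])
    finally show "B \<in> sigma_sets ?\<Omega> ?G" unfolding N .
  qed
  show "sigma_sets ?\<Omega> ?G \<subseteq> sets (lborel_n n)"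
  proof (rule sets.sigma_sets_subset, intro subsetI)
    fix B assume "B \<in> ?G"
    then obtain d where B: "B = {x\<in>?\<Omega>. \<forall>i\<in>{..<n}. x i \<le> d i}" by auto
    have "(\<lambda>x. x i) \<in> borel_measurable (lborel_n n)" if "i \<in> {..<n}" for i
      using measurable_component_singleton[OF that, of "\<lambda>_. lborel"] by simp
    then show "B \<in> sets (lborel_n n)" unfolding B
      by (intro sets.sets_Collect_finite_All borel_measurable_le borel_measurable_const) auto
  qed
qed

lemma emeasure_simplex_finite: "emeasure (simplex_measure n S T) (ord_simplex n S T) < \<infinity>"
proof -
  have "emeasure (simplex_measure n S T) (ord_simplex n S T) = emeasure (lborel_n n) (ord_simplex n S T)"
    unfolding simplex_measure_def by (rule emeasure_restrict_space) (auto simp: ord_simplex_subset_space ord_simplex_sets)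
  also have "\<dots> \<le> emeasure (lborel_n n) (Pi\<^sub>E {..<n} (\<lambda>_. {S<..<T}))"
  proof (rule emeasure_mono)
    show "ord_simplex n S T \<subseteq> Pi\<^sub>E {..<n} (\<lambda>_. {S<..<T})" by (auto simp: ord_simplex_def PiE_def Pi_def)
    show "Pi\<^sub>E {..<n} (\<lambda>_. {S<..<T}) \<in> sets (lborel_n n)" by (rule sets_PiM_I_finite) auto
  qed
  also have "\<dots> = (\<Prod>i<n. emeasure lborel {S<..<T})"
    by (rule product_sigma_finite.emeasure_PiM[OF product_lborel]) auto
  also have "\<dots> < \<infinity>" by (cases "S \<le> T") (simp_all add: power_less_top_ennreal)
  finally show ?thesis .
qed

lemma sets_simplex_measure: "sets (simplex_measure n S T) = {A. A \<subseteq> ord_simplex n S T \<and> A \<in> sets (lborel_n n)}"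
  unfolding simplex_measure_def
  by (rule set_eqI) (simp add: sets_restrict_space_iff ord_simplex_subset_space ord_simplex_sets)

context brownian
begin

text \<open>The sides are half-open as in \<open>simple_process\<close>. For sides arranged in
  decreasing order the coordinates of a point of the box are ordered automatically, so no ordering
  test appears.\<close>

definition rect_indicator :: "nat \<Rightarrow> (nat \<Rightarrow> real) \<Rightarrow> (nat \<Rightarrow> real) \<Rightarrow> 'b \<Rightarrow> (nat \<Rightarrow> real) \<Rightarrow> 'b::euclidean_space" where
  "rect_indicator n a b v x = (if \<forall>i<n. a i < x i \<and> x i \<le> b i then v else 0)"

text \<open>For an outermost time in the first side, the inner integral is over sides that end no
  later than \<open>a 0\<close>, so it is one random variable known at time \<open>a 0\<close>. The
  integrand is thus a single random step, and the Ito integral multiplies it by the first increment.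
  The claims on measurability and finiteness feed the next step of the induction.\<close>

lemma has_iterated_integral_rect:
  fixes v :: "'b::euclidean_space"
  assumes "S \<le> u" "\<And>i. i < n \<Longrightarrow> S \<le> a i \<and> a i \<le> b i" "\<And>i. Suc i < n \<Longrightarrow> b (Suc i) \<le> a i" "0 < n \<Longrightarrow> b 0 \<le> u"
  shows "has_iterated_integral M W S n u (rect_indicator n a b v) (\<lambda>\<omega>. (\<Prod>i<n. W (b i) \<omega> - W (a i) \<omega>) *\<^sub>R v) \<and>
    (\<lambda>\<omega>. (\<Prod>i<n. W (b i) \<omega> - W (a i) \<omega>) *\<^sub>R v) \<in> borel_measurable (F u) \<and>
    l2sq M (\<lambda>\<omega>. (\<Prod>i<n. W (b i) \<omega> - W (a i) \<omega>) *\<^sub>R v) < \<infinity>"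
  using assms
proof (induction n arbitrary: a b u)
  case 0
  then show ?case by (simp add: rect_indicator_def l2sq_def emeasure_space_1)
next
  case (Suc n)
  let ?\<eta> = "\<lambda>\<omega>. (\<Prod>i<n. W (b (Suc i)) \<omega> - W (a (Suc i)) \<omega>) *\<^sub>R v"
  let ?r = "rect_indicator n (\<lambda>i. a (Suc i)) (\<lambda>i. b (Suc i)) v"
  \<comment> \<open>The same inner variable serves every upper end from \<open>a 0\<close> on; the
    end \<open>a 0\<close> itself gives its measurability.\<close>
  have IH: "has_iterated_integral M W S n s ?r ?\<eta> \<and> ?\<eta> \<in> borel_measurable (F s) \<and> l2sq M ?\<eta> < \<infinity>" if "a 0 \<le> s" for s
  proof (rule Suc.IH)
    show "S \<le> s" using Suc.prems(2)[of 0] that by simp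
    show "0 < n \<Longrightarrow> b (Suc 0) \<le> s" using Suc.prems(3)[of 0] that by simp
  qed (use Suc.prems in auto)
  then have \<eta>: "?\<eta> \<in> borel_measurable (F (a 0))" "l2sq M ?\<eta> < \<infinity>" by blast+
  have ord: "S \<le> a 0" "a 0 \<le> b 0" "b 0 \<le> u" using Suc.prems(2)[of 0] Suc.prems(4) by auto
  let ?Y = "\<lambda>s \<omega>. indicat_real {a 0<..b 0} s *\<^sub>R ?\<eta> \<omega>"
  have ito: "has_ito_integral M W S u ?Y (\<lambda>\<omega>. (W (b 0) \<omega> - W (a 0) \<omega>) *\<^sub>R ?\<eta> \<omega>)"
    by (rule has_ito_integral_piece[OF ord \<eta>])
  have "AE s in time_interval S u. has_iterated_integral M W S n s (\<lambda>r. rect_indicator (Suc n) a b v (case_nat s r)) (?Y s)"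
    using AE_space
  proof eventually_elim
    case (elim s)
    show ?case
    proof (cases "s \<in> {a 0<..b 0}")
      case True
      then have "(\<lambda>r. rect_indicator (Suc n) a b v (case_nat s r)) = ?r" "?Y s = ?\<eta>"
        by (auto simp: rect_indicator_def All_less_Suc2 fun_eq_iff)
      moreover have "has_iterated_integral M W S n s ?r ?\<eta>" using IH[of s] True by simp
      ultimately show ?thesis by (simp only:)
    next
      case False
      then have "(\<lambda>r. rect_indicator (Suc n) a b v (case_nat s r)) = (\<lambda>_. 0)" "?Y s = (\<lambda>_. 0)"
        by (auto simp: rect_indicator_def All_less_Suc2 fun_eq_iff)
      moreover have "has_iterated_integral M W S n s (\<lambda>_. 0) (\<lambda>_. 0 :: 'b)"
        using elim by (intro has_iterated_integral_zero) simp
      ultimately show ?thesis by (simp only:)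
    qed
  qed
  with ito have 1: "has_iterated_integral M W S (Suc n) u (rect_indicator (Suc n) a b v) (\<lambda>\<omega>. (W (b 0) \<omega> - W (a 0) \<omega>) *\<^sub>R ?\<eta> \<omega>)"
    unfolding has_iterated_integral.simps(2) by (intro exI[of _ ?Y] conjI)
  have "l2sq M (\<lambda>\<omega>. 0 + (W (b 0) \<omega> - W (a 0) \<omega>) *\<^sub>R ?\<eta> \<omega>) = ennreal ((norm (0::'b))\<^sup>2) + process_sqnorm M S u ?Y"
    by (rule has_ito_integral_isometry[OF ito])
  moreover have "process_sqnorm M S u ?Y < \<infinity>" using has_ito_integralD(1)[OF ito] unfolding L2_adapted_def by blast
  ultimately have 2: "l2sq M (\<lambda>\<omega>. (W (b 0) \<omega> - W (a 0) \<omega>) *\<^sub>R ?\<eta> \<omega>) < \<infinity>" by simp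
  have "a 0 \<le> u" using ord by linarith
  then have 3: "(\<lambda>\<omega>. (W (b 0) \<omega> - W (a 0) \<omega>) *\<^sub>R ?\<eta> \<omega>) \<in> borel_measurable (F u)"
    by (intro borel_measurable_scaleR increment_F ord measurable_F_mono[OF _ \<eta>(1)])
  have "(\<lambda>\<omega>. (\<Prod>i<Suc n. W (b i) \<omega> - W (a i) \<omega>) *\<^sub>R v) = (\<lambda>\<omega>. (W (b 0) \<omega> - W (a 0) \<omega>) *\<^sub>R ?\<eta> \<omega>)"
    by (simp add: prod.lessThan_Suc_shift del: prod.lessThan_Suc)
  with 1 2 3 show ?case by (simp only:)
qed

section \<open>The closed linear space of kernels with a chaos\<close>

definition has_chaos :: "real \<Rightarrow> nat \<Rightarrow> ((nat \<Rightarrow> real) \<Rightarrow> 'b::euclidean_space) \<Rightarrow> bool" where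
  "has_chaos T n f \<longleftrightarrow> f \<in> L2_simplex (Suc n) S T \<and> (\<exists>\<xi>. is_wiener_chaos M W S T n f \<xi>)"

lemma has_chaos_lincomb:
  fixes f g :: "(nat \<Rightarrow> real) \<Rightarrow> 'b::euclidean_space"
  shows "has_chaos T n f \<Longrightarrow> has_chaos T n g \<Longrightarrow> has_chaos T n (\<lambda>x. c *\<^sub>R f x + d *\<^sub>R g x)"
  unfolding has_chaos_def using is_wiener_chaos_lincomb L2_simplex_lincomb by blast

lemma has_chaos_zero: "has_chaos T n (\<lambda>_. 0 :: 'b::euclidean_space)"
  unfolding has_chaos_def using is_wiener_chaos_zero L2_simplex_zero by blast

lemma has_chaos_sum:
  fixes f :: "'i \<Rightarrow> (nat \<Rightarrow> real) \<Rightarrow> 'b::euclidean_space"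
  assumes "finite I" "\<And>i. i \<in> I \<Longrightarrow> has_chaos T n (f i)"
  shows "has_chaos T n (\<lambda>x. \<Sum>i\<in>I. f i x)"
  using assms
proof (induction I)
  case empty show ?case using has_chaos_zero by simp
next
  case (insert i I)
  then have "has_chaos T n (f i)" "has_chaos T n (\<lambda>x. \<Sum>i\<in>I. f i x)" by auto
  from has_chaos_lincomb[OF this, of 1 1] show ?case using insert.hyps by simp
qed

lemma has_chaos_limit:
  fixes f :: "nat \<Rightarrow> (nat \<Rightarrow> real) \<Rightarrow> 'b::euclidean_space"
  assumes "\<And>k. has_chaos T n (f k)" "g \<in> L2_simplex (Suc n) S T"
    "(\<lambda>k. l2sq (simplex_measure (Suc n) S T) (\<lambda>x. f k x - g x)) \<longlonglongrightarrow> 0"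
  shows "has_chaos T n g"
proof -
  have f: "f k \<in> L2_simplex (Suc n) S T" "\<exists>\<xi>. is_wiener_chaos M W S T n (f k) \<xi>" for k
    using assms(1) unfolding has_chaos_def by blast+
  then obtain \<Xi> where "\<And>k. is_wiener_chaos M W S T n (f k) (\<Xi> k)" by metis
  from is_wiener_chaos_limit[OF f(1) assms(2,3) this] assms(2) show ?thesis unfolding has_chaos_def by blast
qed

text \<open>Values off the simplex do not enter the norms, so the constant sequence \<open>f\<close>
  converges to \<open>g\<close>.\<close>

lemma has_chaos_cong:
  fixes f g :: "(nat \<Rightarrow> real) \<Rightarrow> 'b::euclidean_space"
  assumes f: "has_chaos T n f" and eq: "\<And>x. x \<in> ord_simplex (Suc n) S T \<Longrightarrow> f x = g x"
  shows "has_chaos T n g"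
proof -
  have fm: "f \<in> L2_simplex (Suc n) S T" using f unfolding has_chaos_def by blast
  have gm: "g \<in> borel_measurable (simplex_measure (Suc n) S T)"
    using L2_simplexD(1)[OF fm] eq measurable_cong[of "simplex_measure (Suc n) S T" f g borel] by simp
  have "l2sq (simplex_measure (Suc n) S T) f = l2sq (simplex_measure (Suc n) S T) g"
    by (rule l2sq_cong) (simp add: eq)
  then have g: "g \<in> L2_simplex (Suc n) S T" using L2_simplexD(2)[OF fm] by (intro L2_simplexI[OF gm]) (simp only:)
  have "l2sq (simplex_measure (Suc n) S T) (\<lambda>x. f x - g x) = l2sq (simplex_measure (Suc n) S T) (\<lambda>x. 0 :: 'b)"
    by (rule l2sq_cong) (simp add: eq)
  then show ?thesis by (intro has_chaos_limit[OF f g]) simp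
qed

lemma indicator_L2_simplex:
  fixes v :: "'b::euclidean_space"
  assumes "A \<in> sets (simplex_measure n S T)"
  shows "(\<lambda>x. indicat_real A x *\<^sub>R v) \<in> L2_simplex n S T"
proof (rule L2_simplexI)
  show "(\<lambda>x. indicat_real A x *\<^sub>R v) \<in> borel_measurable (simplex_measure n S T)"
    by (intro borel_measurable_scaleR borel_measurable_const borel_measurable_indicator assms)
  have "l2sq (simplex_measure n S T) (\<lambda>x. indicat_real A x *\<^sub>R v) \<le> (\<integral>\<^sup>+x. ennreal ((norm v)\<^sup>2) \<partial>simplex_measure n S T)"
    unfolding l2sq_def by (intro nn_integral_mono) (simp add: indicator_def)
  also have "\<dots> < \<infinity>" using emeasure_simplex_finite[of n S T] by (simp add: ennreal_mult_less_top)
  finally show "l2sq (simplex_measure n S T) (\<lambda>x. indicat_real A x *\<^sub>R v) < \<infinity>" .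
qed

text \<open>The union step of the Dynkin argument below: partial sums of the indicators converge in
  L2 by dominated convergence, since the simplex has finite measure.\<close>

lemma has_chaos_disjoint_UN:
  fixes v :: "'b::euclidean_space" and A :: "nat \<Rightarrow> _"
  assumes disj: "disjoint_family A" and A: "\<And>i. A i \<in> sets (simplex_measure (Suc n) S T)"
    and ch: "\<And>i. has_chaos T n (\<lambda>x. indicat_real (A i) x *\<^sub>R v)"
  shows "has_chaos T n (\<lambda>x. indicat_real (\<Union>i. A i) x *\<^sub>R v)"
proof (rule has_chaos_limit[of T n "\<lambda>k x. \<Sum>i<k. indicat_real (A i) x *\<^sub>R v"])
  let ?N = "simplex_measure (Suc n) S T"
  let ?B = "\<Union>i. A i"
  show B: "(\<lambda>x. indicat_real ?B x *\<^sub>R v) \<in> L2_simplex (Suc n) S T"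
    using A by (intro indicator_L2_simplex sets.countable_UN) auto
  show "has_chaos T n (\<lambda>x. \<Sum>i<k. indicat_real (A i) x *\<^sub>R v)" for k by (intro has_chaos_sum ch) simp
  have ps: "(\<Sum>i<k. indicat_real (A i) x *\<^sub>R v) = indicat_real (\<Union>i<k. A i) x *\<^sub>R v" for k x
  proof -
    have "(\<Sum>i<k. indicat_real (A i) x) = indicat_real (\<Union>i<k. A i) x"
      by (rule indicator_UN_disjoint[symmetric]) (auto intro: disjoint_family_on_mono[OF _ disj])
    then show ?thesis by (simp only: scaleR_sum_left[symmetric])
  qed
  have "(\<lambda>k. \<integral>\<^sup>+x. ennreal ((norm ((\<Sum>i<k. indicat_real (A i) x *\<^sub>R v) - indicat_real ?B x *\<^sub>R v))\<^sup>2) \<partial>?N) \<longlonglongrightarrow> (\<integral>\<^sup>+x. 0 \<partial>?N)"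
    unfolding ps
  proof (rule nn_integral_dominated_convergence[where w="\<lambda>x. ennreal ((norm v)\<^sup>2)"])
    show "(\<lambda>x. ennreal ((norm (indicat_real (\<Union>i<k. A i) x *\<^sub>R v - indicat_real ?B x *\<^sub>R v))\<^sup>2)) \<in> borel_measurable ?N" for k
    proof -
      have "(\<Union>i<k. A i) \<in> sets ?N" "?B \<in> sets ?N" using A by auto
      then show ?thesis by measurable
    qed
    show "(\<integral>\<^sup>+x. ennreal ((norm v)\<^sup>2) \<partial>?N) < \<infinity>"
      using emeasure_simplex_finite[of "Suc n" S T] by (simp add: ennreal_mult_less_top)
    show "AE x in ?N. ennreal ((norm (indicat_real (\<Union>i<k. A i) x *\<^sub>R v - indicat_real ?B x *\<^sub>R v))\<^sup>2) \<le> ennreal ((norm v)\<^sup>2)" for k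
      by (intro AE_I2) (auto simp: indicator_def)
    show "AE x in ?N. (\<lambda>k. ennreal ((norm (indicat_real (\<Union>i<k. A i) x *\<^sub>R v - indicat_real ?B x *\<^sub>R v))\<^sup>2)) \<longlonglongrightarrow> 0"
    proof (intro AE_I2 tendsto_eventually)
      fix x
      show "\<forall>\<^sub>F k in sequentially. ennreal ((norm (indicat_real (\<Union>i<k. A i) x *\<^sub>R v - indicat_real ?B x *\<^sub>R v))\<^sup>2) = 0"
      proof (cases "x \<in> ?B")
        case True
        then obtain i where i: "x \<in> A i" by blast
        have "indicat_real (\<Union>i<k. A i) x = 1" "indicat_real ?B x = 1" if "k \<ge> Suc i" for k
          using i that by (auto simp: indicator_def)
        then show ?thesis by (intro eventually_sequentiallyI[of "Suc i"]) simp
      next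
        case False
        then show ?thesis by (intro always_eventually) (auto simp: indicator_def)
      qed
    qed
  qed simp_all
  then show "(\<lambda>k. l2sq ?N (\<lambda>x. (\<Sum>i<k. indicat_real (A i) x *\<^sub>R v) - indicat_real ?B x *\<^sub>R v)) \<longlonglongrightarrow> 0"
    by (simp add: l2sq_def)
qed

section \<open>From ordered boxes to measurable sets and square-integrable kernels\<close>

definition rect :: "nat \<Rightarrow> real \<Rightarrow> (nat \<Rightarrow> real) \<Rightarrow> (nat \<Rightarrow> real) \<Rightarrow> (nat \<Rightarrow> real) set" where
  "rect n T a b = {x\<in>ord_simplex n S T. \<forall>i<n. a i < x i \<and> x i \<le> b i}"

text \<open>The configuration handled by \<open>has_iterated_integral_rect\<close>: successive sides
  decrease and do not overlap. Empty sides are allowed, which keeps the class closed under cutting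
  by orthants.\<close>

definition ordered_box :: "nat \<Rightarrow> real \<Rightarrow> (nat \<Rightarrow> real) \<Rightarrow> (nat \<Rightarrow> real) \<Rightarrow> bool" where
  "ordered_box n T a b \<longleftrightarrow> (\<forall>i<n. S \<le> a i \<and> a i \<le> b i) \<and> (\<forall>i. Suc i < n \<longrightarrow> b (Suc i) \<le> a i) \<and> b 0 \<le> T"

lemma rect_sets: "rect n T a b \<in> sets (simplex_measure n S T)"
proof -
  have c: "(\<lambda>t. t i) \<in> borel_measurable (lborel_n n)" if "i \<in> {..<n}" for i
    using measurable_component_singleton[OF that, of "\<lambda>_. lborel"] by simp
  have "{x\<in>space (lborel_n n). \<forall>i\<in>{..<n}. a i < x i \<and> x i \<le> b i} \<in> sets (lborel_n n)"
    by (intro sets.sets_Collect_finite_All sets.sets_Collect_conj borel_measurable_less borel_measurable_le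
       borel_measurable_const c) auto
  then have "ord_simplex n S T \<inter> {x\<in>space (lborel_n n). \<forall>i\<in>{..<n}. a i < x i \<and> x i \<le> b i} \<in> sets (lborel_n n)"
    using ord_simplex_sets by blast
  moreover have "rect n T a b = ord_simplex n S T \<inter> {x\<in>space (lborel_n n). \<forall>i\<in>{..<n}. a i < x i \<and> x i \<le> b i}"
    using ord_simplex_subset_space[of n S T] by (auto simp: rect_def)
  ultimately show ?thesis by (auto simp: sets_simplex_measure rect_def)
qed

lemma has_chaos_rect:
  fixes v :: "'b::euclidean_space"
  assumes ST: "S \<le> T" and box: "ordered_box (Suc n) T a b"
  shows "has_chaos T n (\<lambda>x. indicat_real (rect (Suc n) T a b) x *\<^sub>R v)"
proof (rule has_chaos_cong)
  have "has_iterated_integral M W S (Suc n) T (rect_indicator (Suc n) a b v) (\<lambda>\<omega>. (\<Prod>i<Suc n. W (b i) \<omega> - W (a i) \<omega>) *\<^sub>R v)"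
    using has_iterated_integral_rect[of T "Suc n" a b v] ST box unfolding ordered_box_def by blast
  then obtain \<xi> where \<xi>: "is_wiener_chaos M W S T n (rect_indicator (Suc n) a b v) \<xi>"
    unfolding has_iterated_integral_Suc_iff by blast
  have eq: "indicat_real (rect (Suc n) T a b) x *\<^sub>R v = rect_indicator (Suc n) a b v x" if "x \<in> ord_simplex (Suc n) S T" for x
    using that by (auto simp: rect_indicator_def rect_def indicator_def)
  show "rect_indicator (Suc n) a b v x = indicat_real (rect (Suc n) T a b) x *\<^sub>R v" if "x \<in> ord_simplex (Suc n) S T" for x
    using eq[OF that] by simp
  have L2: "(\<lambda>x. indicat_real (rect (Suc n) T a b) x *\<^sub>R v) \<in> L2_simplex (Suc n) S T"
    by (rule indicator_L2_simplex[OF rect_sets])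
  have "rect_indicator (Suc n) a b v \<in> borel_measurable (simplex_measure (Suc n) S T)"
    using L2_simplexD(1)[OF L2] eq
      measurable_cong[of "simplex_measure (Suc n) S T" "\<lambda>x. indicat_real (rect (Suc n) T a b) x *\<^sub>R v" "rect_indicator (Suc n) a b v" borel]
    by (simp only: space_simplex_measure)
  moreover have "l2sq (simplex_measure (Suc n) S T) (rect_indicator (Suc n) a b v) < \<infinity>"
    using L2_simplexD(2)[OF L2] l2sq_cong[of "simplex_measure (Suc n) S T", OF eq] by (simp only: space_simplex_measure)
  ultimately show "has_chaos T n (rect_indicator (Suc n) a b v)"
    unfolding has_chaos_def using \<xi> L2_simplexI by blast
qed

text \<open>Dynkin's argument inside a fixed ordered box, where orthants again cut out ordered
  boxes; in the whole simplex they do not, as their sides overlap.\<close>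

lemma has_chaos_Int_rect:
  fixes v :: "'b::euclidean_space"
  assumes ST: "S \<le> T" and box: "ordered_box (Suc n) T a b" and A: "A \<in> sets (lborel_n (Suc n))"
  shows "has_chaos T n (\<lambda>x. indicat_real (A \<inter> rect (Suc n) T a b) x *\<^sub>R v)"
proof -
  let ?R = "rect (Suc n) T a b" and ?\<Omega> = "space (lborel_n (Suc n))"
  let ?G = "range (\<lambda>d. {x\<in>?\<Omega>. \<forall>i<Suc n. x i \<le> d i})"
  have R: "?R \<in> sets (simplex_measure (Suc n) S T)" by (rule rect_sets)
  then have RO: "?R \<subseteq> ?\<Omega>" using sets.sets_into_space by (fastforce simp: sets_simplex_measure)
  have "Int_stable ?G"
  proof (rule Int_stableI)
    fix X Y assume "X \<in> ?G" "Y \<in> ?G"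
    then obtain d e where "X = {x\<in>?\<Omega>. \<forall>i<Suc n. x i \<le> d i}" "Y = {x\<in>?\<Omega>. \<forall>i<Suc n. x i \<le> e i}" by auto
    then have "X \<inter> Y = {x\<in>?\<Omega>. \<forall>i<Suc n. x i \<le> min (d i) (e i)}" by auto
    then show "X \<inter> Y \<in> ?G" by (intro range_eqI)
  qed
  moreover have "?G \<subseteq> Pow ?\<Omega>" by auto
  moreover have "A \<in> sigma_sets ?\<Omega> ?G" using A by (simp only: sets_lborel_n_orthants[symmetric])
  ultimately show ?thesis
  proof (induction rule: sigma_sets_induct_disjoint)
    case (basic X)
    then obtain d where d: "X = {x\<in>?\<Omega>. \<forall>i<Suc n. x i \<le> d i}" by auto
    \<comment> \<open>Taking the maximum with \<open>a i\<close> keeps a side well formed, though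
      empty, when the orthant misses it.\<close>
    have "X \<inter> ?R = rect (Suc n) T a (\<lambda>i. max (a i) (min (b i) (d i)))"
      using ord_simplex_subset_space[of "Suc n" S T] unfolding d rect_def by (auto simp: min_def max_def split: if_splits)
    moreover have "ordered_box (Suc n) T a (\<lambda>i. max (a i) (min (b i) (d i)))"
    proof -
      have "max (a (Suc i)) (min (b (Suc i)) (d (Suc i))) \<le> a i" if "Suc i < Suc n" for i
      proof -
        have "a (Suc i) \<le> b (Suc i)" "b (Suc i) \<le> a i" using box that unfolding ordered_box_def by blast+
        then show ?thesis by simp
      qed
      moreover have "a 0 \<le> b 0" "b 0 \<le> T" using box unfolding ordered_box_def by blast+
      ultimately show ?thesis using box unfolding ordered_box_def by auto
    qed
    ultimately show ?case using has_chaos_rect[OF ST] by (simp only:)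
  next
    case empty then show ?case using has_chaos_zero by simp
  next
    case (compl X)
    have "(\<lambda>x. indicat_real ((?\<Omega> - X) \<inter> ?R) x *\<^sub>R v) = (\<lambda>x. 1 *\<^sub>R (indicat_real ?R x *\<^sub>R v) + (-1) *\<^sub>R (indicat_real (X \<inter> ?R) x *\<^sub>R v))"
      using RO by (auto simp: indicator_def fun_eq_iff)
    then show ?case using has_chaos_lincomb[OF has_chaos_rect[OF ST box] compl(2)] by (simp only:)
  next
    case (union X)
    have "(\<Union>i. X i) \<inter> ?R = (\<Union>i. X i \<inter> ?R)" by blast
    moreover have "has_chaos T n (\<lambda>x. indicat_real (\<Union>i. X i \<inter> ?R) x *\<^sub>R v)"
    proof (rule has_chaos_disjoint_UN)
      show "disjoint_family (\<lambda>i. X i \<inter> ?R)" using union(1) by (auto simp: disjoint_family_on_def)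
      show "X i \<inter> ?R \<in> sets (simplex_measure (Suc n) S T)" for i
        using union(2) R unfolding sets_lborel_n_orthants[symmetric] sets_simplex_measure by auto
    qed (rule union(3))
    ultimately show ?case by (simp only:)
  qed
qed

text \<open>Consecutive coordinates of a point of the simplex are separated by rationals, so
  countably many ordered boxes cover the simplex. Made disjoint, they cut \<open>A\<close> into
  pieces to which \<open>has_chaos_Int_rect\<close> applies.\<close>

lemma has_chaos_indicator:
  fixes v :: "'b::euclidean_space"
  assumes ST: "S \<le> T" and A: "A \<in> sets (simplex_measure (Suc n) S T)"
  shows "has_chaos T n (\<lambda>x. indicat_real A x *\<^sub>R v)"
proof -
  \<comment> \<open>The number \<open>k\<close> codes a list of rationals, the lower ends of the
    sides; each upper end is the preceding lower end, with \<open>T\<close> for the first side.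
    Whatever a code yields, \<open>R\<close> keeps the box only if it is ordered.\<close>
  define lo where "lo k i = real_of_rat ((from_nat k :: rat list) ! i)" for k i :: nat
  define hi where "hi k i = (if i = 0 then T else lo k (i - 1))" for k i :: nat
  define R where "R k = (if ordered_box (Suc n) T (lo k) (hi k) then rect (Suc n) T (lo k) (hi k) else {})" for k
  have Rs: "R k \<in> sets (simplex_measure (Suc n) S T)" for k unfolding R_def using rect_sets by auto
  have cover: "ord_simplex (Suc n) S T \<subseteq> (\<Union>k. R k)"
  proof
    fix x assume x: "x \<in> ord_simplex (Suc n) S T"
    \<comment> \<open>The last rational separates the smallest coordinate \<open>x n\<close> from
      \<open>S\<close>, so that every side starts at or above \<open>S\<close>.\<close>
    have "\<exists>q::rat. (if i = n then S else x (Suc i)) < of_rat q \<and> of_rat q < x i" if "i < Suc n" for i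
      using x that by (intro of_rat_dense) (auto simp: ord_simplex_def)
    then obtain q :: "nat \<Rightarrow> rat" where q: "\<And>i. i < Suc n \<Longrightarrow> (if i = n then S else x (Suc i)) < of_rat (q i) \<and> of_rat (q i) < x i"
      by metis
    define k where "k = to_nat (map q [0..<Suc n])"
    have lo: "lo k i = of_rat (q i)" if "i < Suc n" for i
      using that by (simp add: lo_def k_def del: upt_Suc)
    have xb: "S < x i" "x i < T" if "i < Suc n" for i using x that by (auto simp: ord_simplex_def)
    have Slo: "S \<le> lo k i" if "i < Suc n" for i
      using q[OF that] lo[OF that] xb[of "Suc i"] that by (cases "i = n") auto
    have lohi: "lo k i < x i" "x i \<le> hi k i" if "i < Suc n" for i
    proof -
      show "lo k i < x i" using q[OF that] lo[OF that] by simp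
      show "x i \<le> hi k i"
      proof (cases i)
        case 0 then show ?thesis using xb[OF that] by (simp add: hi_def)
      next
        case (Suc j)
        then have "x (Suc j) < of_rat (q j)" using q[of j] that by auto
        then show ?thesis using lo[of j] that Suc by (simp add: hi_def)
      qed
    qed
    have lh: "lo k i \<le> hi k i" if "i < Suc n" for i
      using lohi[OF that] by linarith
    have "ordered_box (Suc n) T (lo k) (hi k)"
      unfolding ordered_box_def using Slo lh by (auto simp: hi_def[of _ 0] hi_def[of _ "Suc _"])
    moreover have "x \<in> rect (Suc n) T (lo k) (hi k)" using x lohi by (auto simp: rect_def)
    ultimately show "x \<in> (\<Union>k. R k)" by (intro UN_I[of k]) (auto simp: R_def)
  qed
  have AO: "A \<subseteq> ord_simplex (Suc n) S T" using A by (simp add: sets_simplex_measure)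
  then have eq: "A = (\<Union>k. A \<inter> disjointed R k)"
    using cover UN_disjointed_eq[of R] by blast
  have "has_chaos T n (\<lambda>x. indicat_real (\<Union>k. A \<inter> disjointed R k) x *\<^sub>R v)"
  proof (rule has_chaos_disjoint_UN)
    show "disjoint_family (\<lambda>k. A \<inter> disjointed R k)"
      using disjoint_family_disjointed[of R] by (auto simp: disjoint_family_on_def)
    have dj: "A - (\<Union>i\<in>{0..<k}. R i) \<in> sets (simplex_measure (Suc n) S T)" for k
      using A Rs by (intro sets.Diff sets.finite_UN) auto
    have eq: "A \<inter> disjointed R k = (A - (\<Union>i\<in>{0..<k}. R i)) \<inter> R k" for k by (auto simp: disjointed_def)
    show "A \<inter> disjointed R k \<in> sets (simplex_measure (Suc n) S T)" for k
      unfolding eq using dj Rs by blast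
    show "has_chaos T n (\<lambda>x. indicat_real (A \<inter> disjointed R k) x *\<^sub>R v)" for k
    proof (cases "ordered_box (Suc n) T (lo k) (hi k)")
      case True
      have "A - (\<Union>i\<in>{0..<k}. R i) \<in> sets (lborel_n (Suc n))" using dj[of k] by (simp add: sets_simplex_measure)
      from has_chaos_Int_rect[OF ST True this] True show ?thesis unfolding eq by (simp add: R_def)
    next
      case False
      then show ?thesis unfolding eq using has_chaos_zero by (simp add: R_def)
    qed
  qed
  then show ?thesis using eq by (simp only: eq[symmetric])
qed

theorem wiener_chaos_exists:
  fixes f :: "(nat \<Rightarrow> real) \<Rightarrow> 'b::euclidean_space"
  assumes ST: "S \<le> T" and f: "f \<in> L2_simplex (Suc n) S T"
  shows "\<exists>\<xi>. is_wiener_chaos M W S T n f \<xi>"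
proof -
  let ?N = "simplex_measure (Suc n) S T"
  note fm = L2_simplexD(1)[OF f]
  obtain s where s: "\<And>i. simple_function ?N (s i)" "\<And>x. x \<in> space ?N \<Longrightarrow> (\<lambda>i. s i x) \<longlonglongrightarrow> f x"
    "\<And>i x. x \<in> space ?N \<Longrightarrow> dist (s i x) 0 \<le> 2 * dist (f x) 0"
    using borel_measurable_implies_sequence_metric[OF fm, of 0] by blast
  have ch: "has_chaos T n (s i)" for i
  proof (rule has_chaos_cong)
    show "has_chaos T n (\<lambda>x. \<Sum>y\<in>s i ` space ?N. indicat_real (s i -` {y} \<inter> space ?N) x *\<^sub>R y)"
      using s(1)[of i] by (intro has_chaos_sum has_chaos_indicator[OF ST]) (auto simp: simple_function_def)
    show "(\<Sum>y\<in>s i ` space ?N. indicat_real (s i -` {y} \<inter> space ?N) x *\<^sub>R y) = s i x" if "x \<in> ord_simplex (Suc n) S T" for x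
      by (rule simple_function_indicator_representation_banach[OF s(1), symmetric]) (simp only: space_simplex_measure that)
  qed
  have "(\<lambda>k. \<integral>\<^sup>+x. ennreal ((norm (s k x - f x))\<^sup>2) \<partial>?N) \<longlonglongrightarrow> (\<integral>\<^sup>+x. 0 \<partial>?N)"
  \<comment> \<open>The simple functions are bounded by twice the norm of \<open>f\<close>, so the
    error is at most three times that norm; hence the constant 9.\<close>
  proof (rule nn_integral_dominated_convergence[where w="\<lambda>x. ennreal 9 * ennreal ((norm (f x))\<^sup>2)"])
    have sm: "s k \<in> borel_measurable ?N" for k by (rule borel_measurable_simple_function[OF s(1)])
    show "(\<lambda>x. ennreal ((norm (s k x - f x))\<^sup>2)) \<in> borel_measurable ?N" for k
      using sm[of k] fm by measurable
    show "(\<lambda>x. ennreal 9 * ennreal ((norm (f x))\<^sup>2)) \<in> borel_measurable ?N"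
      using fm by measurable
    show "(\<integral>\<^sup>+x. ennreal 9 * ennreal ((norm (f x))\<^sup>2) \<partial>?N) < \<infinity>"
      using L2_simplexD(2)[OF f] fm unfolding l2sq_def
      by (subst nn_integral_cmult) (auto simp: ennreal_mult_less_top)
    show "AE x in ?N. ennreal ((norm (s k x - f x))\<^sup>2) \<le> ennreal 9 * ennreal ((norm (f x))\<^sup>2)" for k
    proof (rule AE_I2)
      fix x assume x: "x \<in> space ?N"
      have "norm (s k x - f x) \<le> norm (s k x) + norm (f x)" by (rule norm_triangle_ineq4)
      also have "\<dots> \<le> 3 * norm (f x)" using s(3)[OF x, of k] by simp
      finally have "(norm (s k x - f x))\<^sup>2 \<le> (3 * norm (f x))\<^sup>2" by (rule power_mono) simp
      then show "ennreal ((norm (s k x - f x))\<^sup>2) \<le> ennreal 9 * ennreal ((norm (f x))\<^sup>2)"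
        by (subst ennreal_mult[symmetric]) (auto simp: power_mult_distrib intro!: ennreal_leI)
    qed
    show "AE x in ?N. (\<lambda>k. ennreal ((norm (s k x - f x))\<^sup>2)) \<longlonglongrightarrow> 0"
    proof (rule AE_I2)
      fix x assume x: "x \<in> space ?N"
      have "(\<lambda>k. ennreal ((norm (s k x - f x))\<^sup>2)) \<longlonglongrightarrow> ennreal ((norm (f x - f x))\<^sup>2)"
        by (intro tendsto_ennrealI tendsto_intros s(2)[OF x])
      then show "(\<lambda>k. ennreal ((norm (s k x - f x))\<^sup>2)) \<longlonglongrightarrow> 0" by simp
    qed
  qed simp
  then have "has_chaos T n f"
    by (intro has_chaos_limit[OF ch f]) (simp add: l2sq_def)
  then show ?thesis unfolding has_chaos_def by blast
qed

section \<open>Chaos expansions\<close>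

lemma sum_process_L2_adapted:
  fixes \<Xi> :: "nat \<Rightarrow> real \<Rightarrow> 'w \<Rightarrow> 'b::euclidean_space"
  assumes "\<And>n. n < N \<Longrightarrow> \<Xi> n \<in> L2_adapted M W S T"
  shows "(\<lambda>t \<omega>. \<Sum>n<N. \<Xi> n t \<omega>) \<in> L2_adapted M W S T"
  using assms
proof (induction N)
  case 0 show ?case using is_wiener_chaosD(1)[OF is_wiener_chaos_zero] by simp
next
  case (Suc N)
  then have "(\<lambda>t \<omega>. \<Sum>n<N. \<Xi> n t \<omega>) \<in> L2_adapted M W S T" "\<Xi> N \<in> L2_adapted M W S T" by auto
  from L2_adapted_lincomb[OF this, of 1 1] show ?case by simp
qed

lemma L2_adapted_diff:
  fixes \<xi> \<zeta> :: "real \<Rightarrow> 'w \<Rightarrow> 'b::euclidean_space"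
  assumes "\<xi> \<in> L2_adapted M W S T" "\<zeta> \<in> L2_adapted M W S T"
  shows "(\<lambda>t \<omega>. \<xi> t \<omega> - \<zeta> t \<omega>) \<in> L2_adapted M W S T"
  using L2_adapted_lincomb[OF assms, of 1 "-1"] by simp

lemma process_sqnorm_minus_commute:
  "process_sqnorm M S T (\<lambda>t \<omega>. \<xi> t \<omega> - \<zeta> t \<omega> :: 'b::euclidean_space) = process_sqnorm M S T (\<lambda>t \<omega>. \<zeta> t \<omega> - \<xi> t \<omega>)"
  unfolding process_sqnorm_def by (simp add: norm_minus_commute)

lemma process_sqnorm_diff_triangle:
  fixes \<xi> \<zeta> \<theta> :: "real \<Rightarrow> 'w \<Rightarrow> 'b::euclidean_space"
  assumes "\<xi> \<in> L2_adapted M W S T" "\<zeta> \<in> L2_adapted M W S T" "\<theta> \<in> L2_adapted M W S T"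
  shows "process_sqnorm M S T (\<lambda>t \<omega>. \<xi> t \<omega> - \<theta> t \<omega>) \<le>
    2 * process_sqnorm M S T (\<lambda>t \<omega>. \<xi> t \<omega> - \<zeta> t \<omega>) + 2 * process_sqnorm M S T (\<lambda>t \<omega>. \<zeta> t \<omega> - \<theta> t \<omega>)"
proof -
  note m = L2_adapted_measurable[OF assms(1)] L2_adapted_measurable[OF assms(2)] L2_adapted_measurable[OF assms(3)]
  show ?thesis
    unfolding process_sqnorm_diff_eq[OF m(1,2)] process_sqnorm_diff_eq[OF m(2,3)] process_sqnorm_diff_eq[OF m(1,3)]
    by (rule l2sq_diff_triangle[OF m])
qed

lemma process_sqnorm_limit:
  fixes \<Xi> :: "nat \<Rightarrow> real \<Rightarrow> 'w \<Rightarrow> 'b::euclidean_space"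
  assumes "\<And>k. \<Xi> k \<in> L2_adapted M W S T" "\<xi> \<in> L2_adapted M W S T"
    and lim: "(\<lambda>k. process_sqnorm M S T (\<lambda>t \<omega>. \<Xi> k t \<omega> - \<xi> t \<omega>)) \<longlonglongrightarrow> 0"
    and c: "(\<lambda>k. process_sqnorm M S T (\<Xi> k)) \<longlonglongrightarrow> c"
  shows "process_sqnorm M S T \<xi> = c"
proof -
  note m = L2_adapted_measurable[OF assms(1)] and m' = L2_adapted_measurable[OF assms(2)]
  show ?thesis
    using lim c unfolding process_sqnorm_diff_eq[OF m m'] process_sqnorm_eq_l2sq[OF m] process_sqnorm_eq_l2sq[OF m']
    by (rule l2sq_limit[OF m m'])
qed

text \<open>The isometry for finite sums passes to the limit. The case
  \<open>\<zeta> = \<xi>\<close> gives uniqueness of the coefficients, and the case of equal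
  coefficients gives uniqueness of the process.\<close>

lemma has_chaos_expansion_diff:
  fixes \<xi> \<zeta> :: "real \<Rightarrow> 'w \<Rightarrow> 'b::euclidean_space"
  assumes m: "\<xi> \<in> L2_adapted M W S T" "\<zeta> \<in> L2_adapted M W S T"
    and e1: "has_chaos_expansion M W S T \<xi> f" and e2: "has_chaos_expansion M W S T \<zeta> g"
  shows "has_chaos_expansion M W S T (\<lambda>t \<omega>. \<xi> t \<omega> - \<zeta> t \<omega>) (\<lambda>n x. f n x - g n x)"
    and "process_sqnorm M S T (\<lambda>t \<omega>. \<xi> t \<omega> - \<zeta> t \<omega>) = (\<Sum>n. l2sq (simplex_measure (Suc n) S T) (\<lambda>x. f n x - g n x))"
proof -
  from e1 obtain \<Xi> where f: "\<And>n. f n \<in> L2_simplex (Suc n) S T" and \<Xi>: "\<And>n. is_wiener_chaos M W S T n (f n) (\<Xi> n)"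
    and l1: "(\<lambda>N. process_sqnorm M S T (\<lambda>t \<omega>. \<xi> t \<omega> - (\<Sum>n<N. \<Xi> n t \<omega>))) \<longlonglongrightarrow> 0"
    unfolding has_chaos_expansion_def by blast
  from e2 obtain Z where g: "\<And>n. g n \<in> L2_simplex (Suc n) S T" and Z: "\<And>n. is_wiener_chaos M W S T n (g n) (Z n)"
    and l2: "(\<lambda>N. process_sqnorm M S T (\<lambda>t \<omega>. \<zeta> t \<omega> - (\<Sum>n<N. Z n t \<omega>))) \<longlonglongrightarrow> 0"
    unfolding has_chaos_expansion_def by blast
  note ch = is_wiener_chaos_diff[OF \<Xi> Z]
  have fg: "(\<lambda>x. f n x - g n x) \<in> L2_simplex (Suc n) S T" for n
    using L2_simplex_lincomb[OF f g, of 1 _ "-1"] by simp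
  have sumL: "(\<lambda>t \<omega>. \<Sum>n<N. \<Xi> n t \<omega>) \<in> L2_adapted M W S T" "(\<lambda>t \<omega>. \<Sum>n<N. Z n t \<omega>) \<in> L2_adapted M W S T"
    "(\<lambda>t \<omega>. \<Sum>n<N. \<Xi> n t \<omega> - Z n t \<omega>) \<in> L2_adapted M W S T" for N
    by (intro sum_process_L2_adapted is_wiener_chaosD(1)[OF \<Xi>] is_wiener_chaosD(1)[OF Z] is_wiener_chaosD(1)[OF ch])+
  have lim: "(\<lambda>N. process_sqnorm M S T (\<lambda>t \<omega>. (\<xi> t \<omega> - \<zeta> t \<omega>) - (\<Sum>n<N. \<Xi> n t \<omega> - Z n t \<omega>))) \<longlonglongrightarrow> 0"
  proof (rule ennreal_tendsto_0_le)
    show "(\<lambda>N. ennreal 2 * process_sqnorm M S T (\<lambda>t \<omega>. \<xi> t \<omega> - (\<Sum>n<N. \<Xi> n t \<omega>))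
       + ennreal 2 * process_sqnorm M S T (\<lambda>t \<omega>. \<zeta> t \<omega> - (\<Sum>n<N. Z n t \<omega>))) \<longlonglongrightarrow> 0"
      by (intro ennreal_add_tendsto_0 ennreal_cmult_tendsto_0 l1 l2)
    fix N
    have "process_sqnorm M S T (\<lambda>t \<omega>. (\<xi> t \<omega> - (\<Sum>n<N. \<Xi> n t \<omega>)) - (\<zeta> t \<omega> - (\<Sum>n<N. Z n t \<omega>)))
      \<le> 2 * process_sqnorm M S T (\<lambda>t \<omega>. (\<xi> t \<omega> - (\<Sum>n<N. \<Xi> n t \<omega>)) - 0)
       + 2 * process_sqnorm M S T (\<lambda>t \<omega>. 0 - (\<zeta> t \<omega> - (\<Sum>n<N. Z n t \<omega>)))"
      by (intro process_sqnorm_diff_triangle L2_adapted_diff m sumL is_wiener_chaosD(1)[OF is_wiener_chaos_zero])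
    then show "process_sqnorm M S T (\<lambda>t \<omega>. (\<xi> t \<omega> - \<zeta> t \<omega>) - (\<Sum>n<N. \<Xi> n t \<omega> - Z n t \<omega>))
      \<le> ennreal 2 * process_sqnorm M S T (\<lambda>t \<omega>. \<xi> t \<omega> - (\<Sum>n<N. \<Xi> n t \<omega>))
       + ennreal 2 * process_sqnorm M S T (\<lambda>t \<omega>. \<zeta> t \<omega> - (\<Sum>n<N. Z n t \<omega>))"
      using process_sqnorm_minus_commute[of T "\<lambda>t \<omega>. 0" "\<lambda>t \<omega>. \<zeta> t \<omega> - (\<Sum>n<N. Z n t \<omega>)"]
      by (simp add: sum_subtractf algebra_simps)
  qed
  show "has_chaos_expansion M W S T (\<lambda>t \<omega>. \<xi> t \<omega> - \<zeta> t \<omega>) (\<lambda>n x. f n x - g n x)"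
    unfolding has_chaos_expansion_def
    by (intro conjI allI exI[of _ "\<lambda>n t \<omega>. \<Xi> n t \<omega> - Z n t \<omega>"] fg ch lim)
  show "process_sqnorm M S T (\<lambda>t \<omega>. \<xi> t \<omega> - \<zeta> t \<omega>) = (\<Sum>n. l2sq (simplex_measure (Suc n) S T) (\<lambda>x. f n x - g n x))"
  proof (rule process_sqnorm_limit[OF sumL(3) L2_adapted_diff[OF m]])
    show "(\<lambda>N. process_sqnorm M S T (\<lambda>t \<omega>. (\<Sum>n<N. \<Xi> n t \<omega> - Z n t \<omega>) - (\<xi> t \<omega> - \<zeta> t \<omega>))) \<longlonglongrightarrow> 0"
      using lim by (simp only: process_sqnorm_minus_commute[of T "\<lambda>t \<omega>. \<xi> t \<omega> - \<zeta> t \<omega>"])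
    show "(\<lambda>N. process_sqnorm M S T (\<lambda>t \<omega>. \<Sum>n<N. \<Xi> n t \<omega> - Z n t \<omega>))
       \<longlonglongrightarrow> (\<Sum>n. l2sq (simplex_measure (Suc n) S T) (\<lambda>x. f n x - g n x))"
      unfolding wiener_chaos_isometry_sum[OF fg ch] by (rule summable_LIMSEQ) simp
  qed
qed

lemma has_chaos_expansion_unique:
  fixes \<xi> :: "real \<Rightarrow> 'w \<Rightarrow> 'b::euclidean_space"
  assumes m: "\<xi> \<in> L2_adapted M W S T"
    and e: "has_chaos_expansion M W S T \<xi> f" "has_chaos_expansion M W S T \<xi> g"
  shows "AE x in simplex_measure (Suc n) S T. f n x = g n x"
proof -
  have "(\<Sum>n. l2sq (simplex_measure (Suc n) S T) (\<lambda>x. f n x - g n x)) = 0"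
    using has_chaos_expansion_diff(2)[OF m m e] by (simp add: process_sqnorm_def)
  then have 0: "l2sq (simplex_measure (Suc n) S T) (\<lambda>x. f n x - g n x) = 0"
    using sum_le_suminf[of "\<lambda>n. l2sq (simplex_measure (Suc n) S T) (\<lambda>x. f n x - g n x)" "{n}"] by simp
  have "f n \<in> L2_simplex (Suc n) S T" "g n \<in> L2_simplex (Suc n) S T"
    using e unfolding has_chaos_expansion_def by blast+
  then have "(\<lambda>x. f n x - g n x) \<in> borel_measurable (simplex_measure (Suc n) S T)"
    by (intro borel_measurable_diff L2_simplexD(1))
  from iffD1[OF l2sq_eq_0_iff[OF this] 0] show ?thesis by eventually_elim simp
qed

lemma has_chaos_expansion_process_eq:
  fixes \<xi> \<zeta> :: "real \<Rightarrow> 'w \<Rightarrow> 'b::euclidean_space"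
  assumes m: "\<xi> \<in> L2_adapted M W S T" "\<zeta> \<in> L2_adapted M W S T"
    and e: "has_chaos_expansion M W S T \<xi> f" "has_chaos_expansion M W S T \<zeta> g"
    and eq: "\<And>n. AE x in simplex_measure (Suc n) S T. f n x = g n x"
  shows "process_eq M S T \<xi> \<zeta>"
proof -
  have "l2sq (simplex_measure (Suc n) S T) (\<lambda>x. f n x - g n x) = 0" for n
  proof -
    have "l2sq (simplex_measure (Suc n) S T) (\<lambda>x. f n x - g n x) = l2sq (simplex_measure (Suc n) S T) (\<lambda>x. 0 :: 'b)"
      by (rule l2sq_cong_AE, use eq[of n] in eventually_elim) simp
    then show ?thesis by simp
  qed
  then have "process_sqnorm M S T (\<lambda>t \<omega>. \<xi> t \<omega> - \<zeta> t \<omega>) = 0"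
    using has_chaos_expansion_diff(2)[OF m e] by simp
  note m' = L2_adapted_measurable[OF m(1)] L2_adapted_measurable[OF m(2)]
  have "AE x in time_interval S T \<Otimes>\<^sub>M M. (case x of (t, \<omega>) \<Rightarrow> \<xi> t \<omega>) - (case x of (t, \<omega>) \<Rightarrow> \<zeta> t \<omega>) = 0"
    using \<open>process_sqnorm M S T (\<lambda>t \<omega>. \<xi> t \<omega> - \<zeta> t \<omega>) = 0\<close>
    unfolding process_sqnorm_diff_eq[OF m'] by (rule iffD1[OF l2sq_eq_0_iff[OF borel_measurable_diff[OF m']]])
  then show ?thesis unfolding process_eq_def by eventually_elim (simp add: case_prod_beta')
qed

text \<open>Riesz-Fischer argument: by the isometry, differences of partial sums are controlled by
  tails of the convergent series of squared coefficient norms.\<close>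

lemma has_chaos_expansion_exists:
  fixes f :: "nat \<Rightarrow> (nat \<Rightarrow> real) \<Rightarrow> 'b::euclidean_space"
  assumes ST: "S \<le> T" and f: "\<And>n. f n \<in> L2_simplex (Suc n) S T"
    and sum: "(\<Sum>n. l2sq (simplex_measure (Suc n) S T) (f n)) < \<infinity>"
  shows "\<exists>\<xi>\<in>L2_adapted M W S T. has_chaos_expansion M W S T \<xi> f"
proof -
  let ?l = "\<lambda>n. l2sq (simplex_measure (Suc n) S T) (f n)"
  obtain \<Xi> where \<Xi>: "\<And>n. is_wiener_chaos M W S T n (f n) (\<Xi> n)"
    using wiener_chaos_exists[OF ST f] by metis
  define Q where "Q N t \<omega> = (\<Sum>n<N. \<Xi> n t \<omega>)" for N t \<omega>
  have Q: "Q N \<in> L2_adapted M W S T" for N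
    unfolding Q_def by (intro sum_process_L2_adapted is_wiener_chaosD(1)[OF \<Xi>])
  have gap: "process_sqnorm M S T (\<lambda>t \<omega>. Q N t \<omega> - Q m t \<omega>) \<le> (\<Sum>n. ?l (n + k))" if "k \<le> m" "m \<le> N" for k m N
  proof -
    \<comment> \<open>Orders below \<open>m\<close> are replaced by 0, as the isometry is stated for
      sums that start at order 0.\<close>
    let ?f = "\<lambda>n. if m \<le> n then f n else (\<lambda>_. 0)" and ?X = "\<lambda>n. if m \<le> n then \<Xi> n else (\<lambda>_ _. 0)"
    have "Q N t \<omega> - Q m t \<omega> = (\<Sum>n<N. ?X n t \<omega>)" for t \<omega>
    proof -
      have "{..<N} = {..<m} \<union> {m..<N}" using that by auto
      then have "Q N t \<omega> - Q m t \<omega> = (\<Sum>n\<in>{m..<N}. \<Xi> n t \<omega>)"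
        unfolding Q_def by (simp add: sum.union_disjoint[of "{..<m}" "{m..<N}"] disjoint_iff)
      also have "\<dots> = (\<Sum>n<N. ?X n t \<omega>)"
        by (rule sum.mono_neutral_cong_left) auto
      finally show ?thesis .
    qed
    then have "process_sqnorm M S T (\<lambda>t \<omega>. Q N t \<omega> - Q m t \<omega>) = process_sqnorm M S T (\<lambda>t \<omega>. \<Sum>n<N. ?X n t \<omega>)"
      by (simp only:)
    also have "\<dots> = (\<Sum>n<N. l2sq (simplex_measure (Suc n) S T) (?f n))"
      by (rule wiener_chaos_isometry_sum) (simp_all add: f \<Xi> L2_simplex_zero is_wiener_chaos_zero)
    also have "\<dots> = (\<Sum>n\<in>{m..<N}. ?l n)"
      by (rule sum.mono_neutral_cong_right) auto
    also have "\<dots> \<le> (\<Sum>n\<in>{k..<N}. ?l n)" using that by (intro sum_mono2) auto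
    also have "\<dots> = (\<Sum>n<N - k. ?l (n + k))"
      by (rule sum.reindex_bij_witness[of _ "\<lambda>n. n + k" "\<lambda>n. n - k"]) auto
    also have "\<dots> \<le> (\<Sum>n. ?l (n + k))" by (rule sum_le_suminf) auto
    finally show ?thesis .
  qed
  have cauchy: "\<exists>k. \<forall>m\<ge>k. \<forall>N\<ge>k. process_sqnorm M S T (\<lambda>t \<omega>. Q m t \<omega> - Q N t \<omega>) < ennreal e" if e: "e > 0" for e :: real
  proof -
    obtain k where k: "(\<Sum>n. ?l (n + k)) < ennreal e"
      using order_tendstoD(2)[OF ennreal_suminf_tail_tendsto_0[OF sum], of "ennreal e"] e
      by (auto simp: eventually_sequentially)
    have "process_sqnorm M S T (\<lambda>t \<omega>. Q m t \<omega> - Q N t \<omega>) < ennreal e" if "k \<le> m" "k \<le> N" for m N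
    proof (cases "m \<le> N")
      case True
      have "process_sqnorm M S T (\<lambda>t \<omega>. Q m t \<omega> - Q N t \<omega>) = process_sqnorm M S T (\<lambda>t \<omega>. Q N t \<omega> - Q m t \<omega>)"
        by (rule process_sqnorm_minus_commute)
      also have "\<dots> \<le> (\<Sum>n. ?l (n + k))" by (rule gap[OF that(1) True])
      finally show ?thesis using k by (rule order.strict_trans1)
    next
      case False
      then show ?thesis using gap[of k N m] that k by (auto elim: order.strict_trans1)
    qed
    then show ?thesis by blast
  qed
  obtain \<xi> where \<xi>: "\<xi> \<in> L2_adapted M W S T" "(\<lambda>k. process_sqnorm M S T (\<lambda>t \<omega>. Q k t \<omega> - \<xi> t \<omega>)) \<longlonglongrightarrow> 0"
    using L2_adapted_complete[OF Q cauchy] by blast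
  have "(\<lambda>N. process_sqnorm M S T (\<lambda>t \<omega>. \<xi> t \<omega> - (\<Sum>n<N. \<Xi> n t \<omega>))) \<longlonglongrightarrow> 0"
    using \<xi>(2) unfolding process_sqnorm_minus_commute[of T \<xi>] Q_def .
  with f \<Xi> \<xi>(1) show ?thesis unfolding has_chaos_expansion_def by blast
qed

lemma has_chaos_expansion_chaos_coeff:
  "has_chaos_expansion M W S T \<xi> f \<Longrightarrow> has_chaos_expansion M W S T \<xi> (chaos_coeff M W S T \<xi>)"
  unfolding chaos_coeff_def by (rule someI[where P="has_chaos_expansion M W S T \<xi>"])

end

section \<open>Inverting sequences of kernels\<close>

lemma op_norm_nonneg [simp]: "0 \<le> op_norm A"
  unfolding op_norm_def by (rule onorm_pos_le[OF matrix_vector_mul_bounded_linear])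

lemma op_norm_mult_le: "op_norm (A ** B) \<le> op_norm A * op_norm B"
proof -
  have "op_norm (A ** B) = onorm ((*v) A \<circ> (*v) B)"
    unfolding op_norm_def o_def matrix_vector_mul_assoc ..
  also have "\<dots> \<le> op_norm A * op_norm B"
    unfolding op_norm_def by (intro onorm_compose matrix_vector_mul_bounded_linear)
  finally show ?thesis .
qed

lemma op_norm_add_le: "op_norm (A + B) \<le> op_norm A + op_norm B"
  unfolding op_norm_def matrix_vector_mult_add_rdistrib
  by (intro onorm_triangle matrix_vector_mul_bounded_linear)

lemma op_norm_minus: "op_norm (- A) = op_norm A"
proof -
  have "(*v) (- A) = (\<lambda>x. - (A *v x))"
    using matrix_vector_mult_diff_rdistrib[of 0 A] by (intro ext) simp
  then show ?thesis unfolding op_norm_def by (simp add: onorm_neg)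
qed

lemma op_norm_diff_le: "op_norm (A - B) \<le> op_norm A + op_norm B"
  using op_norm_add_le[of A "- B"] by (simp add: op_norm_minus)

lemma op_norm_zero [simp]: "op_norm (0 :: real^'d^'d) = 0"
proof -
  have "(*v) (0 :: real^'d^'d) = (\<lambda>x. 0)" by (intro ext) simp
  then show ?thesis unfolding op_norm_def by (simp only: onorm_zero)
qed

lemma op_norm_sum_le: "op_norm (\<Sum>i\<in>I. f i) \<le> (\<Sum>i\<in>I. op_norm (f i))"
proof (induction I rule: infinite_finite_induct)
  case (insert i I)
  then show ?case using op_norm_add_le[of "f i" "\<Sum>i\<in>I. f i"] by simp
qed simp_all

lemma op_norm_mat_1: "op_norm (mat 1 :: real^'d^'d) \<le> 1"
proof -
  have "(*v) (mat 1 :: real^'d^'d) = (\<lambda>x. x)" by (intro ext) simp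
  then show ?thesis unfolding op_norm_def by (simp only: onorm_id_le)
qed

lemma norm_le_op_norm: "norm (A :: real^'d^'d) \<le> (real CARD('d))\<^sup>2 * op_norm A"
proof -
  have "norm A \<le> (\<Sum>i\<in>UNIV. norm (A $ i))" by (simp add: norm_vec_def L2_set_le_sum)
  also have "\<dots> \<le> (\<Sum>i\<in>(UNIV::'d set). \<Sum>j\<in>(UNIV::'d set). \<bar>A $ i $ j\<bar>)"
    by (intro sum_mono norm_le_l1_cart)
  also have "\<dots> \<le> (\<Sum>i\<in>(UNIV::'d set). \<Sum>j\<in>(UNIV::'d set). op_norm A)"
    unfolding op_norm_def by (intro sum_mono matrix_component_le_onorm)
  also have "\<dots> = (real CARD('d))\<^sup>2 * op_norm A" by (simp add: power2_eq_square)
  finally show ?thesis .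
qed

lemma op_norm_le_norm: "op_norm (A :: real^'d^'d) \<le> (real CARD('d))\<^sup>2 * norm A"
proof -
  have "\<bar>A $ i $ j\<bar> \<le> norm A" for i j
    using component_le_norm_cart[of "A $ i" j] Finite_Cartesian_Product.norm_nth_le[of A i] by simp
  from onorm_le_matrix_component[of A, OF this] show ?thesis
    by (simp add: op_norm_def power2_eq_square)
qed

text \<open>Lipschitz with respect to the Frobenius norm, by the triangle inequality in both
  directions. Continuity serves to make operator norms of kernels measurable.\<close>

lemma continuous_on_op_norm: "continuous_on UNIV (op_norm :: real^'d^'d \<Rightarrow> real)"
proof (rule continuous_onI)
  fix A :: "real^'d^'d" and e :: real assume e: "e > 0"
  let ?D = "(real CARD('d))\<^sup>2"
  have D: "?D > 0" by simp
  have diff: "\<bar>op_norm B - op_norm A\<bar> \<le> ?D * norm (B - A)" for B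
    using op_norm_add_le[of "B - A" A] op_norm_add_le[of "A - B" B] op_norm_minus[of "A - B"] op_norm_le_norm[of "B - A"]
    by simp
  show "\<exists>d>0. \<forall>B\<in>UNIV. dist B A < d \<longrightarrow> dist (op_norm B) (op_norm A) \<le> e"
  proof (intro exI[of _ "e / ?D"] conjI ballI impI)
    fix B assume "dist B A < e / ?D"
    then have "?D * norm (B - A) \<le> e" using D by (simp add: dist_norm field_simps)
    with diff[of B] show "dist (op_norm B) (op_norm A) \<le> e" by (simp add: dist_real_def)
  qed (use e D in simp)
qed

lemma borel_measurable_op_norm:
  fixes f :: "'a \<Rightarrow> real^'d^'d"
  assumes "f \<in> borel_measurable N"
  shows "(\<lambda>x. op_norm (f x)) \<in> borel_measurable N"
  by (rule measurable_compose[OF assms borel_measurable_continuous_onI[OF continuous_on_op_norm]])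

lemma matrix_add_rdistrib:
  fixes A B C :: "real^'d^'d"
  shows "(A + B) ** C = A ** C + B ** C"
  by (simp add: matrix_matrix_mult_def vec_eq_iff sum.distrib distrib_right)

lemma bounded_bilinear_matrix_mult: "bounded_bilinear ((**) :: real^'d^'d \<Rightarrow> real^'d^'d \<Rightarrow> real^'d^'d)"
  unfolding bilinear_conv_bounded_bilinear[symmetric] bilinear_def
  by (auto intro!: linearI simp: matrix_add_ldistrib matrix_add_rdistrib scalar_matrix_assoc matrix_scalar_ac)

lemma borel_measurable_matrix_mult:
  fixes f g :: "'a \<Rightarrow> real^'d^'d"
  assumes "f \<in> borel_measurable N" "g \<in> borel_measurable N"
  shows "(\<lambda>x. f x ** g x) \<in> borel_measurable N"
  by (rule borel_measurable_continuous_Pair[OF assms])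
    (intro bounded_bilinear.continuous_on[OF bounded_bilinear_matrix_mult] continuous_intros)

lemmas matrix_mult_sum_left = bounded_bilinear.sum_left[OF bounded_bilinear_matrix_mult]
lemmas matrix_mult_sum_right = bounded_bilinear.sum_right[OF bounded_bilinear_matrix_mult]
lemmas matrix_mult_diff_left = bounded_bilinear.diff_left[OF bounded_bilinear_matrix_mult]
lemmas matrix_mult_diff_right = bounded_bilinear.diff_right[OF bounded_bilinear_matrix_mult]

section \<open>Neumann series\<close>

primrec neumann_sum :: "real^'d^'d \<Rightarrow> nat \<Rightarrow> real^'d^'d" where
  "neumann_sum A 0 = 0"
| "neumann_sum A (Suc j) = mat 1 + A ** neumann_sum A j"

text \<open>\<open>neumann_sum\<close> is the partial sum of the powers of \<open>A\<close> in
  Horner form. Taking \<open>lim\<close> for every matrix makes measurability in \<open>A\<close>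
  immediate; for operator norm below 1 the value is the inverse of \<open>mat 1 - A\<close>.\<close>

definition neumann :: "real^'d^'d \<Rightarrow> real^'d^'d" where
  "neumann A = lim (neumann_sum A)"

lemma borel_measurable_neumann:
  fixes f :: "'a \<Rightarrow> real^'d^'d"
  assumes f: "f \<in> borel_measurable N"
  shows "(\<lambda>x. neumann (f x)) \<in> borel_measurable N"
proof -
  have "(\<lambda>x. neumann_sum (f x) j) \<in> borel_measurable N" for j
    by (induction j) (auto intro!: borel_measurable_add borel_measurable_matrix_mult f)
  then show ?thesis unfolding neumann_def by (rule borel_measurable_lim_metric)
qed

lemma neumann_sum_commute: "A ** neumann_sum A j = neumann_sum A j ** A"
proof (induction j)
  case (Suc j)
  show ?case by (simp add: matrix_add_ldistrib matrix_add_rdistrib Suc matrix_mul_assoc)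
qed simp

text \<open>Both identities are limits of the Horner recursion, with \<open>A\<close> moved to the
  right by commutation in the second. The bound then solves \<open>x \<le> 1 + q * x\<close>.
  Convergence is checked in the Frobenius norm, which the operator norm dominates up to a
  constant.\<close>

lemma neumann_props:
  fixes A :: "real^'d^'d"
  assumes q: "op_norm A \<le> q" "q < 1"
  shows "neumann A = mat 1 + A ** neumann A" "neumann A = mat 1 + neumann A ** A"
    "op_norm (neumann A) \<le> 1 / (1 - q)"
proof -
  let ?P = "neumann_sum A"
  have q0: "0 \<le> q" using q(1) op_norm_nonneg[of A] by linarith
  have gap: "op_norm (?P (Suc j) - ?P j) \<le> q ^ j" for j
  proof (induction j)
    case 0 show ?case using op_norm_mat_1 by simp
  next
    case (Suc j)
    have "?P (Suc (Suc j)) - ?P (Suc j) = A ** (?P (Suc j) - ?P j)"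
      by (simp add: matrix_mult_diff_right)
    then have "op_norm (?P (Suc (Suc j)) - ?P (Suc j)) \<le> op_norm A * op_norm (?P (Suc j) - ?P j)"
      by (simp only: op_norm_mult_le)
    also have "\<dots> \<le> q * q ^ j" using q q0 Suc by (intro mult_mono) auto
    finally show ?case by simp
  qed
  have nb: "norm (?P (Suc j) - ?P j) \<le> (real CARD('d))\<^sup>2 * q ^ j" for j
    by (rule order_trans[OF norm_le_op_norm mult_left_mono[OF gap]]) simp
  have "\<bar>q\<bar> < 1" using q0 q(2) by linarith
  then have "summable (\<lambda>j. (real CARD('d))\<^sup>2 * q ^ j)"
    by (intro summable_mult summable_geometric) (simp only: real_norm_def)
  then have "summable (\<lambda>j. ?P (Suc j) - ?P j)"
    by (rule summable_comparison_test'[where N=0]) (rule nb)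
  then have "convergent (\<lambda>n. \<Sum>j<n. ?P (Suc j) - ?P j)" by (simp only: summable_iff_convergent)
  then have "convergent (\<lambda>n. ?P n - ?P 0)" by (simp only: sum_lessThan_telescope)
  then have "convergent ?P" by simp
  then have L: "?P \<longlonglongrightarrow> neumann A" unfolding neumann_def by (simp only: convergent_LIMSEQ_iff)
  note bt = bounded_bilinear.tendsto[OF bounded_bilinear_matrix_mult]
  have "(\<lambda>j. ?P (Suc j)) \<longlonglongrightarrow> mat 1 + A ** neumann A"
    unfolding neumann_sum.simps by (intro tendsto_add tendsto_const bt L)
  then show 1: "neumann A = mat 1 + A ** neumann A" by (rule LIMSEQ_unique[OF LIMSEQ_Suc[OF L]])
  have "(\<lambda>j. ?P (Suc j)) \<longlonglongrightarrow> mat 1 + neumann A ** A"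
    unfolding neumann_sum.simps neumann_sum_commute by (intro tendsto_add tendsto_const bt L)
  then show "neumann A = mat 1 + neumann A ** A" by (rule LIMSEQ_unique[OF LIMSEQ_Suc[OF L]])
  have "op_norm (neumann A) \<le> 1 + op_norm A * op_norm (neumann A)"
    using op_norm_add_le[of "mat 1" "A ** neumann A"] op_norm_mat_1[where 'd='d] op_norm_mult_le[of A "neumann A"] 1 by simp
  also have "\<dots> \<le> 1 + q * op_norm (neumann A)" using q by (intro add_mono mult_right_mono) auto
  finally show "op_norm (neumann A) \<le> 1 / (1 - q)" using q by (simp add: field_simps)
qed

section \<open>The graded algebra of kernel sequences\<close>

definition window :: "(nat \<Rightarrow> real) \<Rightarrow> nat \<Rightarrow> nat \<Rightarrow> nat \<Rightarrow> real" where
  "window t p m = (\<lambda>i\<in>{..m}. t (p + i))"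

lemma window_window: "q + m \<le> n \<Longrightarrow> window (window t p n) q m = window t (p + q) m"
  by (auto simp: window_def fun_eq_iff add.assoc)

lemma window_ext: "t \<in> extensional {..m} \<Longrightarrow> window t 0 m = t"
  by (auto simp: window_def extensional_restrict)

lemma triangle_prod_window: "triangle_prod m n f g t = f (window t 0 m) ** g (window t m n)"
  by (simp add: triangle_prod_def window_def)

text \<open>Coefficients of the inverse of \<open>1 - K\<close> in the graded algebra of kernel sequences. \<open>window t p m\<close> is
  \<open>(t\<^sub>p, \<dots>, t\<^bsub>p+m\<^esub>)\<close>; for a fixed point \<open>t\<close>, the values of a kernel sequence on all windows form a block
  upper triangular matrix, and \<open>\<triangleright>\<close>-convolution is multiplication of such matrices.\<close>

function resolvent_series :: "(nat \<Rightarrow> (nat \<Rightarrow> real) \<Rightarrow> real^'d^'d) \<Rightarrow> nat \<Rightarrow> (nat \<Rightarrow> real) \<Rightarrow> real^'d^'d" where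
  "resolvent_series k n t = (if n = 0 then neumann (k 0 (window t 0 0))
     else neumann (k 0 (window t 0 0)) **
       (\<Sum>j<n. k (n - j) (window t 0 (n - j)) ** resolvent_series k j (window t (n - j) j)))"
  by pat_completeness auto
termination by (relation "inv_image less_than (\<lambda>(k, n, t). n)") auto

declare resolvent_series.simps [simp del]

lemma resolvent_series_0: "resolvent_series k 0 t = neumann (k 0 (window t 0 0))"
  by (subst resolvent_series.simps) simp

lemma resolvent_series_pos:
  "n > 0 \<Longrightarrow> resolvent_series k n t = neumann (k 0 (window t 0 0)) **
       (\<Sum>j<n. k (n - j) (window t 0 (n - j)) ** resolvent_series k j (window t (n - j) j))"
  by (subst resolvent_series.simps) simp

lemma sum_triangle_swap:
  fixes f :: "nat \<Rightarrow> nat \<Rightarrow> 'a::comm_monoid_add"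
  shows "(\<Sum>j\<in>{1..<m}. \<Sum>i<j. f j i) = (\<Sum>i<m. \<Sum>j\<in>{i<..<m}. f j i)"
proof -
  have "(\<Sum>j\<in>{1..<m}. \<Sum>i<j. f j i) = (\<Sum>j\<in>{1..<m}. \<Sum>i | i \<in> {..<m} \<and> i < j. f j i)"
    by (intro sum.cong) auto
  also have "\<dots> = (\<Sum>i<m. \<Sum>j | j \<in> {1..<m} \<and> i < j. f j i)"
    by (rule sum.swap_restrict) auto
  also have "\<dots> = (\<Sum>i<m. \<Sum>j\<in>{i<..<m}. f j i)"
    by (intro sum.cong) auto
  finally show ?thesis .
qed

text \<open>The defining recursion makes the series a right inverse of \<open>1 - K\<close>; this
  form makes it a left inverse as well. The recursion is expanded once, the induction hypothesis
  expands the inner factors from the right, and exchanging the double sum recollects the original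
  recursion. The offset \<open>p\<close> is general because the inner factors live on shifted
  windows.\<close>

lemma resolvent_series_right:
  fixes k :: "nat \<Rightarrow> (nat \<Rightarrow> real) \<Rightarrow> real^'d^'d"
  assumes "m > 0"
  shows "resolvent_series k m (window t p m) =
    (\<Sum>j<m. resolvent_series k j (window t p j) ** k (m - j) (window t (p + j) (m - j))) ** neumann (k 0 (window t (p + m) 0))"
  using assms
proof (induction m arbitrary: p rule: less_induct)
  case (less m)
  \<comment> \<open>Entries of block triangular matrices for the fixed point \<open>t\<close>, in
    row \<open>p\<close> and column \<open>p + m\<close>; \<open>\<rho> p\<close> plays the role of
    the inverse of a diagonal entry of \<open>1 - K\<close>.\<close>
  define \<kappa> where "\<kappa> p m = k m (window t p m)" for p m
  define \<sigma> where "\<sigma> p m = resolvent_series k m (window t p m)" for p m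
  define \<rho> where "\<rho> p = neumann (k 0 (window t p 0))" for p
  have \<sigma>0: "\<sigma> p 0 = \<rho> p" for p
    by (simp add: \<sigma>_def \<rho>_def resolvent_series_0 window_window)
  have \<sigma>S: "\<sigma> p n = \<rho> p ** (\<Sum>j<n. \<kappa> p (n - j) ** \<sigma> (p + (n - j)) j)" if "n > 0" for p n
    unfolding \<sigma>_def \<rho>_def \<kappa>_def using that
    by (subst resolvent_series_pos) (auto simp: window_window intro!: arg_cong2[where f="(**)"] sum.cong)
  have IH: "\<sigma> p n = (\<Sum>i<n. \<sigma> p i ** \<kappa> (p + i) (n - i)) ** \<rho> (p + n)" if "n < m" "n > 0" for p n
    using less.IH[OF that] unfolding \<sigma>_def \<kappa>_def \<rho>_def .
  \<comment> \<open>The summand of index 0 is split off, as the induction hypothesis covers only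
    positive orders.\<close>
  have m: "{..<m} = insert 0 {1..<m}" using less.prems by auto
  have "(\<Sum>j<m. \<kappa> p (m - j) ** \<sigma> (p + (m - j)) j) = \<kappa> p m ** \<rho> (p + m) + (\<Sum>j\<in>{1..<m}. \<kappa> p (m - j) ** \<sigma> (p + (m - j)) j)"
    unfolding m by (simp add: \<sigma>0)
  also have "(\<Sum>j\<in>{1..<m}. \<kappa> p (m - j) ** \<sigma> (p + (m - j)) j)
     = (\<Sum>j\<in>{1..<m}. \<Sum>i<j. \<kappa> p (m - j) ** \<sigma> (p + (m - j)) i ** \<kappa> (p + (m - j) + i) (j - i) ** \<rho> (p + m))"
  proof (intro sum.cong refl)
    fix j assume j: "j \<in> {1..<m}"
    then have "\<sigma> (p + (m - j)) j = (\<Sum>i<j. \<sigma> (p + (m - j)) i ** \<kappa> (p + (m - j) + i) (j - i)) ** \<rho> (p + (m - j) + j)"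
      by (intro IH) auto
    moreover have "p + (m - j) + j = p + m" using j by simp
    ultimately have "\<sigma> (p + (m - j)) j = (\<Sum>i<j. \<sigma> (p + (m - j)) i ** \<kappa> (p + (m - j) + i) (j - i)) ** \<rho> (p + m)"
      by (simp only:)
    then show "\<kappa> p (m - j) ** \<sigma> (p + (m - j)) j
      = (\<Sum>i<j. \<kappa> p (m - j) ** \<sigma> (p + (m - j)) i ** \<kappa> (p + (m - j) + i) (j - i) ** \<rho> (p + m))"
      by (simp add: matrix_mult_sum_left matrix_mult_sum_right matrix_mul_assoc)
  qed
  also have "\<dots> = (\<Sum>i<m. \<Sum>j\<in>{i<..<m}. \<kappa> p (m - j) ** \<sigma> (p + (m - j)) i ** \<kappa> (p + (m - j) + i) (j - i) ** \<rho> (p + m))"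
    by (rule sum_triangle_swap)
  also have "\<dots> = (\<Sum>n\<in>{1..<m}. (\<Sum>i<n. \<kappa> p (n - i) ** \<sigma> (p + (n - i)) i) ** \<kappa> (p + n) (m - n) ** \<rho> (p + m))"
  proof -
    have "(\<Sum>i<m. \<Sum>j\<in>{i<..<m}. \<kappa> p (m - j) ** \<sigma> (p + (m - j)) i ** \<kappa> (p + (m - j) + i) (j - i) ** \<rho> (p + m))
      = (\<Sum>i<m. \<Sum>n\<in>{i<..<m}. \<kappa> p (n - i) ** \<sigma> (p + (n - i)) i ** \<kappa> (p + n) (m - n) ** \<rho> (p + m))"
    proof (rule sum.cong[OF refl])
      fix i assume "i \<in> {..<m}"
      show "(\<Sum>j\<in>{i<..<m}. \<kappa> p (m - j) ** \<sigma> (p + (m - j)) i ** \<kappa> (p + (m - j) + i) (j - i) ** \<rho> (p + m))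
        = (\<Sum>n\<in>{i<..<m}. \<kappa> p (n - i) ** \<sigma> (p + (n - i)) i ** \<kappa> (p + n) (m - n) ** \<rho> (p + m))"
      \<comment> \<open>The new index \<open>n = m + i - j\<close> marks, counted from
        \<open>p\<close>, where the last factor \<open>\<kappa>\<close> starts: then
        \<open>n - i = m - j\<close> and \<open>m - n = j - i\<close>.\<close>
      proof (rule sum.reindex_bij_witness[of _ "\<lambda>n. m + i - n" "\<lambda>j. m + i - j"])
        fix j assume "j \<in> {i<..<m}"
        then have "m + i - j - i = m - j" "p + (m + i - j) = p + (m - j) + i" "m - (m + i - j) = j - i" by auto
        then show "\<kappa> p (m + i - j - i) ** \<sigma> (p + (m + i - j - i)) i ** \<kappa> (p + (m + i - j)) (m - (m + i - j)) ** \<rho> (p + m)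
          = \<kappa> p (m - j) ** \<sigma> (p + (m - j)) i ** \<kappa> (p + (m - j) + i) (j - i) ** \<rho> (p + m)"
          by (simp only:)
      qed auto
    qed
    also have "\<dots> = (\<Sum>n\<in>{1..<m}. \<Sum>i<n. \<kappa> p (n - i) ** \<sigma> (p + (n - i)) i ** \<kappa> (p + n) (m - n) ** \<rho> (p + m))"
      by (rule sum_triangle_swap[symmetric])
    finally show ?thesis by (simp add: matrix_mult_sum_left)
  qed
  finally have eq: "(\<Sum>j<m. \<kappa> p (m - j) ** \<sigma> (p + (m - j)) j) =
    (\<kappa> p m + (\<Sum>n\<in>{1..<m}. (\<Sum>i<n. \<kappa> p (n - i) ** \<sigma> (p + (n - i)) i) ** \<kappa> (p + n) (m - n))) ** \<rho> (p + m)"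
    by (simp add: matrix_add_rdistrib matrix_mult_sum_left)
  have "\<sigma> p m = (\<rho> p ** \<kappa> p m + (\<Sum>n\<in>{1..<m}. \<rho> p ** (\<Sum>i<n. \<kappa> p (n - i) ** \<sigma> (p + (n - i)) i) ** \<kappa> (p + n) (m - n))) ** \<rho> (p + m)"
    unfolding \<sigma>S[OF less.prems] eq by (simp add: matrix_mul_assoc matrix_add_ldistrib matrix_mult_sum_right)
  also have "(\<Sum>n\<in>{1..<m}. \<rho> p ** (\<Sum>i<n. \<kappa> p (n - i) ** \<sigma> (p + (n - i)) i) ** \<kappa> (p + n) (m - n)) = (\<Sum>n\<in>{1..<m}. \<sigma> p n ** \<kappa> (p + n) (m - n))"
    by (intro sum.cong refl) (simp add: \<sigma>S)
  also have "\<rho> p ** \<kappa> p m + (\<Sum>n\<in>{1..<m}. \<sigma> p n ** \<kappa> (p + n) (m - n)) = (\<Sum>n<m. \<sigma> p n ** \<kappa> (p + n) (m - n))"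
    unfolding m by (simp add: \<sigma>0)
  finally show ?case unfolding \<sigma>_def \<kappa>_def \<rho>_def .
qed

text \<open>The unit of the convolution algebra is the identity matrix in order 0 and zero in all
  other orders; it is subtracted from the inverse of \<open>1 - K\<close>.\<close>

definition resolvent_coeff :: "(nat \<Rightarrow> (nat \<Rightarrow> real) \<Rightarrow> real^'d^'d) \<Rightarrow> nat \<Rightarrow> (nat \<Rightarrow> real) \<Rightarrow> real^'d^'d" where
  "resolvent_coeff k n t = resolvent_series k n t - (if n = 0 then mat 1 else 0)"

text \<open>With \<open>\<sigma> = 1 + R\<close> this is \<open>\<sigma> = 1 + K \<sigma>\<close>,
  order by order. In positive order the lower terms add up to a matrix \<open>?B\<close> with
  \<open>\<sigma> 0 n = \<rho> 0 ** ?B\<close>, and the Neumann identity for \<open>\<rho> 0\<close>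
  absorbs the product of \<open>k 0\<close> with \<open>\<sigma> 0 n\<close>. By the assumption on
  \<open>t\<close> the full window is \<open>t\<close> itself.\<close>

lemma resolvent_coeff_left:
  fixes k :: "nat \<Rightarrow> (nat \<Rightarrow> real) \<Rightarrow> real^'d^'d"
  assumes q: "\<And>t. op_norm (k 0 t) \<le> q" "q < 1" and t: "t \<in> extensional {..n}"
  shows "resolvent_coeff k n t = k n t + (\<Sum>j=0..n. triangle_prod (n - j) j (k (n - j)) (resolvent_coeff k j) t)"
proof -
  define \<kappa> where "\<kappa> p m = k m (window t p m)" for p m
  define \<sigma> where "\<sigma> p m = resolvent_series k m (window t p m)" for p m
  define \<rho> where "\<rho> p = neumann (k 0 (window t p 0))" for p
  have \<rho>: "\<rho> 0 = mat 1 + \<kappa> 0 0 ** \<rho> 0" unfolding \<rho>_def \<kappa>_def by (rule neumann_props(1)[OF q])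
  \<comment> \<open>\<open>resolvent_coeff\<close> differs from the series only in order 0, by the
    unit; in the sum this costs one copy of the coefficient of \<open>k\<close> of order
    \<open>n\<close>.\<close>
  have "(\<Sum>j=0..n. triangle_prod (n - j) j (k (n - j)) (resolvent_coeff k j) t)
    = (\<Sum>j=0..n. \<kappa> 0 (n - j) ** \<sigma> (n - j) j - (if j = 0 then \<kappa> 0 n else 0))"
    by (intro sum.cong refl) (simp add: triangle_prod_window resolvent_coeff_def \<kappa>_def \<sigma>_def matrix_mult_diff_right)
  also have "\<dots> = (\<Sum>j=0..n. \<kappa> 0 (n - j) ** \<sigma> (n - j) j) - \<kappa> 0 n"
    by (simp add: sum_subtractf)
  also have "(\<Sum>j=0..n. \<kappa> 0 (n - j) ** \<sigma> (n - j) j) = \<kappa> 0 0 ** \<sigma> 0 n + (\<Sum>j<n. \<kappa> 0 (n - j) ** \<sigma> (n - j) j)"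
    by (simp add: atLeast0AtMost lessThan_Suc_atMost[symmetric])
  also have "\<kappa> 0 0 ** \<sigma> 0 n + (\<Sum>j<n. \<kappa> 0 (n - j) ** \<sigma> (n - j) j) = \<sigma> 0 n - (if n = 0 then mat 1 else 0)"
  proof (cases "n = 0")
    case True
    have "\<sigma> 0 0 = \<rho> 0" by (simp add: \<sigma>_def \<rho>_def resolvent_series_0 window_window)
    moreover have "\<kappa> 0 0 ** \<rho> 0 = \<rho> 0 - mat 1" using arg_cong[OF \<rho>, of "\<lambda>x. x - mat 1"] by simp
    ultimately show ?thesis using True by simp
  next
    case False
    let ?B = "\<Sum>j<n. \<kappa> 0 (n - j) ** \<sigma> (n - j) j"
    have "\<sigma> 0 n = \<rho> 0 ** ?B"
      unfolding \<sigma>_def \<rho>_def \<kappa>_def using False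
      by (subst resolvent_series_pos) (auto simp: window_window intro!: arg_cong2[where f="(**)"] sum.cong)
    moreover have "\<kappa> 0 0 ** (\<rho> 0 ** ?B) + ?B = (mat 1 + \<kappa> 0 0 ** \<rho> 0) ** ?B"
      by (simp add: matrix_add_rdistrib matrix_mul_assoc add.commute)
    ultimately show ?thesis using False \<rho> by simp
  qed
  finally have eq: "(\<Sum>j=0..n. triangle_prod (n - j) j (k (n - j)) (resolvent_coeff k j) t)
    = \<sigma> 0 n - (if n = 0 then mat 1 else 0) - \<kappa> 0 n" .
  show ?thesis
    unfolding eq \<sigma>_def \<kappa>_def window_ext[OF t] by (simp add: resolvent_coeff_def)
qed

text \<open>Mirror image of the previous lemma, from \<open>\<sigma> = 1 + \<sigma> K\<close>: the
  diagonal inverse now has to stand on the right, which is the form supplied by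
  \<open>resolvent_series_right\<close>.\<close>

lemma resolvent_coeff_right:
  fixes k :: "nat \<Rightarrow> (nat \<Rightarrow> real) \<Rightarrow> real^'d^'d"
  assumes q: "\<And>t. op_norm (k 0 t) \<le> q" "q < 1" and t: "t \<in> extensional {..n}"
  shows "resolvent_coeff k n t = k n t + (\<Sum>j=0..n. triangle_prod (n - j) j (resolvent_coeff k (n - j)) (k j) t)"
proof -
  define \<kappa> where "\<kappa> p m = k m (window t p m)" for p m
  define \<sigma> where "\<sigma> p m = resolvent_series k m (window t p m)" for p m
  define \<rho> where "\<rho> p = neumann (k 0 (window t p 0))" for p
  have \<rho>: "\<rho> n = mat 1 + \<rho> n ** \<kappa> n 0" unfolding \<rho>_def \<kappa>_def by (rule neumann_props(2)[OF q])
  have "(\<Sum>j=0..n. triangle_prod (n - j) j (resolvent_coeff k (n - j)) (k j) t)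
    = (\<Sum>j=0..n. \<sigma> 0 (n - j) ** \<kappa> (n - j) j - (if j = n then \<kappa> 0 n else 0))"
    by (intro sum.cong refl) (auto simp: triangle_prod_window resolvent_coeff_def \<kappa>_def \<sigma>_def matrix_mult_diff_left)
  also have "\<dots> = (\<Sum>j=0..n. \<sigma> 0 (n - j) ** \<kappa> (n - j) j) - \<kappa> 0 n"
    by (simp add: sum_subtractf)
  also have "(\<Sum>j=0..n. \<sigma> 0 (n - j) ** \<kappa> (n - j) j) = (\<Sum>i=0..n. \<sigma> 0 i ** \<kappa> i (n - i))"
    by (rule sum.reindex_bij_witness[of _ "\<lambda>i. n - i" "\<lambda>i. n - i"]) auto
  also have "\<dots> = \<sigma> 0 n ** \<kappa> n 0 + (\<Sum>i<n. \<sigma> 0 i ** \<kappa> i (n - i))"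
    by (simp add: atLeast0AtMost lessThan_Suc_atMost[symmetric])
  also have "\<sigma> 0 n ** \<kappa> n 0 + (\<Sum>i<n. \<sigma> 0 i ** \<kappa> i (n - i)) = \<sigma> 0 n - (if n = 0 then mat 1 else 0)"
  proof (cases "n = 0")
    case True
    have "\<sigma> 0 0 = \<rho> 0" by (simp add: \<sigma>_def \<rho>_def resolvent_series_0 window_window)
    moreover have "\<rho> n ** \<kappa> n 0 = \<rho> n - mat 1" using arg_cong[OF \<rho>, of "\<lambda>x. x - mat 1"] by simp
    ultimately show ?thesis using True by simp
  next
    case False
    let ?B = "\<Sum>i<n. \<sigma> 0 i ** \<kappa> i (n - i)"
    have "\<sigma> 0 n = ?B ** \<rho> n"
      unfolding \<sigma>_def \<rho>_def \<kappa>_def using resolvent_series_right[of n k t 0] False by simp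
    moreover have "?B ** \<rho> n ** \<kappa> n 0 + ?B = ?B ** (mat 1 + \<rho> n ** \<kappa> n 0)"
      by (simp add: matrix_add_ldistrib matrix_mul_assoc add.commute)
    ultimately show ?thesis using False \<rho> by simp
  qed
  finally have eq: "(\<Sum>j=0..n. triangle_prod (n - j) j (resolvent_coeff k (n - j)) (k j) t)
    = \<sigma> 0 n - (if n = 0 then mat 1 else 0) - \<kappa> 0 n" .
  show ?thesis
    unfolding eq \<sigma>_def \<kappa>_def window_ext[OF t] by (simp add: resolvent_coeff_def)
qed

text \<open>On the whole product space windows are measurable projections with no ordering
  constraint to track; the kernels inserted later are extended by 0 outside the simplex.\<close>

lemma resolvent_series_measurable:
  fixes k :: "nat \<Rightarrow> (nat \<Rightarrow> real) \<Rightarrow> real^'d^'d"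
  assumes k: "\<And>n. k n \<in> borel_measurable (lborel_n (Suc n))"
  shows "resolvent_series k n \<in> borel_measurable (lborel_n (Suc n))"
proof (induction n rule: less_induct)
  case (less n)
  have w: "(\<lambda>t. window t p m) \<in> lborel_n (Suc n) \<rightarrow>\<^sub>M lborel_n (Suc m)" if "p + m \<le> n" for p m
    unfolding window_def lessThan_Suc_atMost[symmetric] using that
    by (intro measurable_restrict measurable_component_singleton) auto
  have \<rho>: "(\<lambda>t. neumann (k 0 (window t 0 0))) \<in> borel_measurable (lborel_n (Suc n))"
    by (intro borel_measurable_neumann measurable_compose[OF w k]) simp
  show ?case
  proof (cases "n = 0")
    case True
    have "resolvent_series k n = (\<lambda>t. neumann (k 0 (window t 0 0)))" using True by (simp add: resolvent_series_0 fun_eq_iff)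
    with \<rho> show ?thesis by (simp only:)
  next
    case False
    have "resolvent_series k n = (\<lambda>t. neumann (k 0 (window t 0 0)) **
       (\<Sum>j<n. k (n - j) (window t 0 (n - j)) ** resolvent_series k j (window t (n - j) j)))"
      using False by (simp add: resolvent_series_pos fun_eq_iff)
    moreover have "(\<lambda>t. neumann (k 0 (window t 0 0)) **
       (\<Sum>j<n. k (n - j) (window t 0 (n - j)) ** resolvent_series k j (window t (n - j) j))) \<in> borel_measurable (lborel_n (Suc n))"
    proof (intro borel_measurable_matrix_mult borel_measurable_sum \<rho>)
      fix j assume j: "j \<in> {..<n}"
      then show "(\<lambda>t. k (n - j) (window t 0 (n - j))) \<in> borel_measurable (lborel_n (Suc n))"
        by (intro measurable_compose[OF w k]) simp
      show "(\<lambda>t. resolvent_series k j (window t (n - j) j)) \<in> borel_measurable (lborel_n (Suc n))"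
        using j by (intro measurable_compose[OF w less]) auto
    qed
    ultimately show ?thesis by (simp only:)
  qed
qed

section \<open>Growth of the inverse\<close>

definition gap_prod :: "(real \<Rightarrow> real) \<Rightarrow> nat \<Rightarrow> (nat \<Rightarrow> real) \<Rightarrow> real" where
  "gap_prod a n t = (\<Prod>i<n. a (t i - t (Suc i)))"

lemma gap_prod_window: "m \<le> n \<Longrightarrow> gap_prod a m (window t p n) = (\<Prod>i<m. a (t (p + i) - t (p + Suc i)))"
  unfolding gap_prod_def window_def by (intro prod.cong refl) auto

text \<open>The two windows share only the time \<open>t (n - j)\<close>, so their consecutive gaps
  together are the gaps of \<open>t\<close>. Thus product bounds pass through
  \<open>triangle_prod\<close>.\<close>

lemma gap_prod_split:
  assumes "j \<le> n"
  shows "gap_prod a (n - j) (window t 0 (n - j)) * gap_prod a j (window t (n - j) j) = gap_prod a n t"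
proof -
  have "gap_prod a n t = (\<Prod>i<(n - j) + j. a (t i - t (Suc i)))" using assms by (simp add: gap_prod_def)
  also have "\<dots> = (\<Prod>i<n - j. a (t i - t (Suc i))) * (\<Prod>i<j. a (t (n - j + i) - t (n - j + Suc i)))"
  proof -
    have "(\<Prod>i<(n - j) + j. a (t i - t (Suc i))) = (\<Prod>i<n - j. a (t i - t (Suc i))) * (\<Prod>i\<in>{n - j..<n - j + j}. a (t i - t (Suc i)))"
      by (subst prod.union_disjoint[symmetric]) (auto intro!: prod.cong)
    also have "(\<Prod>i\<in>{n - j..<n - j + j}. a (t i - t (Suc i))) = (\<Prod>i<j. a (t (n - j + i) - t (n - j + Suc i)))"
      by (rule prod.reindex_bij_witness[of _ "\<lambda>i. n - j + i" "\<lambda>i. i - (n - j)"]) auto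
    finally show ?thesis .
  qed
  finally show ?thesis by (simp add: gap_prod_window)
qed

text \<open>Unfolded, the recursion sums over all compositions of \<open>n\<close>, each part adding
  one diagonal inverse of norm at most \<open>C\<close>; counting compositions by their number of
  parts produces the rate \<open>1 + C\<close>. In the induction the recursion closes because the
  sum of \<open>C * (1 + C) ^ j\<close> over \<open>j < n\<close> is
  \<open>(1 + C) ^ n - 1\<close>.\<close>

lemma op_norm_resolvent_series_le:
  fixes k :: "nat \<Rightarrow> (nat \<Rightarrow> real) \<Rightarrow> real^'d^'d"
  assumes q: "\<And>t. op_norm (k 0 t) \<le> q" "q < 1"
    and a: "\<And>x. 0 \<le> a x" and k: "\<And>n t. n \<ge> 1 \<Longrightarrow> op_norm (k n t) \<le> gap_prod a n t"
    and C: "C = 1 / (1 - q)"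
  shows "op_norm (resolvent_series k n t) \<le> C * (1 + C) ^ n * gap_prod a n t"
proof (induction n arbitrary: t rule: less_induct)
  case (less n)
  have C0: "0 \<le> C" using q(2) by (simp add: C)
  have gp: "0 \<le> gap_prod a m t" for m t unfolding gap_prod_def by (intro prod_nonneg a)
  have \<rho>: "op_norm (neumann (k 0 t)) \<le> C" for t unfolding C by (rule neumann_props(3)[OF q])
  show ?case
  proof (cases "n = 0")
    case True then show ?thesis using \<rho> by (simp add: resolvent_series_0 gap_prod_def)
  next
    case False
    have tm: "op_norm (k (n - j) (window t 0 (n - j)) ** resolvent_series k j (window t (n - j) j)) \<le> C * (1 + C) ^ j * gap_prod a n t"
      if j: "j < n" for j
    proof -
      have "op_norm (k (n - j) (window t 0 (n - j)) ** resolvent_series k j (window t (n - j) j))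
        \<le> op_norm (k (n - j) (window t 0 (n - j))) * op_norm (resolvent_series k j (window t (n - j) j))"
        by (rule op_norm_mult_le)
      also have "\<dots> \<le> gap_prod a (n - j) (window t 0 (n - j)) * (C * (1 + C) ^ j * gap_prod a j (window t (n - j) j))"
        using j by (intro mult_mono k less gp op_norm_nonneg) auto
      also have "\<dots> = C * (1 + C) ^ j * (gap_prod a (n - j) (window t 0 (n - j)) * gap_prod a j (window t (n - j) j))" by simp
      also have "\<dots> = C * (1 + C) ^ j * gap_prod a n t" using j by (subst gap_prod_split) auto
      finally show ?thesis .
    qed
    have geo: "(\<Sum>j<n. C * (1 + C) ^ j) = (1 + C) ^ n - 1"
      by (induction n) (auto simp: algebra_simps)
    have "op_norm (resolvent_series k n t) \<le> op_norm (neumann (k 0 (window t 0 0))) *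
       op_norm (\<Sum>j<n. k (n - j) (window t 0 (n - j)) ** resolvent_series k j (window t (n - j) j))"
      using False by (subst resolvent_series_pos) (auto intro: op_norm_mult_le)
    also have "\<dots> \<le> C * (\<Sum>j<n. C * (1 + C) ^ j * gap_prod a n t)"
      using C0 by (intro mult_mono \<rho> order_trans[OF op_norm_sum_le sum_mono] tm) auto
    also have "\<dots> = C * (((1 + C) ^ n - 1) * gap_prod a n t)"
      unfolding sum_distrib_right[symmetric] geo ..
    also have "\<dots> \<le> C * ((1 + C) ^ n * gap_prod a n t)"
      using C0 gp by (intro mult_left_mono mult_right_mono) auto
    finally show ?thesis by (simp add: mult.assoc)
  qed
qed

section \<open>Norm estimates\<close>

lemma gap_prod_nonneg: "(\<And>x. 0 \<le> a x) \<Longrightarrow> 0 \<le> gap_prod a n t"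
  unfolding gap_prod_def by (rule prod_nonneg) blast

text \<open>The first coordinate is integrated innermost here, so that a translation in it can be
  performed with all others fixed.\<close>

lemma nn_integral_lborel_n_head_swap:
  assumes h: "h \<in> borel_measurable (lborel_n (Suc n))"
  shows "(\<integral>\<^sup>+x. h x \<partial>lborel_n (Suc n)) = (\<integral>\<^sup>+r. (\<integral>\<^sup>+s. h (case_nat s r) \<partial>lborel) \<partial>lborel_n n)"
proof -
  interpret P: pair_sigma_finite lborel "lborel_n n"
    by (intro pair_sigma_finite.intro sigma_finite_lborel sigma_finite_lborel_n)
  have m: "(\<lambda>(s, r). h (case_nat s r)) \<in> borel_measurable (lborel \<Otimes>\<^sub>M lborel_n n)"
    using measurable_compose[OF measurable_case_nat_lborel_n h] by (simp only: case_prod_beta')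
  show ?thesis
    unfolding nn_integral_lborel_n_head(1)[OF h] using P.Fubini'[OF m] by simp
qed

lemma gap_prod_term_measurable:
  assumes "i < n"
  shows "(\<lambda>x. (x(n := t)) i - (x(n := t)) (Suc i)) \<in> borel_measurable (lborel_n n)"
proof -
  have c: "(\<lambda>x. (x(n := t)) j) \<in> borel_measurable (lborel_n n)" if "j \<le> n" for j
  proof (cases "j = n")
    case False
    then have "(\<lambda>x. x j) \<in> borel_measurable (lborel_n n)"
      using measurable_component_singleton[of j "{..<n}" "\<lambda>_. lborel"] that by simp
    with False show ?thesis by simp
  qed simp
  show ?thesis using assms by (intro borel_measurable_diff c) auto
qed

text \<open>The first coordinate occurs in the first gap only. Integrated first, over the whole
  line, it contributes the full mass of \<open>b\<close> by translation invariance, and the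
  remaining product has the same shape.\<close>

lemma nn_integral_gap_prod:
  fixes b :: "real \<Rightarrow> ennreal"
  assumes b: "b \<in> borel_measurable borel"
  shows "(\<integral>\<^sup>+x. (\<Prod>i<n. b ((x(n := t)) i - (x(n := t)) (Suc i))) \<partial>lborel_n n) = (\<integral>\<^sup>+x. b x \<partial>lborel) ^ n"
proof (induction n)
  case 0 show ?case by (simp add: PiM_empty)
next
  case (Suc n)
  have m: "(\<lambda>x. \<Prod>i<n. b ((x(n := t)) i - (x(n := t)) (Suc i))) \<in> borel_measurable (lborel_n n)" for n
    by (rule borel_measurable_prod_ennreal) (intro measurable_compose[OF gap_prod_term_measurable b], simp)
  have upd: "(case_nat s r)(Suc n := t) = case_nat s (r(n := t))" for s and r :: "nat \<Rightarrow> real"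
    by (auto simp: fun_eq_iff split: nat.splits)
  have shift: "(\<integral>\<^sup>+s. b (s - c) \<partial>lborel) = (\<integral>\<^sup>+x. b x \<partial>lborel)" for c
    using nn_integral_real_affine[OF b, of 1 "- c"] by (simp add: add.commute)
  have mb: "(\<lambda>s. b (s - c)) \<in> borel_measurable lborel" for c
    using measurable_compose[OF _ b, of "\<lambda>s. s - c" lborel] by simp
  have "(\<integral>\<^sup>+x. (\<Prod>i<Suc n. b ((x(Suc n := t)) i - (x(Suc n := t)) (Suc i))) \<partial>lborel_n (Suc n))
    = (\<integral>\<^sup>+r. (\<integral>\<^sup>+s. (\<Prod>i<Suc n. b (case_nat s (r(n := t)) i - case_nat s (r(n := t)) (Suc i))) \<partial>lborel) \<partial>lborel_n n)"
    unfolding nn_integral_lborel_n_head_swap[OF m] upd ..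
  also have "\<dots> = (\<integral>\<^sup>+r. (\<integral>\<^sup>+x. b x \<partial>lborel) * (\<Prod>i<n. b ((r(n := t)) i - (r(n := t)) (Suc i))) \<partial>lborel_n n)"
    by (intro nn_integral_cong)
      (simp add: prod.lessThan_Suc_shift nn_integral_multc[OF mb] shift del: prod.lessThan_Suc fun_upd_apply)
  also have "\<dots> = (\<integral>\<^sup>+x. b x \<partial>lborel) ^ Suc n"
    by (subst nn_integral_cmult[OF m]) (simp only: Suc power_Suc)
  finally show ?case .
qed

text \<open>The exponential weight turns the iterated integral over a bounded time interval into a power of the
  total mass \<open>\<beta>\<close>, which is small for large \<open>l\<close>.\<close>

lemma nn_integral_gap_prod_sq_le:
  assumes a: "a \<in> borel_measurable borel" and a0: "\<And>x. 0 \<le> a x"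
    and l: "0 \<le> l" and \<beta>: "(\<integral>\<^sup>+x. ennreal ((a x)\<^sup>2 * exp (- l * x)) \<partial>lborel) = ennreal \<beta>" "0 \<le> \<beta>"
    and t: "S \<le> t" "t \<le> T"
  shows "(\<integral>\<^sup>+s. ennreal ((gap_prod a n (s(n := t)))\<^sup>2) \<partial>simplex_measure n t T) \<le> ennreal (exp (l * (T - S)) * \<beta> ^ n)"
proof -
  let ?b = "\<lambda>x. ennreal ((a x)\<^sup>2 * exp (- l * x))"
  have b: "?b \<in> borel_measurable borel" using a by measurable
  have pw: "ennreal ((gap_prod a n (s(n := t)))\<^sup>2) \<le>
      ennreal (exp (l * (T - S))) * (\<Prod>i<n. ?b ((s(n := t)) i - (s(n := t)) (Suc i)))" if s: "s \<in> ord_simplex n t T" for s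
  proof -
    let ?x = "s(n := t)"
    let ?d = "\<lambda>i. ?x i - ?x (Suc i)"
    have x0: "?x 0 \<le> T" using s t by (cases n) (auto simp: ord_simplex_def less_imp_le)
    \<comment> \<open>The gaps telescope, so the factors \<open>exp (l * y)\<close> taken out of the
      gaps multiply to at most \<open>exp (l * (T - S))\<close>, whatever \<open>n\<close>
      is.\<close>
    have sumd: "(\<Sum>i<n. ?d i) = ?x 0 - t"
      using sum_lessThan_telescope'[of ?x n] by (simp del: fun_upd_apply add: fun_upd_same)
    have weight: "(a y)\<^sup>2 = exp (l * y) * ((a y)\<^sup>2 * exp (- l * y))" for y
    proof -
      have "exp (l * y) * exp (- l * y) = 1" by (simp add: mult_exp_exp)
      then have "(a y)\<^sup>2 * (exp (l * y) * exp (- l * y)) = (a y)\<^sup>2" by (simp only: mult_1_right)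
      then show ?thesis by (simp only: mult.left_commute)
    qed
    have "(gap_prod a n ?x)\<^sup>2 = (\<Prod>i<n. (a (?d i))\<^sup>2)"
      unfolding gap_prod_def by (rule prod_power_distrib)
    also have "\<dots> = (\<Prod>i<n. exp (l * ?d i) * ((a (?d i))\<^sup>2 * exp (- l * ?d i)))"
      by (rule prod.cong[OF refl]) (rule weight)
    also have "\<dots> = exp (l * (\<Sum>i<n. ?d i)) * (\<Prod>i<n. (a (?d i))\<^sup>2 * exp (- l * ?d i))"
      by (simp only: prod.distrib sum_distrib_left exp_sum[OF finite_lessThan])
    also have "\<dots> \<le> exp (l * (T - S)) * (\<Prod>i<n. (a (?d i))\<^sup>2 * exp (- l * ?d i))"
      unfolding sumd using x0 t l
      by (intro mult_right_mono prod_nonneg ballI mult_nonneg_nonneg) (auto intro!: mult_left_mono)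
    finally show ?thesis
      by (subst prod_ennreal, simp)
        (simp only: ennreal_mult[symmetric] exp_ge_zero prod_nonneg mult_nonneg_nonneg zero_le_power2 ennreal_leI)
  qed
  have m: "(\<lambda>x. \<Prod>i<n. ?b ((x(n := t)) i - (x(n := t)) (Suc i))) \<in> borel_measurable (lborel_n n)"
    by (rule borel_measurable_prod_ennreal) (intro measurable_compose[OF gap_prod_term_measurable b], simp)
  have "(\<integral>\<^sup>+s. ennreal ((gap_prod a n (s(n := t)))\<^sup>2) \<partial>simplex_measure n t T)
     \<le> (\<integral>\<^sup>+s. ennreal (exp (l * (T - S))) * (\<Prod>i<n. ?b ((s(n := t)) i - (s(n := t)) (Suc i))) \<partial>simplex_measure n t T)"
    by (rule nn_integral_mono) (simp only: space_simplex_measure pw)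
  also have "\<dots> \<le> (\<integral>\<^sup>+s. ennreal (exp (l * (T - S))) * (\<Prod>i<n. ?b ((s(n := t)) i - (s(n := t)) (Suc i))) \<partial>lborel_n n)"
    unfolding nn_integral_simplex by (intro nn_integral_mono) (simp add: indicator_def)
  also have "\<dots> = ennreal (exp (l * (T - S))) * (ennreal \<beta>) ^ n"
    unfolding nn_integral_cmult[OF m] nn_integral_gap_prod[OF b] \<beta>(1) ..
  also have "\<dots> = ennreal (exp (l * (T - S)) * \<beta> ^ n)"
    using \<beta>(2) by (simp add: ennreal_power ennreal_mult)
  finally show ?thesis .
qed

section \<open>Volterra and L2 norms of kernels bounded by gap products\<close>

lemma sqrt_ennreal_le: "x \<le> ennreal (c\<^sup>2) \<Longrightarrow> 0 \<le> c \<Longrightarrow> sqrt_ennreal x \<le> ennreal c"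
proof -
  assume x: "x \<le> ennreal (c\<^sup>2)" and c: "0 \<le> c"
  then have "x \<noteq> \<infinity>" by (auto simp: top_unique)
  moreover have "enn2real x \<le> c\<^sup>2" using enn2real_mono[OF x] by simp
  then have "sqrt (enn2real x) \<le> c" using c by (simp add: real_le_lsqrt)
  ultimately show ?thesis unfolding sqrt_ennreal_def by (simp add: ennreal_leI)
qed

lemma sqrt_ennreal_measurable:
  assumes [measurable]: "f \<in> borel_measurable N"
  shows "(\<lambda>x. sqrt_ennreal (f x)) \<in> borel_measurable N"
  unfolding sqrt_ennreal_def by measurable

text \<open>The simplex of dimension 0 is a unit point mass, so for \<open>n = 0\<close> the
  integral is the square of the operator norm and both cases of the definition become one
  formula.\<close>

lemma volterra_norm_eq:
  fixes f :: "(nat \<Rightarrow> real) \<Rightarrow> real^'d^'d"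
  shows "volterra_norm S T n f = esssup (time_interval S T)
     (\<lambda>t. sqrt_ennreal (\<integral>\<^sup>+s. ennreal ((op_norm (f (s(n := t))))\<^sup>2) \<partial>simplex_measure n t T))"
proof (cases "n = 0")
  case True
  have upd: "(\<lambda>_. undefined)(0::nat := t) = (\<lambda>i\<in>{..<1}. t)" for t :: real by (auto simp: fun_eq_iff)
  have "sqrt_ennreal (ennreal (x\<^sup>2)) = ennreal x" if "0 \<le> x" for x
    using that by (simp add: sqrt_ennreal_def)
  then show ?thesis using True by (simp add: volterra_norm_def nn_integral_simplex_0 upd)
qed (simp add: volterra_norm_def)

text \<open>Both norms come from \<open>?J t\<close>, the integral over all times above the smallest
  one: its essential supremum is the squared Volterra norm, and its integral over \<open>t\<close>
  bounds the squared L2 norm up to the factor comparing Frobenius and operator norm.\<close>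

lemma kernel_norm_bounds:
  fixes f :: "(nat \<Rightarrow> real) \<Rightarrow> real^'d^'d"
  assumes ST: "S < T" and a: "a \<in> borel_measurable borel" and a0: "\<And>x. 0 \<le> a x"
    and l: "0 \<le> l" and \<beta>: "(\<integral>\<^sup>+x. ennreal ((a x)\<^sup>2 * exp (- l * x)) \<partial>lborel) = ennreal \<beta>" "0 \<le> \<beta>"
    and f: "f \<in> borel_measurable (simplex_measure (Suc n) S T)" and c: "0 \<le> c"
    and bound: "AE x in simplex_measure (Suc n) S T. op_norm (f x) \<le> c * gap_prod a n x"
  shows "volterra_norm S T n f \<le> ennreal (c * exp (l * (T - S)) * sqrt \<beta> ^ n)"
    and "l2sq (simplex_measure (Suc n) S T) f \<le> ennreal ((T - S) * ((real CARD('d))\<^sup>2 * (c * exp (l * (T - S)) * sqrt \<beta> ^ n))\<^sup>2)"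
proof -
  let ?E = "exp (l * (T - S))"
  let ?V = "c * ?E * sqrt \<beta> ^ n"
  let ?J = "\<lambda>t. \<integral>\<^sup>+s. ennreal ((op_norm (f (s(n := t))))\<^sup>2) \<partial>simplex_measure n t T"
  have V0: "0 \<le> ?V" using c \<beta> by simp
  have gp: "0 \<le> gap_prod a m t" for m t by (rule gap_prod_nonneg[OF a0])
  have E1: "1 \<le> ?E" using l ST by simp
  have fm: "(\<lambda>x. ennreal ((op_norm (f x))\<^sup>2)) \<in> borel_measurable (simplex_measure (Suc n) S T)"
    using borel_measurable_op_norm[OF f] by measurable
  have J: "AE t in time_interval S T. ?J t \<le> ennreal (?V\<^sup>2)"
    using AE_simplex_last[OF bound] AE_space
  proof eventually_elim
    case (elim t)
    have "?J t \<le> (\<integral>\<^sup>+s. ennreal (c\<^sup>2) * ennreal ((gap_prod a n (s(n := t)))\<^sup>2) \<partial>simplex_measure n t T)"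
    proof (rule nn_integral_mono_AE, use elim(1) in eventually_elim)
      case (elim s)
      then have "(op_norm (f (s(n := t))))\<^sup>2 \<le> (c * gap_prod a n (s(n := t)))\<^sup>2" by (intro power_mono) auto
      then show ?case by (simp add: ennreal_mult[symmetric] power_mult_distrib)
    qed
    also have "\<dots> = ennreal (c\<^sup>2) * (\<integral>\<^sup>+s. ennreal ((gap_prod a n (s(n := t)))\<^sup>2) \<partial>simplex_measure n t T)"
    proof (rule nn_integral_cmult)
      have "(\<lambda>s. a ((s(n := t)) i - (s(n := t)) (Suc i))) \<in> borel_measurable (simplex_measure n t T)" if "i \<in> {..<n}" for i
        unfolding simplex_measure_def using that
        by (intro measurable_restrict_space1 measurable_compose[OF gap_prod_term_measurable a]) simp
      then have "(\<lambda>s. gap_prod a n (s(n := t))) \<in> borel_measurable (simplex_measure n t T)"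
        unfolding gap_prod_def by (rule borel_measurable_prod)
      then show "(\<lambda>s. ennreal ((gap_prod a n (s(n := t)))\<^sup>2)) \<in> borel_measurable (simplex_measure n t T)" by measurable
    qed
    also have "\<dots> \<le> ennreal (c\<^sup>2) * ennreal (?E * \<beta> ^ n)"
      using elim(2) by (intro mult_left_mono nn_integral_gap_prod_sq_le[OF a a0 l \<beta>]) auto
    also have "\<dots> = ennreal (c\<^sup>2 * (?E * \<beta> ^ n))" using \<beta>(2) by (simp add: ennreal_mult)
    \<comment> \<open>As \<open>?E\<close> is at least 1 it may be replaced by its square, which
      makes the bound a perfect square.\<close>
    also have "\<dots> \<le> ennreal (?V\<^sup>2)"
    proof (rule ennreal_leI)
      have "(sqrt \<beta> ^ n)\<^sup>2 = \<beta> ^ n" using \<beta>(2) by (simp add: power_mult[symmetric] mult.commute[of n] power_mult)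
      then have "?V\<^sup>2 = c\<^sup>2 * (?E * ?E * \<beta> ^ n)" by (simp add: power_mult_distrib power2_eq_square[of ?E])
      moreover have "?E * 1 \<le> ?E * ?E" using E1 by (intro mult_left_mono) auto
      ultimately show "c\<^sup>2 * (?E * \<beta> ^ n) \<le> ?V\<^sup>2"
        using \<beta>(2) by (simp only:) (intro mult_left_mono mult_right_mono; simp)
    qed
    finally show ?case .
  qed
  show "volterra_norm S T n f \<le> ennreal ?V"
    unfolding volterra_norm_eq
  proof (rule esssup_I)
    show "(\<lambda>t. sqrt_ennreal (?J t)) \<in> borel_measurable (time_interval S T)"
      by (rule sqrt_ennreal_measurable[OF nn_integral_simplex_last(2)[OF fm]])
    show "AE t in time_interval S T. sqrt_ennreal (?J t) \<le> ennreal ?V"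
      using J by eventually_elim (rule sqrt_ennreal_le[OF _ V0])
  qed
  let ?d = "(real CARD('d))\<^sup>2"
  have "l2sq (simplex_measure (Suc n) S T) f \<le> (\<integral>\<^sup>+x. ennreal (?d\<^sup>2) * ennreal ((op_norm (f x))\<^sup>2) \<partial>simplex_measure (Suc n) S T)"
    unfolding l2sq_def
  proof (rule nn_integral_mono)
    fix x
    have "(norm (f x))\<^sup>2 \<le> (?d * op_norm (f x))\<^sup>2" by (intro power_mono norm_le_op_norm) simp
    then have "ennreal ((norm (f x))\<^sup>2) \<le> ennreal (?d\<^sup>2 * (op_norm (f x))\<^sup>2)" by (simp only: power_mult_distrib ennreal_leI)
    then show "ennreal ((norm (f x))\<^sup>2) \<le> ennreal (?d\<^sup>2) * ennreal ((op_norm (f x))\<^sup>2)"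
      by (simp only: ennreal_mult zero_le_power2)
  qed
  also have "\<dots> = ennreal (?d\<^sup>2) * (\<integral>\<^sup>+t. ?J t \<partial>time_interval S T)"
    unfolding nn_integral_cmult[OF fm] nn_integral_simplex_last(1)[OF fm] ..
  also have "\<dots> \<le> ennreal (?d\<^sup>2) * (\<integral>\<^sup>+t. ennreal (?V\<^sup>2) \<partial>time_interval S T)"
    by (intro mult_left_mono nn_integral_mono_AE J) simp
  also have "(\<integral>\<^sup>+t. ennreal (?V\<^sup>2) \<partial>time_interval S T) = ennreal (?V\<^sup>2) * ennreal (T - S)"
    using ST by (simp add: emeasure_restrict_space)
  also have "ennreal (?d\<^sup>2) * (ennreal (?V\<^sup>2) * ennreal (T - S)) = ennreal (?d\<^sup>2 * (?V\<^sup>2 * (T - S)))"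
    using ST by (simp only: ennreal_mult zero_le_power2 mult_nonneg_nonneg diff_ge_0_iff_ge less_imp_le)
  also have "?d\<^sup>2 * (?V\<^sup>2 * (T - S)) = (T - S) * (?d * ?V)\<^sup>2"
    by (simp only: power_mult_distrib mult_ac)
  finally show "l2sq (simplex_measure (Suc n) S T) f \<le> ennreal ((T - S) * (?d * ?V)\<^sup>2)" .
qed

text \<open>Where \<open>a\<close> is nonzero the argument is positive, so the weights are at most 1
  and tend to 0 as \<open>l\<close> grows. Dominated convergence applies, with the square of
  \<open>a\<close> as the dominating function.\<close>

lemma exists_small_weighted_mass:
  assumes a: "a \<in> borel_measurable borel" and supp: "\<forall>x\<le>0. a x = 0"
    and fin: "(\<integral>\<^sup>+x. ennreal ((a x)\<^sup>2) \<partial>lborel) < \<infinity>" and e: "0 < e"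
  shows "\<exists>l \<beta>. 0 \<le> l \<and> 0 \<le> \<beta> \<and> \<beta> \<le> e \<and> (\<integral>\<^sup>+x. ennreal ((a x)\<^sup>2 * exp (- l * x)) \<partial>lborel) = ennreal \<beta>"
proof -
  have "(\<lambda>k::nat. \<integral>\<^sup>+x. ennreal ((a x)\<^sup>2 * exp (- real k * x)) \<partial>lborel) \<longlonglongrightarrow> (\<integral>\<^sup>+x. 0 \<partial>(lborel :: real measure))"
  proof (rule nn_integral_dominated_convergence[where w="\<lambda>x. ennreal ((a x)\<^sup>2)"])
    show "(\<lambda>x. ennreal ((a x)\<^sup>2 * exp (- real k * x))) \<in> borel_measurable lborel" for k using a by measurable
    show "(\<lambda>x. ennreal ((a x)\<^sup>2)) \<in> borel_measurable lborel" using a by measurable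
    show "AE x in lborel. ennreal ((a x)\<^sup>2 * exp (- real k * x)) \<le> ennreal ((a x)\<^sup>2)" for k
    proof (rule AE_I2)
      fix x show "ennreal ((a x)\<^sup>2 * exp (- real k * x)) \<le> ennreal ((a x)\<^sup>2)"
        by (cases "x \<le> 0") (auto simp: supp intro!: ennreal_leI mult_left_le)
    qed
    show "AE x in lborel. (\<lambda>k. ennreal ((a x)\<^sup>2 * exp (- real k * x))) \<longlonglongrightarrow> 0"
    proof (rule AE_I2)
      fix x :: real
      show "(\<lambda>k. ennreal ((a x)\<^sup>2 * exp (- real k * x))) \<longlonglongrightarrow> 0"
      proof (cases "x \<le> 0")
        case False
        have "norm (exp (- x)) < 1" using False by simp
        then have "(\<lambda>k. exp (- x) ^ k) \<longlonglongrightarrow> 0" by (rule LIMSEQ_power_zero)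
        then have "(\<lambda>k. (a x)\<^sup>2 * exp (- x) ^ k) \<longlonglongrightarrow> (a x)\<^sup>2 * 0" by (rule tendsto_mult[OF tendsto_const])
        moreover have "exp (- x) ^ k = exp (- real k * x)" for k by (simp add: exp_of_nat_mult[symmetric])
        ultimately have "(\<lambda>k. (a x)\<^sup>2 * exp (- real k * x)) \<longlonglongrightarrow> 0" by simp
        from tendsto_ennrealI[OF this] show ?thesis by simp
      qed (simp add: supp)
    qed
  qed (use fin in simp_all)
  then have "(\<lambda>k::nat. \<integral>\<^sup>+x. ennreal ((a x)\<^sup>2 * exp (- real k * x)) \<partial>lborel) \<longlonglongrightarrow> 0" by simp
  from order_tendstoD(2)[OF this, of "ennreal e"] e
  obtain k :: nat where k: "(\<integral>\<^sup>+x. ennreal ((a x)\<^sup>2 * exp (- real k * x)) \<partial>lborel) < ennreal e"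
    by (auto simp: eventually_sequentially)
  then obtain \<beta> where \<beta>: "0 \<le> \<beta>" "(\<integral>\<^sup>+x. ennreal ((a x)\<^sup>2 * exp (- real k * x)) \<partial>lborel) = ennreal \<beta>"
    by (cases "\<integral>\<^sup>+x. ennreal ((a x)\<^sup>2 * exp (- real k * x)) \<partial>lborel") auto
  with k have "\<beta> \<le> e" by (simp add: ennreal_less_iff)
  with \<beta> show ?thesis by (intro exI[of _ "real k"] exI[of _ \<beta>]) simp
qed

lemma kernel_sequence_summable:
  fixes f :: "nat \<Rightarrow> (nat \<Rightarrow> real) \<Rightarrow> real^'d^'d"
  assumes ST: "S < T" and a: "a \<in> borel_measurable borel" and a0: "\<And>x. 0 \<le> a x"
    and supp: "\<forall>x\<le>0. a x = 0" and fin: "(\<integral>\<^sup>+x. ennreal ((a x)\<^sup>2) \<partial>lborel) < \<infinity>"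
    and f: "\<And>n. f n \<in> borel_measurable (simplex_measure (Suc n) S T)" and D: "0 \<le> D" "0 < B"
    and bound: "\<And>n. AE x in simplex_measure (Suc n) S T. op_norm (f n x) \<le> D * B ^ n * gap_prod a n x"
  shows "f n \<in> L2_simplex (Suc n) S T" "(\<Sum>n. l2sq (simplex_measure (Suc n) S T) (f n)) < \<infinity>"
    "f n \<in> volterra_space S T n" "(\<Sum>n. volterra_norm S T n (f n)) < \<infinity>"
proof -
  \<comment> \<open>This level makes \<open>B * sqrt \<beta>\<close> at most 1/2, so the bounds
    decay like powers of 1/2 for the Volterra norms and of 1/4 for the squared L2 norms.\<close>
  have "0 < (1 / (2 * B))\<^sup>2" using D by simp
  from exists_small_weighted_mass[OF a supp fin this]
  obtain l \<beta> where l: "0 \<le> l" and \<beta>0: "0 \<le> \<beta>" and \<beta>e: "\<beta> \<le> (1 / (2 * B))\<^sup>2"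
    and \<beta>: "(\<integral>\<^sup>+x. ennreal ((a x)\<^sup>2 * exp (- l * x)) \<partial>lborel) = ennreal \<beta>" by blast
  let ?E = "exp (l * (T - S))" and ?d = "(real CARD('d))\<^sup>2"
  have "sqrt \<beta> \<le> 1 / (2 * B)" using \<beta>e D by (intro real_le_lsqrt) (auto simp: \<beta>0)
  then have "B * sqrt \<beta> \<le> B * (1 / (2 * B))" using D by (intro mult_left_mono) auto
  then have sB: "B * sqrt \<beta> \<le> 1 / 2" using D by simp
  have V: "D * B ^ n * ?E * sqrt \<beta> ^ n \<le> D * ?E * (1/2) ^ n" for n
  proof -
    have "D * B ^ n * ?E * sqrt \<beta> ^ n = D * ?E * (B * sqrt \<beta>) ^ n" by (simp add: power_mult_distrib)
    also have "\<dots> \<le> D * ?E * (1/2) ^ n" using sB D \<beta>0 by (intro mult_left_mono power_mono) auto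
    finally show ?thesis .
  qed
  have c0: "0 \<le> D * B ^ n" for n using D by simp
  note kb = kernel_norm_bounds[OF ST a a0 l \<beta> \<beta>0 f c0 bound]
  have v: "volterra_norm S T n (f n) \<le> ennreal (D * ?E * (1/2) ^ n)" for n
    by (rule order_trans[OF kb(1) ennreal_leI[OF V]])
  have w: "l2sq (simplex_measure (Suc n) S T) (f n) \<le> ennreal ((T - S) * (?d * (D * ?E))\<^sup>2 * (1/4) ^ n)" for n
  proof -
    have "l2sq (simplex_measure (Suc n) S T) (f n) \<le> ennreal ((T - S) * (?d * (D * B ^ n * ?E * sqrt \<beta> ^ n))\<^sup>2)"
      by (rule kb(2))
    also have "\<dots> \<le> ennreal ((T - S) * (?d * (D * ?E * (1/2) ^ n))\<^sup>2)"
      using ST D \<beta>0 by (intro ennreal_leI mult_left_mono power_mono V) auto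
    also have "(T - S) * (?d * (D * ?E * (1/2) ^ n))\<^sup>2 = (T - S) * (?d * (D * ?E))\<^sup>2 * (1/4) ^ n"
    proof -
      have "((1/2 :: real) ^ n)\<^sup>2 = (1/4) ^ n" by (simp add: power2_eq_square power_mult_distrib[symmetric])
      then show ?thesis by (simp add: power_mult_distrib)
    qed
    finally show ?thesis .
  qed
  show "f n \<in> L2_simplex (Suc n) S T"
    using w[of n] by (intro L2_simplexI f) (auto elim!: order.strict_trans1)
  show "f n \<in> volterra_space S T n"
    using v[of n] f unfolding volterra_space_def by (auto elim!: order.strict_trans1)
  have geo: "(\<Sum>n. ennreal (c * r ^ n)) < \<infinity>" if "0 \<le> c" "0 \<le> r" "r < 1" for c r :: real
  proof -
    have "(\<Sum>n. ennreal (c * r ^ n)) = ennreal (\<Sum>n. c * r ^ n)"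
      using that by (intro suminf_ennreal2) (auto intro!: summable_mult summable_geometric)
    then show ?thesis by simp
  qed
  have "(\<Sum>n. volterra_norm S T n (f n)) \<le> (\<Sum>n. ennreal (D * ?E * (1/2) ^ n))" by (intro suminf_le v) auto
  also have "\<dots> < \<infinity>" using D by (intro geo) auto
  finally show "(\<Sum>n. volterra_norm S T n (f n)) < \<infinity>" .
  have "(\<Sum>n. l2sq (simplex_measure (Suc n) S T) (f n)) \<le> (\<Sum>n. ennreal ((T - S) * (?d * (D * ?E))\<^sup>2 * (1/4) ^ n))"
    by (intro suminf_le w) auto
  also have "\<dots> < \<infinity>" using ST by (intro geo) auto
  finally show "(\<Sum>n. l2sq (simplex_measure (Suc n) S T) (f n)) < \<infinity>" .
qed

section \<open>Existence of the resolvent\<close>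

text \<open>Bridge between the essential supremum over times, in which order 0 is given, and the
  one-dimensional simplex, on which the algebra works.\<close>

lemma AE_simplex_1:
  assumes P: "{x\<in>ord_simplex 1 S T. \<not> P x} \<in> sets (simplex_measure 1 S T)"
    and AE: "AE t in time_interval S T. P (\<lambda>i\<in>{..<1}. t)"
  shows "AE x in simplex_measure 1 S T. P x"
proof -
  let ?N = "{x\<in>ord_simplex 1 S T. \<not> P x}"
  have m: "(indicator ?N :: _ \<Rightarrow> ennreal) \<in> borel_measurable (simplex_measure (Suc 0) S T)"
    using P by (intro borel_measurable_indicator) simp
  have upd: "(\<lambda>_. undefined)(0::nat := t) = (\<lambda>i\<in>{..<1}. t)" for t :: real by (auto simp: fun_eq_iff)
  have "(\<integral>\<^sup>+x. indicator ?N x \<partial>simplex_measure (Suc 0) S T) = (\<integral>\<^sup>+t. indicator ?N (\<lambda>i\<in>{..<1}. t) \<partial>time_interval S T)"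
    unfolding nn_integral_simplex_last(1)[OF m] nn_integral_simplex_0 upd ..
  also have "\<dots> = (\<integral>\<^sup>+t. 0 \<partial>time_interval S T)"
    by (rule nn_integral_cong_AE, use AE in eventually_elim) (simp add: indicator_def)
  finally have "AE x in simplex_measure (Suc 0) S T. indicator ?N x = (0::ennreal)"
    using nn_integral_0_iff_AE[OF m] by simp
  then show ?thesis using AE_space unfolding One_nat_def
    by eventually_elim (auto simp: indicator_def split: if_splits)
qed

context brownian
begin

text \<open>\<open>chaos_coeff\<close> is some choice of coefficients. Uniqueness identifies it with
  \<open>f\<close> almost everywhere, and an almost everywhere bound survives this, so the norm
  estimates apply to the chosen sequence.\<close>

lemma star_kernels_I:
  fixes \<xi> :: "real \<Rightarrow> 'w \<Rightarrow> real^'d^'d"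
  assumes ST: "S < T" and a: "a \<in> borel_measurable borel" "\<And>x. 0 \<le> a x" "\<forall>x\<le>0. a x = 0"
      "(\<integral>\<^sup>+x. ennreal ((a x)\<^sup>2) \<partial>lborel) < \<infinity>"
    and \<xi>: "\<xi> \<in> L2_adapted M W S T" "has_chaos_expansion M W S T \<xi> f" and D: "0 \<le> D" "0 < B"
    and bound: "\<And>n. AE x in simplex_measure (Suc n) S T. op_norm (f n x) \<le> D * B ^ n * gap_prod a n x"
  shows "\<xi> \<in> star_kernels M W S T" "\<And>n. AE x in simplex_measure (Suc n) S T. chaos_coeff M W S T \<xi> n x = f n x"
proof -
  let ?c = "chaos_coeff M W S T \<xi>"
  have e: "has_chaos_expansion M W S T \<xi> ?c" by (rule has_chaos_expansion_chaos_coeff[OF \<xi>(2)])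
  show eq: "AE x in simplex_measure (Suc n) S T. ?c n x = f n x" for n
    by (rule has_chaos_expansion_unique[OF \<xi>(1) e \<xi>(2)])
  have "?c n \<in> L2_simplex (Suc n) S T" for n using e unfolding has_chaos_expansion_def by blast
  note m = L2_simplexD(1)[OF this]
  have b: "AE x in simplex_measure (Suc n) S T. op_norm (?c n x) \<le> D * B ^ n * gap_prod a n x" for n
    using eq[of n] bound[of n] by eventually_elim simp
  have "\<forall>n. ?c n \<in> volterra_space S T n" "(\<Sum>n. volterra_norm S T n (?c n)) < \<infinity>"
    using kernel_sequence_summable(3,4)[OF ST a m D b] by blast+
  with \<xi>(1) e show "\<xi> \<in> star_kernels M W S T" unfolding star_kernels_def by blast
qed

lemma star_kernelsD:
  assumes "\<xi> \<in> star_kernels M W S T"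
  shows "\<xi> \<in> L2_adapted M W S T" "has_chaos_expansion M W S T \<xi> (chaos_coeff M W S T \<xi>)"
  using assms unfolding star_kernels_def by blast+

text \<open>\<open>Z\<close> witnesses the choice made by \<open>star_prod\<close>, so the chosen
  process has the same coefficients; and coefficients determine the process.\<close>

lemma process_eq_star_prod:
  fixes K\<^sub>1 K\<^sub>2 Z :: "real \<Rightarrow> 'w \<Rightarrow> real^'d^'d"
  assumes Z: "Z \<in> star_kernels M W S T"
    and eq: "\<And>n. AE t in simplex_measure (Suc n) S T. chaos_coeff M W S T Z n t =
       (\<Sum>k=0..n. triangle_prod (n - k) k (chaos_coeff M W S T K\<^sub>1 (n - k)) (chaos_coeff M W S T K\<^sub>2 k) t)"
  shows "process_eq M S T Z (star_prod M W S T K\<^sub>1 K\<^sub>2)"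
proof -
  let ?P = "\<lambda>Z. Z \<in> star_kernels M W S T \<and> (\<forall>n. AE t in simplex_measure (Suc n) S T. chaos_coeff M W S T Z n t =
       (\<Sum>k=0..n. triangle_prod (n - k) k (chaos_coeff M W S T K\<^sub>1 (n - k)) (chaos_coeff M W S T K\<^sub>2 k) t))"
  have "?P (star_prod M W S T K\<^sub>1 K\<^sub>2)"
    unfolding star_prod_def by (rule someI[where P="?P"]) (use Z eq in blast)
  then have P: "star_prod M W S T K\<^sub>1 K\<^sub>2 \<in> star_kernels M W S T"
    "\<And>n. AE t in simplex_measure (Suc n) S T. chaos_coeff M W S T (star_prod M W S T K\<^sub>1 K\<^sub>2) n t =
       (\<Sum>k=0..n. triangle_prod (n - k) k (chaos_coeff M W S T K\<^sub>1 (n - k)) (chaos_coeff M W S T K\<^sub>2 k) t)" by blast+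
  show ?thesis
  proof (rule has_chaos_expansion_process_eq[OF star_kernelsD(1)[OF Z] star_kernelsD(1)[OF P(1)] star_kernelsD(2)[OF Z] star_kernelsD(2)[OF P(1)]])
    show "AE x in simplex_measure (Suc n) S T. chaos_coeff M W S T Z n x = chaos_coeff M W S T (star_prod M W S T K\<^sub>1 K\<^sub>2) n x" for n
      using eq[of n] P(2)[of n] by eventually_elim simp
  qed
qed

text \<open>Each factor sees a window of the point, and exceptional null sets stay null on passing
  to windows.\<close>

lemma AE_triangle_prod_cong:
  assumes f: "AE x in simplex_measure (Suc m) S T. f x = f' x" and g: "AE x in simplex_measure (Suc n) S T. g x = g' x"
  shows "AE x in simplex_measure (Suc (m + n)) S T. triangle_prod m n f g x = triangle_prod m n f' g' x"
proof -
  have "AE x in simplex_measure (Suc (m + n)) S T. f (\<lambda>i\<in>{..m}. x i) = f' (\<lambda>i\<in>{..m}. x i)"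
    using AE_simplex_window[OF f, of 0 n] by (simp only: lessThan_Suc_atMost add_0 add_Suc)
  moreover have "AE x in simplex_measure (Suc (m + n)) S T. g (\<lambda>i\<in>{..n}. x (m + i)) = g' (\<lambda>i\<in>{..n}. x (m + i))"
    using AE_simplex_window[OF g, of m 0] by (simp only: lessThan_Suc_atMost add_0_right add_Suc_right)
  ultimately show ?thesis by eventually_elim (simp add: triangle_prod_def)
qed

theorem star_resolvent_exists:
  fixes K :: "real \<Rightarrow> 'w \<Rightarrow> real^'d^'d"
  assumes ST: "S < T" and K: "K \<in> star_kernels M W S T"
    and q: "q < 1" "AE x in simplex_measure (Suc 0) S T. op_norm (chaos_coeff M W S T K 0 x) \<le> q"
    and a: "a \<in> borel_measurable borel" "\<And>x. 0 \<le> a x" "\<forall>x\<le>0. a x = 0"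
      "(\<integral>\<^sup>+x. ennreal ((a x)\<^sup>2) \<partial>lborel) < \<infinity>"
    and bound: "\<And>n. n \<ge> 1 \<Longrightarrow> AE x in simplex_measure (Suc n) S T. op_norm (chaos_coeff M W S T K n x) \<le> gap_prod a n x"
    and q0: "0 \<le> q"
  shows "\<exists>R. star_resolvent M W S T K R"
proof -
  let ?k = "chaos_coeff M W S T K"
  note K' = star_kernelsD[OF K]
  have "?k n \<in> L2_simplex (Suc n) S T" for n using K'(2) unfolding has_chaos_expansion_def by blast
  note km = L2_simplexD(1)[OF this]
  let ?B = "\<lambda>n x. if n = 0 then q else gap_prod a n x"
  \<comment> \<open>The recursion wants the bounds at every point, also on windows. The coefficients
    are therefore replaced by 0 outside the simplex and on the null set where their bound fails,
    which is \<open>q\<close> in order 0.\<close>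
  define k where "k n x = (if x \<in> ord_simplex (Suc n) S T \<and> op_norm (?k n x) \<le> ?B n x then ?k n x else 0)" for n x
  have gm: "gap_prod a n \<in> borel_measurable (lborel_n (Suc n))" for n
  proof -
    have "(\<lambda>x. x i) \<in> borel_measurable (lborel_n (Suc n))" if "i < Suc n" for i
      using measurable_component_singleton[of i "{..<Suc n}" "\<lambda>_. lborel"] that by simp
    then have "(\<lambda>x. \<Prod>i<n. a (x i - x (Suc i))) \<in> borel_measurable (lborel_n (Suc n))"
      by (intro borel_measurable_prod measurable_compose[OF borel_measurable_diff a(1)]) simp_all
    then show ?thesis unfolding gap_prod_def[abs_def] .
  qed
  have k_measurable: "k n \<in> borel_measurable (lborel_n (Suc n))" for n
  proof -
    let ?N = "simplex_measure (Suc n) S T"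
    have Bm: "?B n \<in> borel_measurable ?N"
      unfolding simplex_measure_def by (cases "n = 0") (simp_all add: measurable_restrict_space1[OF gm])
    have "{x\<in>space ?N. op_norm (?k n x) \<le> ?B n x} \<in> sets ?N"
      by (rule borel_measurable_le[OF borel_measurable_op_norm[OF km] Bm])
    then have "(\<lambda>x. if op_norm (?k n x) \<le> ?B n x then ?k n x else 0) \<in> borel_measurable ?N"
      by (intro measurable_If km borel_measurable_const)
    then have "(\<lambda>x. indicat_real (ord_simplex (Suc n) S T) x *\<^sub>R (if op_norm (?k n x) \<le> ?B n x then ?k n x else 0)) \<in> borel_measurable (lborel_n (Suc n))"
      unfolding simplex_measure_def
      by (subst (asm) borel_measurable_restrict_space_iff) (simp_all add: ord_simplex_subset_space ord_simplex_sets)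
    moreover have "(\<lambda>x. indicat_real (ord_simplex (Suc n) S T) x *\<^sub>R (if op_norm (?k n x) \<le> ?B n x then ?k n x else 0)) = k n"
      by (auto simp: k_def fun_eq_iff indicator_def)
    ultimately show ?thesis by (simp only:)
  qed
  have k_eq: "AE x in simplex_measure (Suc n) S T. ?k n x = k n x" for n
  proof -
    have "AE x in simplex_measure (Suc n) S T. op_norm (?k n x) \<le> ?B n x"
    proof (cases n)
      case 0 show ?thesis unfolding 0 using q(2) by simp
    next
      case (Suc m) then show ?thesis using bound[of n] by simp
    qed
    then show ?thesis using AE_space by eventually_elim (simp only: k_def space_simplex_measure if_True simp_thms)
  qed
  have gp0: "0 \<le> gap_prod a n x" for n x by (rule gap_prod_nonneg[OF a(2)])
  have k0: "op_norm (k 0 x) \<le> q" for x using q0 by (simp add: k_def)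
  have kn: "op_norm (k n x) \<le> gap_prod a n x" if "n \<ge> 1" for n x using gp0 that by (simp add: k_def)
  define C where "C = 1 / (1 - q)"
  have C1: "1 \<le> C" using q0 q(1) by (simp add: C_def field_simps)
  define r where "r = resolvent_coeff k"
  have geo1: "1 \<le> C * (1 + C) ^ n" for n
  proof -
    have "1 * 1 \<le> C * (1 + C) ^ n" using C1 by (intro mult_mono one_le_power) auto
    then show ?thesis by simp
  qed
  \<comment> \<open>Twice the bound for the series: the second copy covers the unit in order 0,
    where \<open>1 \<le> C\<close>.\<close>
  have r_bound: "op_norm (r n x) \<le> 2 * C * (1 + C) ^ n * gap_prod a n x" for n x
  proof -
    have "op_norm (r n x) \<le> op_norm (resolvent_series k n x) + op_norm (if n = 0 then mat 1 else 0 :: real^'d^'d)"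
      unfolding r_def resolvent_coeff_def by (rule op_norm_diff_le)
    also have "op_norm (if n = 0 then mat 1 else 0 :: real^'d^'d) \<le> (if n = 0 then 1 else 0)"
      using op_norm_mat_1[where 'd='d] by simp
    also have "\<dots> \<le> C * (1 + C) ^ n * gap_prod a n x"
      using geo1[of n] C1 gp0 by (cases "n = 0") (simp_all add: gap_prod_def)
    also have "op_norm (resolvent_series k n x) \<le> C * (1 + C) ^ n * gap_prod a n x"
      by (rule op_norm_resolvent_series_le[OF k0 q(1) a(2) kn C_def])
    finally show ?thesis by (simp add: mult_ac)
  qed
  \<comment> \<open>A third copy of the bound covers \<open>k\<close>; in order 0 this uses that
    \<open>q\<close> is below 1 and \<open>C\<close> at least 1.\<close>
  have rk_bound: "op_norm (r n x - k n x) \<le> 3 * C * (1 + C) ^ n * gap_prod a n x" for n x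
  proof -
    have "op_norm (k n x) \<le> C * (1 + C) ^ n * gap_prod a n x"
    proof (cases "n = 0")
      case True then show ?thesis using k0[of x] q(1) C1 by (simp add: gap_prod_def)
    next
      case False
      then have "op_norm (k n x) \<le> 1 * gap_prod a n x" using kn[of n x] by simp
      also have "\<dots> \<le> C * (1 + C) ^ n * gap_prod a n x" by (intro mult_right_mono geo1 gp0)
      finally show ?thesis .
    qed
    then show ?thesis using op_norm_diff_le[of "r n x" "k n x"] r_bound[of n x] by (simp add: mult_ac)
  qed
  have r_measurable: "r n \<in> borel_measurable (simplex_measure (Suc n) S T)" for n
  proof -
    have "(\<lambda>x. resolvent_series k n x - (if n = 0 then mat 1 else 0)) \<in> borel_measurable (lborel_n (Suc n))"
      by (intro borel_measurable_diff resolvent_series_measurable k_measurable borel_measurable_const)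
    then show ?thesis
      unfolding simplex_measure_def r_def resolvent_coeff_def[abs_def] by (rule measurable_restrict_space1)
  qed
  have D: "0 \<le> 2 * C" "0 \<le> 3 * C" "0 < 1 + C" using C1 by auto
  note summ = kernel_sequence_summable[OF ST a r_measurable D(1,3) AE_I2[OF r_bound]]
  have "S \<le> T" using ST by simp
  from has_chaos_expansion_exists[OF this summ(1,2)]
  obtain R where R: "R \<in> L2_adapted M W S T" "has_chaos_expansion M W S T R r" by blast
  note Rk = star_kernels_I[OF ST a R D(1,3) AE_I2[OF r_bound]]
  \<comment> \<open>The candidate for both star products: its coefficients are those of
    \<open>R\<close> minus those of \<open>K\<close>, and the two resolvent equations turn them into
    the two convolutions.\<close>
  define Z where "Z t \<omega> = R t \<omega> - K t \<omega>" for t \<omega>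
  have Z: "Z \<in> L2_adapted M W S T" "has_chaos_expansion M W S T Z (\<lambda>n x. r n x - ?k n x)"
    unfolding Z_def using L2_adapted_diff[OF R(1) K'(1)] has_chaos_expansion_diff(1)[OF R(1) K'(1) R(2) K'(2)] by blast+
  have "AE x in simplex_measure (Suc n) S T. op_norm (r n x - ?k n x) \<le> 3 * C * (1 + C) ^ n * gap_prod a n x" for n
    using k_eq[of n] by eventually_elim (simp only: rk_bound)
  note Zk = star_kernels_I[OF ST a Z D(2,3) this]
  have ext: "x \<in> extensional {..n}" if "x \<in> ord_simplex (Suc n) S T" for n x
    using that by (simp add: ord_simplex_def lessThan_Suc_atMost)
  have prod_AE: "AE x in simplex_measure (Suc n) S T.
      (\<Sum>j=0..n. triangle_prod (n - j) j (f (n - j)) (g j) x) = (\<Sum>j=0..n. triangle_prod (n - j) j (f' (n - j)) (g' j) x)"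
    if fg: "\<And>n. AE x in simplex_measure (Suc n) S T. f n x = f' n x" "\<And>n. AE x in simplex_measure (Suc n) S T. g n x = g' n x"
    for n and f f' g g' :: "nat \<Rightarrow> (nat \<Rightarrow> real) \<Rightarrow> real^'d^'d"
  proof -
    have "AE x in simplex_measure (Suc n) S T. \<forall>j\<in>{0..n}. triangle_prod (n - j) j (f (n - j)) (g j) x = triangle_prod (n - j) j (f' (n - j)) (g' j) x"
    proof (rule AE_finite_allI)
      fix j assume "j \<in> {0..n}"
      then have "n - j + j = n" by simp
      then show "AE x in simplex_measure (Suc n) S T. triangle_prod (n - j) j (f (n - j)) (g j) x = triangle_prod (n - j) j (f' (n - j)) (g' j) x"
        using AE_triangle_prod_cong[OF fg(1) fg(2), of "n - j" j] by (simp only:)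
    qed simp
    then show ?thesis by eventually_elim (rule sum.cong, simp_all)
  qed
  have eqL: "AE x in simplex_measure (Suc n) S T. chaos_coeff M W S T Z n x =
      (\<Sum>j=0..n. triangle_prod (n - j) j (?k (n - j)) (chaos_coeff M W S T R j) x)" for n
    using Zk(2)[of n] k_eq[of n] prod_AE[OF k_eq Rk(2), of n] AE_space
  proof eventually_elim
    case (elim x)
    have "r n x = k n x + (\<Sum>j=0..n. triangle_prod (n - j) j (k (n - j)) (r j) x)"
      unfolding r_def using elim(4) by (intro resolvent_coeff_left[where k=k and q=q, OF k0 q(1)] ext) (simp only: space_simplex_measure)
    with elim(1-3) show ?case by simp
  qed
  have eqR: "AE x in simplex_measure (Suc n) S T. chaos_coeff M W S T Z n x =
      (\<Sum>j=0..n. triangle_prod (n - j) j (chaos_coeff M W S T R (n - j)) (?k j) x)" for n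
    using Zk(2)[of n] k_eq[of n] prod_AE[OF Rk(2) k_eq, of n] AE_space
  proof eventually_elim
    case (elim x)
    have "r n x = k n x + (\<Sum>j=0..n. triangle_prod (n - j) j (r (n - j)) (k j) x)"
      unfolding r_def using elim(4) by (intro resolvent_coeff_right[where k=k and q=q, OF k0 q(1)] ext) (simp only: space_simplex_measure)
    with elim(1-3) show ?case by simp
  qed
  have fin: "process_eq M S T R (\<lambda>t \<omega>. K t \<omega> + Y t \<omega>)" if "process_eq M S T Z Y" for Y
    using that unfolding process_eq_def by eventually_elim (auto simp: Z_def diff_eq_eq add.commute)
  have "star_resolvent M W S T K R"
    unfolding star_resolvent_def
    by (intro conjI Rk(1) fin process_eq_star_prod[OF Zk(1)] eqL eqR)
  then show ?thesis by blast
qed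

end

theorem corollary5p6:
  fixes M :: "'w measure" and W :: "real \<Rightarrow> 'w \<Rightarrow> real" and S T :: real
    and K :: "real \<Rightarrow> 'w \<Rightarrow> real^'d^'d"
  assumes "prob_space M" and "complete_measure M" and "brownian_motion M W"
    and "0 \<le> S" and "S < T"
    and "K \<in> star_kernels M W S T"
    and "esssup (time_interval S T)
           (\<lambda>t. ennreal (op_norm (chaos_coeff M W S T K 0 (\<lambda>i\<in>{..<1}. t)))) < 1"
    and "\<exists>a :: real \<Rightarrow> real.
           a \<in> borel_measurable (time_interval 0 (T - S)) \<and>
           (\<forall>x\<in>{0<..<T - S}. 0 \<le> a x) \<and>
           (\<integral>\<^sup>+x. ennreal ((a x)\<^sup>2) \<partial>time_interval 0 (T - S)) < \<infinity> \<and>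
           (\<forall>n\<ge>1. AE t in simplex_measure (Suc n) S T.
              op_norm (chaos_coeff M W S T K n t) \<le> (\<Prod>i=1..n. a (t (i - 1) - t i)))"
  shows "\<exists>R. star_resolvent M W S T K R"
proof -
  interpret brownian M W S
    using assms(1,3,4) by (intro brownian.intro brownian_axioms.intro)
  let ?k = "chaos_coeff M W S T K"
  let ?e = "esssup (time_interval S T) (\<lambda>t. ennreal (op_norm (?k 0 (\<lambda>i\<in>{..<1}. t))))"
  define q where "q = enn2real ?e"
  have "?e < top" using assms(7) by (rule order.strict_trans) simp
  then have e: "?e = ennreal q" "0 \<le> q" unfolding q_def by simp_all
  have q1: "q < 1" using assms(7) e by simp
  have "AE t in time_interval S T. op_norm (?k 0 (\<lambda>i\<in>{..<1}. t)) \<le> q"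
    using esssup_AE[of "\<lambda>t. ennreal (op_norm (?k 0 (\<lambda>i\<in>{..<1}. t)))" "time_interval S T"] unfolding e(1)
    by eventually_elim (simp add: e(2))
  moreover have "{x\<in>ord_simplex 1 S T. \<not> op_norm (?k 0 x) \<le> q} \<in> sets (simplex_measure 1 S T)"
  proof -
    have "?k 0 \<in> L2_simplex (Suc 0) S T"
      using star_kernelsD(2)[OF assms(6)] unfolding has_chaos_expansion_def by blast
    from borel_measurable_le[OF borel_measurable_op_norm[OF L2_simplexD(1)[OF this]] borel_measurable_const[of q]]
    have "{x\<in>ord_simplex 1 S T. op_norm (?k 0 x) \<le> q} \<in> sets (simplex_measure 1 S T)" by simp
    from sets.compl_sets[OF this]
    show ?thesis by (simp add: set_diff_eq) (rule back_subst[of "\<lambda>A. A \<in> sets (simplex_measure (Suc 0) S T)"], assumption, auto)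
  qed
  ultimately have "AE x in simplex_measure 1 S T. op_norm (?k 0 x) \<le> q"
    by (intro AE_simplex_1)
  then have k0: "AE x in simplex_measure (Suc 0) S T. op_norm (?k 0 x) \<le> q"
    by (simp only: One_nat_def)
  from assms(8) obtain a :: "real \<Rightarrow> real" where a: "a \<in> borel_measurable (time_interval 0 (T - S))"
    "\<And>x. x \<in> {0<..<T - S} \<Longrightarrow> 0 \<le> a x" "(\<integral>\<^sup>+x. ennreal ((a x)\<^sup>2) \<partial>time_interval 0 (T - S)) < \<infinity>"
    "\<And>n. n \<ge> 1 \<Longrightarrow> AE t in simplex_measure (Suc n) S T. op_norm (?k n t) \<le> (\<Prod>i=1..n. a (t (i - 1) - t i))"
    by blast
  \<comment> \<open>Outside \<open>{0<..<T - S}\<close> nothing is known about \<open>a\<close>, so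
    it is set to 0 there. All gaps of a point of the simplex lie in this interval, hence the bounds
    are unchanged.\<close>
  define b where "b x = indicat_real {0<..<T - S} x *\<^sub>R a x" for x
  show ?thesis
  proof (rule star_resolvent_exists[OF assms(5,6) q1 k0])
    show "b \<in> borel_measurable borel"
      using a(1) unfolding b_def[abs_def] by (subst (asm) borel_measurable_restrict_space_iff) simp_all
    show "0 \<le> b x" for x using a(2)[of x] by (simp add: b_def indicator_def)
    show "\<forall>x\<le>0. b x = 0" by (simp add: b_def indicator_def)
    have "(\<integral>\<^sup>+x. ennreal ((b x)\<^sup>2) \<partial>lborel) = (\<integral>\<^sup>+x. ennreal ((a x)\<^sup>2) \<partial>time_interval 0 (T - S))"
      unfolding nn_integral_time_interval by (intro nn_integral_cong) (simp add: b_def indicator_def)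
    then show "(\<integral>\<^sup>+x. ennreal ((b x)\<^sup>2) \<partial>lborel) < \<infinity>" using a(3) by simp
    show "AE x in simplex_measure (Suc n) S T. op_norm (?k n x) \<le> gap_prod b n x" if "n \<ge> 1" for n
      using a(4)[OF that] AE_space
    proof eventually_elim
      case (elim x)
      have "(\<Prod>i=1..n. a (x (i - 1) - x i)) = (\<Prod>i<n. a (x i - x (Suc i)))"
        by (rule prod.reindex_bij_witness[of _ Suc "\<lambda>i. i - 1"]) auto
      also have "\<dots> = gap_prod b n x"
        unfolding gap_prod_def
      proof (intro prod.cong refl)
        fix i assume "i \<in> {..<n}"
        then have "x (Suc i) < x i" "x i < T" "S < x (Suc i)" using elim(2) by (auto simp: ord_simplex_def)
        then show "a (x i - x (Suc i)) = b (x i - x (Suc i))" by (simp add: b_def indicator_def)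
      qed
      finally show ?case using elim(1) by simp
    qed
  qed (rule e(2))
qed

end
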